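(* Let $\mathcal{C}$ and $\mathcal{D}$ be two $(\mathrm{Ho}\,\mathbf{Cat})$-enriched categories, and let $F : \mathcal{C} \to \mathcal{D}$ be a $(\mathrm{Ho}\,\mathbf{Cat})$-enriched equivalence. (i) If $F : \mathcal{C} \to \mathcal{D}$ underlies a pseudofunctor between bicategories, then that pseudofunctor is a bicategorical equivalence. (ii) If $\mathcal{D}$ underlies a bicategory $\mathfrak{D}$, then $\mathcal{C}$ underlies a bicategory $\mathfrak{C}$ such that $F : \mathcal{C} \to \mathcal{D}$ underlies a bicategorical equivalence $\mathfrak{C} \to \mathfrak{D}$.
   Context: $\mathbf{Cat}$ is the category of small categories and functors. $\mathrm{Ho}\,\mathbf{Cat}$ is the localisation of $\mathbf{Cat}$ at the categorical equivalences (functors that are fully faithful and essentially surjective on objects); equivalently, its objects are small categories and its morphisms are natural-isomorphism classes of functors. It is cartesian closed; enrichment in $\mathrm{Ho}\,\mathbf{Cat}$ is with respect to its cartesian monoidal structure. Any bicategory (with small hom-categories) has an underlying $(\mathrm{Ho}\,\mathbf{Cat})$-enriched category, with the same objects, the same hom-categories, and identities and composition given by the isomorphism classes of the identity and horizontal composition functors (the unitors and associators being forgotten); likewise any pseudofunctor between bicategories has an underlying $(\mathrm{Ho}\,\mathbf{Cat})$-enriched functor. "Underlies" refers to this construction. A bicategorical equivalence is a pseudofunctor that is surjective on objects up to equivalence and induces equivalences on hom-categories. *)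

theory Defs
  imports Main "HOL-Library.FuncSet"
begin

section \<open>Small categories, functors and natural isomorphisms\<close>

text \<open>
  A small category has a set of objects and a set of arrows, both carved out of a type.
  The structure maps are required to be \<^const>\<open>undefined\<close> outside their domains, so that
  equality of records is equality of categories.
\<close>

record ('o, 'a) cat =
  Obj :: "'o set"
  Arr :: "'a set"
  Dom :: "'a \<Rightarrow> 'o"
  Cod :: "'a \<Rightarrow> 'o"
  Idt :: "'o \<Rightarrow> 'a"
  Cmp :: "'a \<Rightarrow> 'a \<Rightarrow> 'a"  (infixl "\<cdot>\<index>" 70)

definition arrs :: "('o, 'a) cat \<Rightarrow> 'o \<Rightarrow> 'o \<Rightarrow> 'a set" where
  "arrs A x y = {f \<in> Arr A. Dom A f = x \<and> Cod A f = y}"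

locale category =
  fixes A :: "('o, 'a) cat" (structure)
  assumes dom_closed: "f \<in> Arr A \<Longrightarrow> Dom A f \<in> Obj A"
    and cod_closed: "f \<in> Arr A \<Longrightarrow> Cod A f \<in> Obj A"
    and idt_closed: "x \<in> Obj A \<Longrightarrow> Idt A x \<in> arrs A x x"
    and cmp_closed: "\<lbrakk>f \<in> arrs A x y; g \<in> arrs A y z\<rbrakk> \<Longrightarrow> g \<cdot> f \<in> arrs A x z"
    and idt_left: "f \<in> arrs A x y \<Longrightarrow> Idt A y \<cdot> f = f"
    and idt_right: "f \<in> arrs A x y \<Longrightarrow> f \<cdot> Idt A x = f"
    and cmp_assoc: "\<lbrakk>f \<in> arrs A w x; g \<in> arrs A x y; h \<in> arrs A y z\<rbrakk>
      \<Longrightarrow> (h \<cdot> g) \<cdot> f = h \<cdot> (g \<cdot> f)"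
    and dom_ext: "Dom A \<in> extensional (Arr A)"
    and cod_ext: "Cod A \<in> extensional (Arr A)"
    and idt_ext: "Idt A \<in> extensional (Obj A)"
    and cmp_ext: "\<not> (f \<in> Arr A \<and> g \<in> Arr A \<and> Dom A g = Cod A f) \<Longrightarrow> g \<cdot> f = undefined"

definition iso_arrs :: "('o, 'a) cat \<Rightarrow> 'o \<Rightarrow> 'o \<Rightarrow> 'a set" where
  "iso_arrs A x y =
    {f \<in> arrs A x y. \<exists>g \<in> arrs A y x. g \<cdot>\<^bsub>A\<^esub> f = Idt A x \<and> f \<cdot>\<^bsub>A\<^esub> g = Idt A y}"

definition isomorphic :: "('o, 'a) cat \<Rightarrow> 'o \<Rightarrow> 'o \<Rightarrow> bool" where
  "isomorphic A x y \<longleftrightarrow> iso_arrs A x y \<noteq> {}"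

record ('o, 'a, 'p, 'b) funct =
  FO :: "'o \<Rightarrow> 'p"
  FA :: "'a \<Rightarrow> 'b"

locale is_functor =
  fixes A :: "('o, 'a) cat" and B :: "('p, 'b) cat" and F :: "('o, 'a, 'p, 'b) funct"
  assumes obj_closed: "x \<in> Obj A \<Longrightarrow> FO F x \<in> Obj B"
    and arr_closed: "f \<in> arrs A x y \<Longrightarrow> FA F f \<in> arrs B (FO F x) (FO F y)"
    and pres_idt: "x \<in> Obj A \<Longrightarrow> FA F (Idt A x) = Idt B (FO F x)"
    and pres_cmp: "\<lbrakk>f \<in> arrs A x y; g \<in> arrs A y z\<rbrakk>
      \<Longrightarrow> FA F (g \<cdot>\<^bsub>A\<^esub> f) = FA F g \<cdot>\<^bsub>B\<^esub> FA F f"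

definition nat_iso :: "('o, 'a) cat \<Rightarrow> ('p, 'b) cat \<Rightarrow>
    ('o, 'a, 'p, 'b) funct \<Rightarrow> ('o, 'a, 'p, 'b) funct \<Rightarrow> ('o \<Rightarrow> 'b) \<Rightarrow> bool" where
  "nat_iso A B F G \<tau> \<longleftrightarrow>
    (\<forall>x \<in> Obj A. \<tau> x \<in> iso_arrs B (FO F x) (FO G x)) \<and>
    (\<forall>x y. \<forall>f \<in> arrs A x y. \<tau> y \<cdot>\<^bsub>B\<^esub> FA F f = FA G f \<cdot>\<^bsub>B\<^esub> \<tau> x)"

definition cat_equivalence :: "('o, 'a) cat \<Rightarrow> ('p, 'b) cat \<Rightarrow> ('o, 'a, 'p, 'b) funct \<Rightarrow> bool" where
  "cat_equivalence A B F \<longleftrightarrow>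
    is_functor A B F \<and>
    (\<forall>x \<in> Obj A. \<forall>y \<in> Obj A. bij_betw (FA F) (arrs A x y) (arrs B (FO F x) (FO F y))) \<and>
    (\<forall>z \<in> Obj B. \<exists>x \<in> Obj A. isomorphic B (FO F x) z)"

definition fid :: "('o, 'a, 'o, 'a) funct" where
  "fid = \<lparr>FO = (\<lambda>x. x), FA = (\<lambda>f. f)\<rparr>"

definition fcomp :: "('p, 'b, 'q, 'c) funct \<Rightarrow> ('o, 'a, 'p, 'b) funct \<Rightarrow> ('o, 'a, 'q, 'c) funct"
    (infixr "\<circ>\<^sub>F" 55) where
  "G \<circ>\<^sub>F F = \<lparr>FO = FO G \<circ> FO F, FA = FA G \<circ> FA F\<rparr>"

subsection \<open>Finite products\<close>

definition prod_cat :: "('o, 'a) cat \<Rightarrow> ('p, 'b) cat \<Rightarrow> ('o \<times> 'p, 'a \<times> 'b) cat"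
    (infixr "\<times>\<^sub>C" 80) where
  "A \<times>\<^sub>C B = \<lparr>
    Obj = Obj A \<times> Obj B,
    Arr = Arr A \<times> Arr B,
    Dom = restrict (map_prod (Dom A) (Dom B)) (Arr A \<times> Arr B),
    Cod = restrict (map_prod (Cod A) (Cod B)) (Arr A \<times> Arr B),
    Idt = restrict (map_prod (Idt A) (Idt B)) (Obj A \<times> Obj B),
    Cmp = (\<lambda>g f. if f \<in> Arr A \<times> Arr B \<and> g \<in> Arr A \<times> Arr B \<and>
        Dom A (fst g) = Cod A (fst f) \<and> Dom B (snd g) = Cod B (snd f)
      then (fst g \<cdot>\<^bsub>A\<^esub> fst f, snd g \<cdot>\<^bsub>B\<^esub> snd f) else undefined)\<rparr>"

definition one_cat :: "(unit, unit) cat" where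
  "one_cat = \<lparr>Obj = UNIV, Arr = UNIV, Dom = (\<lambda>_. ()), Cod = (\<lambda>_. ()), Idt = (\<lambda>_. ()),
    Cmp = (\<lambda>_ _. ())\<rparr>"

definition fprod :: "('o, 'a, 'p, 'b) funct \<Rightarrow> ('o', 'a', 'p', 'b') funct
    \<Rightarrow> ('o \<times> 'o', 'a \<times> 'a', 'p \<times> 'p', 'b \<times> 'b') funct" (infixr "\<times>\<^sub>F" 80) where
  "F \<times>\<^sub>F G = \<lparr>FO = map_prod (FO F) (FO G), FA = map_prod (FA F) (FA G)\<rparr>"

definition pick :: "('o, 'a) cat \<Rightarrow> 'o \<Rightarrow> (unit, unit, 'o, 'a) funct" where
  "pick A x = \<lparr>FO = (\<lambda>_. x), FA = (\<lambda>_. Idt A x)\<rparr>"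

text \<open>The structural isomorphisms of the cartesian monoidal structure and their inverses:
  \<open>(A \<times> B) \<times> C \<rightarrow> A \<times> (B \<times> C)\<close>, \<open>A \<rightarrow> 1 \<times> A\<close> and \<open>A \<rightarrow> A \<times> 1\<close>.\<close>

definition fassoc :: "(('o \<times> 'p) \<times> 'q, ('a \<times> 'b) \<times> 'c, 'o \<times> 'p \<times> 'q, 'a \<times> 'b \<times> 'c) funct" where
  "fassoc = \<lparr>FO = (\<lambda>((x, y), z). (x, y, z)), FA = (\<lambda>((f, g), h). (f, g, h))\<rparr>"

definition funit_l :: "('o, 'a, unit \<times> 'o, unit \<times> 'a) funct" where
  "funit_l = \<lparr>FO = Pair (), FA = Pair ()\<rparr>"

definition funit_r :: "('o, 'a, 'o \<times> unit, 'a \<times> unit) funct" where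
  "funit_r = \<lparr>FO = (\<lambda>x. (x, ())), FA = (\<lambda>f. (f, ()))\<rparr>"

section \<open>The homotopy category of small categories\<close>

text \<open>
  A morphism \<open>A \<rightarrow> B\<close> of Ho Cat is a natural-isomorphism class of functors \<open>A \<rightarrow> B\<close>.
  Functors which agree on \<open>A\<close> are naturally isomorphic, so a class does not depend on the
  values of its representatives outside \<open>A\<close>, and equality of classes is equality of
  morphisms.
\<close>

definition iso_rel :: "('o, 'a) cat \<Rightarrow> ('p, 'b) cat \<Rightarrow>
    (('o, 'a, 'p, 'b) funct \<times> ('o, 'a, 'p, 'b) funct) set" where
  "iso_rel A B =
    {(F, G). is_functor A B F \<and> is_functor A B G \<and> (\<exists>\<tau>. nat_iso A B F G \<tau>)}"

definition iso_class :: "('o, 'a) cat \<Rightarrow> ('p, 'b) cat \<Rightarrow>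
    ('o, 'a, 'p, 'b) funct \<Rightarrow> ('o, 'a, 'p, 'b) funct set" where
  "iso_class A B F = iso_rel A B `` {F}"

definition ho_hom :: "('o, 'a) cat \<Rightarrow> ('p, 'b) cat \<Rightarrow> ('o, 'a, 'p, 'b) funct set set" where
  "ho_hom A B = Collect (is_functor A B) // iso_rel A B"

definition ho_id :: "('o, 'a) cat \<Rightarrow> ('o, 'a, 'o, 'a) funct set" where
  "ho_id A = iso_class A A fid"

text \<open>The composite of \<open>f : A \<rightarrow> B\<close> and \<open>g : B \<rightarrow> C\<close>; the middle category need not be given.\<close>

definition ho_comp :: "('o, 'a) cat \<Rightarrow> ('q, 'c) cat \<Rightarrow> ('p, 'b, 'q, 'c) funct set
    \<Rightarrow> ('o, 'a, 'p, 'b) funct set \<Rightarrow> ('o, 'a, 'q, 'c) funct set" where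
  "ho_comp A C g f = (\<Union>G \<in> g. \<Union>F \<in> f. iso_class A C (G \<circ>\<^sub>F F))"

definition ho_prod :: "('o, 'a) cat \<Rightarrow> ('p, 'b) cat \<Rightarrow> ('o', 'a') cat \<Rightarrow> ('p', 'b') cat
    \<Rightarrow> ('o, 'a, 'p, 'b) funct set \<Rightarrow> ('o', 'a', 'p', 'b') funct set
    \<Rightarrow> ('o \<times> 'o', 'a \<times> 'a', 'p \<times> 'p', 'b \<times> 'b') funct set" where
  "ho_prod A B A' B' f g = (\<Union>F \<in> f. \<Union>G \<in> g. iso_class (A \<times>\<^sub>C A') (B \<times>\<^sub>C B') (F \<times>\<^sub>F G))"

section \<open>Categories enriched in Ho Cat\<close>

text \<open>
  \<open>EComp C a b c\<close> is the composition morphism \<open>C(b,c) \<times> C(a,b) \<rightarrow> C(a,c)\<close> and \<open>EId C a\<close> the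
  identity \<open>1 \<rightarrow> C(a,a)\<close>.  The hom-categories may overlap: cells of \<open>C(a,b)\<close> are always
  used together with the pair \<open>a\<close>, \<open>b\<close>.
\<close>

record ('o, 'h, 'm) hocat =
  EOb :: "'o set"
  EHom :: "'o \<Rightarrow> 'o \<Rightarrow> ('h, 'm) cat"
  EComp :: "'o \<Rightarrow> 'o \<Rightarrow> 'o \<Rightarrow> ('h \<times> 'h, 'm \<times> 'm, 'h, 'm) funct set"
  EId :: "'o \<Rightarrow> (unit, unit, 'h, 'm) funct set"

locale ho_category =
  fixes C :: "('o, 'h, 'm) hocat"
  assumes hom_category: "\<lbrakk>a \<in> EOb C; b \<in> EOb C\<rbrakk> \<Longrightarrow> category (EHom C a b)"
    and comp_mor: "\<lbrakk>a \<in> EOb C; b \<in> EOb C; c \<in> EOb C\<rbrakk>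
      \<Longrightarrow> EComp C a b c \<in> ho_hom (EHom C b c \<times>\<^sub>C EHom C a b) (EHom C a c)"
    and id_mor: "a \<in> EOb C \<Longrightarrow> EId C a \<in> ho_hom one_cat (EHom C a a)"
    and assoc: "\<lbrakk>a \<in> EOb C; b \<in> EOb C; c \<in> EOb C; d \<in> EOb C\<rbrakk> \<Longrightarrow>
      (let X = (EHom C c d \<times>\<^sub>C EHom C b c) \<times>\<^sub>C EHom C a b;
           Y = EHom C c d \<times>\<^sub>C (EHom C b c \<times>\<^sub>C EHom C a b);
           Z = EHom C a d
       in ho_comp X Z (EComp C a b d)
            (ho_prod (EHom C c d \<times>\<^sub>C EHom C b c) (EHom C b d) (EHom C a b) (EHom C a b)
              (EComp C b c d) (ho_id (EHom C a b)))
        = ho_comp X Z (EComp C a c d)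
            (ho_comp X (EHom C c d \<times>\<^sub>C EHom C a c)
              (ho_prod (EHom C c d) (EHom C c d) (EHom C b c \<times>\<^sub>C EHom C a b) (EHom C a c)
                (ho_id (EHom C c d)) (EComp C a b c))
              (iso_class X Y fassoc)))"
    and unit_left: "\<lbrakk>a \<in> EOb C; b \<in> EOb C\<rbrakk> \<Longrightarrow>
      (let X = EHom C a b
       in ho_comp X X (EComp C a b b)
            (ho_comp X (EHom C b b \<times>\<^sub>C X)
              (ho_prod one_cat (EHom C b b) X X (EId C b) (ho_id X))
              (iso_class X (one_cat \<times>\<^sub>C X) funit_l))
        = ho_id X)"
    and unit_right: "\<lbrakk>a \<in> EOb C; b \<in> EOb C\<rbrakk> \<Longrightarrow>
      (let X = EHom C a b
       in ho_comp X X (EComp C a a b)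
            (ho_comp X (X \<times>\<^sub>C EHom C a a)
              (ho_prod X X one_cat (EHom C a a) (ho_id X) (EId C a))
              (iso_class X (X \<times>\<^sub>C one_cat) funit_r))
        = ho_id X)"

record ('o, 'h, 'm, 'p, 'k, 'n) hofun =
  EFO :: "'o \<Rightarrow> 'p"
  EFA :: "'o \<Rightarrow> 'o \<Rightarrow> ('h, 'm, 'k, 'n) funct set"

locale ho_functor =
  fixes C :: "('o, 'h, 'm) hocat" and D :: "('p, 'k, 'n) hocat"
    and F :: "('o, 'h, 'm, 'p, 'k, 'n) hofun"
  assumes obj_closed: "a \<in> EOb C \<Longrightarrow> EFO F a \<in> EOb D"
    and hom_mor: "\<lbrakk>a \<in> EOb C; b \<in> EOb C\<rbrakk>
      \<Longrightarrow> EFA F a b \<in> ho_hom (EHom C a b) (EHom D (EFO F a) (EFO F b))"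
    and pres_comp: "\<lbrakk>a \<in> EOb C; b \<in> EOb C; c \<in> EOb C\<rbrakk> \<Longrightarrow>
      (let X = EHom C b c \<times>\<^sub>C EHom C a b;
           Z = EHom D (EFO F a) (EFO F c)
       in ho_comp X Z (EFA F a c) (EComp C a b c)
        = ho_comp X Z (EComp D (EFO F a) (EFO F b) (EFO F c))
            (ho_prod (EHom C b c) (EHom D (EFO F b) (EFO F c))
              (EHom C a b) (EHom D (EFO F a) (EFO F b)) (EFA F b c) (EFA F a b)))"
    and pres_id: "a \<in> EOb C \<Longrightarrow>
      ho_comp one_cat (EHom D (EFO F a) (EFO F a)) (EFA F a a) (EId C a) = EId D (EFO F a)"

definition ho_functor_id :: "('o, 'h, 'm) hocat \<Rightarrow> ('o, 'h, 'm, 'o, 'h, 'm) hofun" where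
  "ho_functor_id C = \<lparr>EFO = (\<lambda>a. a), EFA = (\<lambda>a b. ho_id (EHom C a b))\<rparr>"

definition ho_functor_comp :: "('o, 'h, 'm) hocat \<Rightarrow> ('q, 'l, 'r) hocat
    \<Rightarrow> ('p, 'k, 'n, 'q, 'l, 'r) hofun \<Rightarrow> ('o, 'h, 'm, 'p, 'k, 'n) hofun
    \<Rightarrow> ('o, 'h, 'm, 'q, 'l, 'r) hofun" where
  "ho_functor_comp C E G F = \<lparr>
    EFO = (\<lambda>a. EFO G (EFO F a)),
    EFA = (\<lambda>a b. ho_comp (EHom C a b) (EHom E (EFO G (EFO F a)) (EFO G (EFO F b)))
      (EFA G (EFO F a) (EFO F b)) (EFA F a b))\<rparr>"

text \<open>
  An enriched natural transformation \<open>\<alpha> : F \<Rightarrow> G\<close> has components \<open>\<alpha> a : 1 \<rightarrow> D(F a, G a)\<close>,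
  and its naturality is an equation between morphisms \<open>C(a,b) \<rightarrow> D(F a, G b)\<close>.
\<close>

definition ho_nat_trans :: "('o, 'h, 'm) hocat \<Rightarrow> ('p, 'k, 'n) hocat
    \<Rightarrow> ('o, 'h, 'm, 'p, 'k, 'n) hofun \<Rightarrow> ('o, 'h, 'm, 'p, 'k, 'n) hofun
    \<Rightarrow> ('o \<Rightarrow> (unit, unit, 'k, 'n) funct set) \<Rightarrow> bool" where
  "ho_nat_trans C D F G \<alpha> \<longleftrightarrow>
    (\<forall>a \<in> EOb C. \<alpha> a \<in> ho_hom one_cat (EHom D (EFO F a) (EFO G a))) \<and>
    (\<forall>a \<in> EOb C. \<forall>b \<in> EOb C.
      (let X = EHom C a b;
           Z = EHom D (EFO F a) (EFO G b);
           Fab = EHom D (EFO F a) (EFO F b);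
           Gab = EHom D (EFO G a) (EFO G b);
           FGa = EHom D (EFO F a) (EFO G a);
           FGb = EHom D (EFO F b) (EFO G b)
       in ho_comp X Z (EComp D (EFO F a) (EFO F b) (EFO G b))
            (ho_comp X (FGb \<times>\<^sub>C Fab) (ho_prod one_cat FGb X Fab (\<alpha> b) (EFA F a b))
              (iso_class X (one_cat \<times>\<^sub>C X) funit_l))
        = ho_comp X Z (EComp D (EFO F a) (EFO G a) (EFO G b))
            (ho_comp X (Gab \<times>\<^sub>C FGa) (ho_prod X Gab one_cat FGa (EFA G a b) (\<alpha> a))
              (iso_class X (X \<times>\<^sub>C one_cat) funit_r))))"

text \<open>The composite \<open>1 \<cong> 1 \<times> 1 \<rightarrow> D(y,z) \<times> D(x,y) \<rightarrow> D(x,z)\<close> of morphisms of the underlying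
  category of \<open>D\<close>.\<close>

definition ho_under_comp :: "('p, 'k, 'n) hocat \<Rightarrow> 'p \<Rightarrow> 'p \<Rightarrow> 'p
    \<Rightarrow> (unit, unit, 'k, 'n) funct set \<Rightarrow> (unit, unit, 'k, 'n) funct set
    \<Rightarrow> (unit, unit, 'k, 'n) funct set" where
  "ho_under_comp D x y z v u =
    ho_comp one_cat (EHom D x z) (EComp D x y z)
      (ho_comp one_cat (EHom D y z \<times>\<^sub>C EHom D x y)
        (ho_prod one_cat (EHom D y z) one_cat (EHom D x y) v u)
        (iso_class one_cat (one_cat \<times>\<^sub>C one_cat) funit_l))"

definition ho_nat_isomorphic :: "('o, 'h, 'm) hocat \<Rightarrow> ('p, 'k, 'n) hocat
    \<Rightarrow> ('o, 'h, 'm, 'p, 'k, 'n) hofun \<Rightarrow> ('o, 'h, 'm, 'p, 'k, 'n) hofun \<Rightarrow> bool" where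
  "ho_nat_isomorphic C D F G \<longleftrightarrow>
    (\<exists>\<alpha> \<beta>. ho_nat_trans C D F G \<alpha> \<and> ho_nat_trans C D G F \<beta> \<and>
      (\<forall>a \<in> EOb C.
        ho_under_comp D (EFO F a) (EFO G a) (EFO F a) (\<beta> a) (\<alpha> a) = EId D (EFO F a) \<and>
        ho_under_comp D (EFO G a) (EFO F a) (EFO G a) (\<alpha> a) (\<beta> a) = EId D (EFO G a)))"

text \<open>An enriched equivalence is an equivalence in the 2-category of Ho Cat-enriched categories,
  enriched functors and enriched natural transformations.\<close>

definition ho_equivalence :: "('o, 'h, 'm) hocat \<Rightarrow> ('p, 'k, 'n) hocat
    \<Rightarrow> ('o, 'h, 'm, 'p, 'k, 'n) hofun \<Rightarrow> bool" where
  "ho_equivalence C D F \<longleftrightarrow>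
    ho_functor C D F \<and>
    (\<exists>G. ho_functor D C G \<and>
      ho_nat_isomorphic C C (ho_functor_id C) (ho_functor_comp C C G F) \<and>
      ho_nat_isomorphic D D (ho_functor_comp D D F G) (ho_functor_id D))"

section \<open>Bicategories and pseudofunctors\<close>

text \<open>
  For \<open>f : a \<rightarrow> b\<close>, \<open>g : b \<rightarrow> c\<close> and \<open>h : c \<rightarrow> d\<close>, the constraints are
  \<open>BAssoc B a b c d ((h, g), f) : (h g) f \<rightarrow> h (g f)\<close>, \<open>BLunit B a b f : 1 f \<rightarrow> f\<close> and
  \<open>BRunit B a b f : f 1 \<rightarrow> f\<close>.
\<close>

record ('o, 'h, 'm) bicat =
  BOb :: "'o set"
  BHom :: "'o \<Rightarrow> 'o \<Rightarrow> ('h, 'm) cat"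
  BComp :: "'o \<Rightarrow> 'o \<Rightarrow> 'o \<Rightarrow> ('h \<times> 'h, 'm \<times> 'm, 'h, 'm) funct"
  BId :: "'o \<Rightarrow> 'h"
  BAssoc :: "'o \<Rightarrow> 'o \<Rightarrow> 'o \<Rightarrow> 'o \<Rightarrow> ('h \<times> 'h) \<times> 'h \<Rightarrow> 'm"
  BLunit :: "'o \<Rightarrow> 'o \<Rightarrow> 'h \<Rightarrow> 'm"
  BRunit :: "'o \<Rightarrow> 'o \<Rightarrow> 'h \<Rightarrow> 'm"

abbreviation id2 :: "('o, 'h, 'm) bicat \<Rightarrow> 'o \<Rightarrow> 'o \<Rightarrow> 'h \<Rightarrow> 'm" where
  "id2 B a b f \<equiv> Idt (BHom B a b) f"

abbreviation hcomp1 :: "('o, 'h, 'm) bicat \<Rightarrow> 'o \<Rightarrow> 'o \<Rightarrow> 'o \<Rightarrow> 'h \<Rightarrow> 'h \<Rightarrow> 'h" where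
  "hcomp1 B a b c g f \<equiv> FO (BComp B a b c) (g, f)"

abbreviation hcomp2 :: "('o, 'h, 'm) bicat \<Rightarrow> 'o \<Rightarrow> 'o \<Rightarrow> 'o \<Rightarrow> 'm \<Rightarrow> 'm \<Rightarrow> 'm" where
  "hcomp2 B a b c \<beta> \<alpha> \<equiv> FA (BComp B a b c) (\<beta>, \<alpha>)"

locale bicategory =
  fixes B :: "('o, 'h, 'm) bicat"
  assumes hom_category: "\<lbrakk>a \<in> BOb B; b \<in> BOb B\<rbrakk> \<Longrightarrow> category (BHom B a b)"
    and comp_functor: "\<lbrakk>a \<in> BOb B; b \<in> BOb B; c \<in> BOb B\<rbrakk>
      \<Longrightarrow> is_functor (BHom B b c \<times>\<^sub>C BHom B a b) (BHom B a c) (BComp B a b c)"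
    and id_closed: "a \<in> BOb B \<Longrightarrow> BId B a \<in> Obj (BHom B a a)"
    and assoc_iso: "\<lbrakk>a \<in> BOb B; b \<in> BOb B; c \<in> BOb B; d \<in> BOb B\<rbrakk> \<Longrightarrow>
      nat_iso ((BHom B c d \<times>\<^sub>C BHom B b c) \<times>\<^sub>C BHom B a b) (BHom B a d)
        (BComp B a b d \<circ>\<^sub>F (BComp B b c d \<times>\<^sub>F fid))
        (BComp B a c d \<circ>\<^sub>F (fid \<times>\<^sub>F BComp B a b c) \<circ>\<^sub>F fassoc)
        (BAssoc B a b c d)"
    and lunit_iso: "\<lbrakk>a \<in> BOb B; b \<in> BOb B\<rbrakk> \<Longrightarrow>
      nat_iso (BHom B a b) (BHom B a b)
        (BComp B a b b \<circ>\<^sub>F (pick (BHom B b b) (BId B b) \<times>\<^sub>F fid) \<circ>\<^sub>F funit_l) fid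
        (BLunit B a b)"
    and runit_iso: "\<lbrakk>a \<in> BOb B; b \<in> BOb B\<rbrakk> \<Longrightarrow>
      nat_iso (BHom B a b) (BHom B a b)
        (BComp B a a b \<circ>\<^sub>F (fid \<times>\<^sub>F pick (BHom B a a) (BId B a)) \<circ>\<^sub>F funit_r) fid
        (BRunit B a b)"
    and pentagon:
      "\<lbrakk>a \<in> BOb B; b \<in> BOb B; c \<in> BOb B; d \<in> BOb B; e \<in> BOb B;
        f \<in> Obj (BHom B a b); g \<in> Obj (BHom B b c);
        h \<in> Obj (BHom B c d); k \<in> Obj (BHom B d e)\<rbrakk> \<Longrightarrow>
      BAssoc B a c d e ((k, h), hcomp1 B a b c g f)
        \<cdot>\<^bsub>BHom B a e\<^esub> BAssoc B a b c e ((hcomp1 B c d e k h, g), f)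
      = hcomp2 B a d e (id2 B d e k) (BAssoc B a b c d ((h, g), f))
        \<cdot>\<^bsub>BHom B a e\<^esub> (BAssoc B a b d e ((k, hcomp1 B b c d h g), f)
        \<cdot>\<^bsub>BHom B a e\<^esub> hcomp2 B a b e (BAssoc B b c d e ((k, h), g)) (id2 B a b f))"
    and triangle:
      "\<lbrakk>a \<in> BOb B; b \<in> BOb B; c \<in> BOb B;
        f \<in> Obj (BHom B a b); g \<in> Obj (BHom B b c)\<rbrakk> \<Longrightarrow>
      hcomp2 B a b c (id2 B b c g) (BLunit B a b f)
        \<cdot>\<^bsub>BHom B a c\<^esub> BAssoc B a b b c ((g, BId B b), f)
      = hcomp2 B a b c (BRunit B b c g) (id2 B a b f)"

text \<open>
  The constraints of a pseudofunctor \<open>P\<close> are \<open>PComp P a b c (g, f) : P g P f \<rightarrow> P (g f)\<close> and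
  \<open>PUnit P a : 1 \<rightarrow> P 1\<close>.
\<close>

record ('o, 'h, 'm, 'p, 'k, 'n) psfun =
  PO :: "'o \<Rightarrow> 'p"
  PF :: "'o \<Rightarrow> 'o \<Rightarrow> ('h, 'm, 'k, 'n) funct"
  PComp :: "'o \<Rightarrow> 'o \<Rightarrow> 'o \<Rightarrow> 'h \<times> 'h \<Rightarrow> 'n"
  PUnit :: "'o \<Rightarrow> 'n"

locale pseudofunctor =
  fixes B :: "('o, 'h, 'm) bicat" and E :: "('p, 'k, 'n) bicat"
    and P :: "('o, 'h, 'm, 'p, 'k, 'n) psfun"
  assumes obj_closed: "a \<in> BOb B \<Longrightarrow> PO P a \<in> BOb E"
    and hom_functor: "\<lbrakk>a \<in> BOb B; b \<in> BOb B\<rbrakk>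
      \<Longrightarrow> is_functor (BHom B a b) (BHom E (PO P a) (PO P b)) (PF P a b)"
    and comp_iso: "\<lbrakk>a \<in> BOb B; b \<in> BOb B; c \<in> BOb B\<rbrakk> \<Longrightarrow>
      nat_iso (BHom B b c \<times>\<^sub>C BHom B a b) (BHom E (PO P a) (PO P c))
        (BComp E (PO P a) (PO P b) (PO P c) \<circ>\<^sub>F (PF P b c \<times>\<^sub>F PF P a b))
        (PF P a c \<circ>\<^sub>F BComp B a b c)
        (PComp P a b c)"
    and unit_iso: "a \<in> BOb B \<Longrightarrow>
      PUnit P a \<in> iso_arrs (BHom E (PO P a) (PO P a)) (BId E (PO P a)) (FO (PF P a a) (BId B a))"
    and assoc_coherence:
      "\<lbrakk>a \<in> BOb B; b \<in> BOb B; c \<in> BOb B; d \<in> BOb B;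
        f \<in> Obj (BHom B a b); g \<in> Obj (BHom B b c); h \<in> Obj (BHom B c d)\<rbrakk> \<Longrightarrow>
      (let a' = PO P a; b' = PO P b; c' = PO P c; d' = PO P d;
           f' = FO (PF P a b) f; g' = FO (PF P b c) g; h' = FO (PF P c d) h
       in FA (PF P a d) (BAssoc B a b c d ((h, g), f))
          \<cdot>\<^bsub>BHom E a' d'\<^esub> (PComp P a b d (hcomp1 B b c d h g, f)
          \<cdot>\<^bsub>BHom E a' d'\<^esub> hcomp2 E a' b' d' (PComp P b c d (h, g)) (id2 E a' b' f'))
        = PComp P a c d (h, hcomp1 B a b c g f)
          \<cdot>\<^bsub>BHom E a' d'\<^esub> (hcomp2 E a' c' d' (id2 E c' d' h') (PComp P a b c (g, f))
          \<cdot>\<^bsub>BHom E a' d'\<^esub> BAssoc E a' b' c' d' ((h', g'), f')))"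
    and lunit_coherence:
      "\<lbrakk>a \<in> BOb B; b \<in> BOb B; f \<in> Obj (BHom B a b)\<rbrakk> \<Longrightarrow>
      (let a' = PO P a; b' = PO P b; f' = FO (PF P a b) f
       in FA (PF P a b) (BLunit B a b f)
          \<cdot>\<^bsub>BHom E a' b'\<^esub> (PComp P a b b (BId B b, f)
          \<cdot>\<^bsub>BHom E a' b'\<^esub> hcomp2 E a' b' b' (PUnit P b) (id2 E a' b' f'))
        = BLunit E a' b' f')"
    and runit_coherence:
      "\<lbrakk>a \<in> BOb B; b \<in> BOb B; f \<in> Obj (BHom B a b)\<rbrakk> \<Longrightarrow>
      (let a' = PO P a; b' = PO P b; f' = FO (PF P a b) f
       in FA (PF P a b) (BRunit B a b f)
          \<cdot>\<^bsub>BHom E a' b'\<^esub> (PComp P a a b (f, BId B a)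
          \<cdot>\<^bsub>BHom E a' b'\<^esub> hcomp2 E a' a' b' (id2 E a' b' f') (PUnit P a))
        = BRunit E a' b' f')"

definition equivalent_objs :: "('o, 'h, 'm) bicat \<Rightarrow> 'o \<Rightarrow> 'o \<Rightarrow> bool" where
  "equivalent_objs B x y \<longleftrightarrow>
    (\<exists>u \<in> Obj (BHom B x y). \<exists>v \<in> Obj (BHom B y x).
      isomorphic (BHom B x x) (hcomp1 B x y x v u) (BId B x) \<and>
      isomorphic (BHom B y y) (hcomp1 B y x y u v) (BId B y))"

definition bicategorical_equivalence :: "('o, 'h, 'm) bicat \<Rightarrow> ('p, 'k, 'n) bicat
    \<Rightarrow> ('o, 'h, 'm, 'p, 'k, 'n) psfun \<Rightarrow> bool" where
  "bicategorical_equivalence B E P \<longleftrightarrow>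
    pseudofunctor B E P \<and>
    (\<forall>y \<in> BOb E. \<exists>x \<in> BOb B. equivalent_objs E (PO P x) y) \<and>
    (\<forall>a \<in> BOb B. \<forall>b \<in> BOb B.
      cat_equivalence (BHom B a b) (BHom E (PO P a) (PO P b)) (PF P a b))"

subsection \<open>Underlying Ho Cat-enriched structure\<close>

text \<open>
  The enriched category underlying a bicategory is determined on its objects only; the record
  fields of an enriched category carry no information elsewhere, and are not compared there.
\<close>

definition underlies_bicategory :: "('o, 'h, 'm) hocat \<Rightarrow> ('o, 'h, 'm) bicat \<Rightarrow> bool" where
  "underlies_bicategory C B \<longleftrightarrow>
    EOb C = BOb B \<and>
    (\<forall>a \<in> BOb B. \<forall>b \<in> BOb B. EHom C a b = BHom B a b) \<and>
    (\<forall>a \<in> BOb B. \<forall>b \<in> BOb B. \<forall>c \<in> BOb B.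
      EComp C a b c = iso_class (BHom B b c \<times>\<^sub>C BHom B a b) (BHom B a c) (BComp B a b c)) \<and>
    (\<forall>a \<in> BOb B. EId C a = iso_class one_cat (BHom B a a) (pick (BHom B a a) (BId B a)))"

definition underlies_pseudofunctor :: "('o, 'h, 'm, 'p, 'k, 'n) hofun
    \<Rightarrow> ('o, 'h, 'm) bicat \<Rightarrow> ('p, 'k, 'n) bicat \<Rightarrow> ('o, 'h, 'm, 'p, 'k, 'n) psfun \<Rightarrow> bool" where
  "underlies_pseudofunctor F B E P \<longleftrightarrow>
    (\<forall>a \<in> BOb B. EFO F a = PO P a) \<and>
    (\<forall>a \<in> BOb B. \<forall>b \<in> BOb B.
      EFA F a b = iso_class (BHom B a b) (BHom E (PO P a) (PO P b)) (PF P a b))"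

end

theory Submission
  imports Defs
begin

text \<open>
  A morphism \<open>A \<rightarrow> B\<close> of Ho Cat is invertible iff its representatives are equivalences of categories,
  so everything can be said about functors up to natural isomorphism.

  \<^emph>\<open>Local equivalence.\<close>  Let \<open>G\<close> be an inverse of the enriched equivalence \<open>F\<close>.  Naturality of
  \<open>1 \<cong> G F\<close> expresses the hom-functor of \<open>G F\<close> at \<open>(a, b)\<close> as conjugation by invertible 1-cells, hence
  as an isomorphism of Ho Cat; likewise for \<open>F G\<close>.  The functors \<open>F\<close>, \<open>G\<close>, \<open>F\<close> on hom-categories
  therefore form a chain whose two consecutive composites are invertible, and the 2-out-of-6 property
  makes each of them invertible (\<open>ho_equivalence_ho_iso\<close>).
  Essential surjectivity is witnessed by the components of \<open>F G \<cong> 1\<close>.  This gives (i).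

  \<^emph>\<open>Lifting.\<close>  For (ii), choose a functor in each of the given classes: \<open>P\<close> for the action of \<open>F\<close> on
  homs, \<open>M\<close> for composition in \<open>C\<close>, and an object \<open>I a\<close> for each identity.  The functor equations are
  equations of classes, hence provide natural isomorphisms \<open>\<phi> : P g P f \<cong> P (g f)\<close> and
  \<open>\<psi> : 1 \<cong> P I\<close>.  Because \<open>P\<close> is fully faithful there is exactly one way to choose an associator and
  unitors for \<open>M\<close> which makes \<open>(P, \<phi>, \<psi>)\<close> satisfy the axioms of a pseudofunctor to the given
  bicategory: the required cells exist between images under \<open>P\<close>, and are lifted (\<open>nat_iso_lift\<close>).
  Pentagon and triangle then hold because they hold after applying the faithful \<open>P\<close>, where they become
  the pentagon and the triangle of the target bicategory (\<open>lifted_pentagon\<close>, \<open>lifted_triangle\<close>).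
  That the resulting pseudofunctor is a bicategorical equivalence is an instance of (i).
\<close>

section \<open>Functors and natural isomorphisms\<close>

(* The product of filters shares its symbol with the product of functors. *)
no_notation prod_filter (infixr "\<times>\<^sub>F" 80)

context category
begin

lemma arrs_objs: "f \<in> arrs A x y \<Longrightarrow> x \<in> Obj A \<and> y \<in> Obj A"
  using dom_closed cod_closed by (auto simp: arrs_def)

lemma iso_arrs_idt: "x \<in> Obj A \<Longrightarrow> Idt A x \<in> iso_arrs A x x"
  using idt_closed idt_left by (fastforce simp: iso_arrs_def)

lemma iso_arrs_inverse:
  assumes "f \<in> iso_arrs A x y"
  obtains g where "g \<in> iso_arrs A y x" "g \<cdot> f = Idt A x" "f \<cdot> g = Idt A y"
  using assms by (auto simp: iso_arrs_def)

lemma iso_arrs_cmp: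
  assumes "f \<in> iso_arrs A x y" "g \<in> iso_arrs A y z"
  shows "g \<cdot> f \<in> iso_arrs A x z"
proof -
  obtain f' where f': "f' \<in> iso_arrs A y x" "f' \<cdot> f = Idt A x" "f \<cdot> f' = Idt A y"
    using assms(1) by (rule iso_arrs_inverse)
  obtain g' where g': "g' \<in> iso_arrs A z y" "g' \<cdot> g = Idt A y" "g \<cdot> g' = Idt A z"
    using assms(2) by (rule iso_arrs_inverse)
  have T: "f \<in> arrs A x y" "f' \<in> arrs A y x" "g \<in> arrs A y z" "g' \<in> arrs A z y"
    using assms f' g' by (auto simp: iso_arrs_def)
  have "(f' \<cdot> g') \<cdot> (g \<cdot> f) = f' \<cdot> ((g' \<cdot> g) \<cdot> f)"
    using T cmp_closed[OF T(1,3)] by (simp add: cmp_assoc)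
  moreover have "(g \<cdot> f) \<cdot> (f' \<cdot> g') = g \<cdot> ((f \<cdot> f') \<cdot> g')"
    using T cmp_closed[OF T(4,2)] by (simp add: cmp_assoc)
  ultimately have "(f' \<cdot> g') \<cdot> (g \<cdot> f) = Idt A x" "(g \<cdot> f) \<cdot> (f' \<cdot> g') = Idt A z"
    using T f' g' by (simp_all add: idt_left)
  then show ?thesis
    using T cmp_closed by (auto simp: iso_arrs_def)
qed

lemma iso_arrs_epi:
  assumes "f \<in> iso_arrs A x y" "g \<in> arrs A y z" "h \<in> arrs A y z" "g \<cdot> f = h \<cdot> f"
  shows "g = h"
proof -
  obtain f' where f': "f' \<in> iso_arrs A y x" "f \<cdot> f' = Idt A y"
    using assms(1) by (rule iso_arrs_inverse)
  have "f \<in> arrs A x y" "f' \<in> arrs A y x" using assms(1) f'(1) by (simp_all add: iso_arrs_def)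
  then have "(g \<cdot> f) \<cdot> f' = g" "(h \<cdot> f) \<cdot> f' = h"
    using cmp_assoc[of f' y x f y] assms(2,3) f'(2) by (simp_all only: idt_right)
  then show ?thesis using assms(4) by metis
qed

lemma iso_arrs_mono:
  assumes "f \<in> iso_arrs A x y" "g \<in> arrs A w x" "h \<in> arrs A w x" "f \<cdot> g = f \<cdot> h"
  shows "g = h"
proof -
  obtain f' where f': "f' \<in> iso_arrs A y x" "f' \<cdot> f = Idt A x"
    using assms(1) by (rule iso_arrs_inverse)
  have "f \<in> arrs A x y" "f' \<in> arrs A y x" using assms(1) f'(1) by (simp_all add: iso_arrs_def)
  then have "f' \<cdot> (f \<cdot> g) = g" "f' \<cdot> (f \<cdot> h) = h"
    using cmp_assoc[of _ w x f y f' x, symmetric] assms(2,3) f'(2) by (simp_all only: idt_left)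
  then show ?thesis using assms(4) by metis
qed

end

lemma iso_arrsD: "f \<in> iso_arrs A x y \<Longrightarrow> f \<in> arrs A x y"
  by (simp add: iso_arrs_def)

lemma is_functor_iso_arrs:
  assumes "category A" "is_functor A B F" "f \<in> iso_arrs A x y"
  shows "FA F f \<in> iso_arrs B (FO F x) (FO F y)"
proof -
  interpret A: category A by fact
  interpret F: is_functor A B F by fact
  obtain g where g: "g \<in> iso_arrs A y x" "g \<cdot>\<^bsub>A\<^esub> f = Idt A x" "f \<cdot>\<^bsub>A\<^esub> g = Idt A y"
    using assms(3) by (rule A.iso_arrs_inverse)
  have T: "f \<in> arrs A x y" "g \<in> arrs A y x" using assms(3) g(1) by (auto dest: iso_arrsD)
  then have "FA F g \<cdot>\<^bsub>B\<^esub> FA F f = Idt B (FO F x)" "FA F f \<cdot>\<^bsub>B\<^esub> FA F g = Idt B (FO F y)"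
    using g(2,3) A.arrs_objs by (auto simp: F.pres_idt simp flip: F.pres_cmp)
  with T show ?thesis
    using F.arr_closed by (auto simp: iso_arrs_def)
qed

lemma fcomp_sel [simp]: "FO (G \<circ>\<^sub>F F) x = FO G (FO F x)" "FA (G \<circ>\<^sub>F F) f = FA G (FA F f)"
  by (simp_all add: fcomp_def)

lemma fprod_sel [simp]:
  "FO (F \<times>\<^sub>F G) (x, y) = (FO F x, FO G y)" "FA (F \<times>\<^sub>F G) (f, g) = (FA F f, FA G g)"
  by (simp_all add: fprod_def)

lemma fid_sel [simp]: "FO fid x = x" "FA fid f = f"
  by (simp_all add: fid_def)

lemma pick_sel [simp]: "FO (pick A x) i = x" "FA (pick A x) j = Idt A x"
  by (simp_all add: pick_def)

lemma structural_sel [simp]: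
  "FO fassoc ((x, y), z) = (x, y, z)" "FA fassoc ((f, g), h) = (f, g, h)"
  "FO funit_l x = ((), x)" "FA funit_l f = ((), f)"
  "FO funit_r x = (x, ())" "FA funit_r f = (f, ())"
  by (simp_all add: fassoc_def funit_l_def funit_r_def)

text \<open>Functors are equal as records, without restriction to the objects and arrows of a category.  Hence
  composites such as \<open>(f, g) \<mapsto> M (P g, P f)\<close> which differ only in their bracketing, or by structural
  functors, are equal and not just isomorphic.\<close>

lemma funct_eqI: "(\<And>x. FO F x = FO G x) \<Longrightarrow> (\<And>f. FA F f = FA G f) \<Longrightarrow> F = (G :: ('o, 'a, 'p, 'b) funct)"
  by (cases F; cases G) auto

lemma prod_cat_sel [simp]:
  "Obj (A \<times>\<^sub>C B) = Obj A \<times> Obj B"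
  "Arr (A \<times>\<^sub>C B) = Arr A \<times> Arr B"
  "(x, y) \<in> Obj (A \<times>\<^sub>C B) \<Longrightarrow> Idt (A \<times>\<^sub>C B) (x, y) = (Idt A x, Idt B y)"
  by (simp_all add: prod_cat_def)

lemma arrs_prod: "(f, g) \<in> arrs (A \<times>\<^sub>C B) x y \<longleftrightarrow>
    f \<in> arrs A (fst x) (fst y) \<and> g \<in> arrs B (snd x) (snd y)"
  by (cases x; cases y) (auto simp: arrs_def prod_cat_def)

lemma cmp_prod:
  assumes "f \<in> arrs A x y" "f' \<in> arrs A y z" "g \<in> arrs B x' y'" "g' \<in> arrs B y' z'"
  shows "(f', g') \<cdot>\<^bsub>A \<times>\<^sub>C B\<^esub> (f, g) = (f' \<cdot>\<^bsub>A\<^esub> f, g' \<cdot>\<^bsub>B\<^esub> g)"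
  using assms by (simp add: prod_cat_def arrs_def)

lemma category_prod:
  assumes "category A" "category B"
  shows "category (A \<times>\<^sub>C B)"
proof -
  interpret A: category A by fact
  interpret B: category B by fact
  have cp: "g \<cdot>\<^bsub>A \<times>\<^sub>C B\<^esub> f = (fst g \<cdot>\<^bsub>A\<^esub> fst f, snd g \<cdot>\<^bsub>B\<^esub> snd f)"
    if "f \<in> arrs (A \<times>\<^sub>C B) x y" "g \<in> arrs (A \<times>\<^sub>C B) y z" for f g x y z
    using that by (cases f; cases g) (auto simp: arrs_prod cmp_prod)
  show ?thesis
  proof
    fix f assume "f \<in> Arr (A \<times>\<^sub>C B)"
    then show "Dom (A \<times>\<^sub>C B) f \<in> Obj (A \<times>\<^sub>C B)" "Cod (A \<times>\<^sub>C B) f \<in> Obj (A \<times>\<^sub>C B)"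
      by (auto simp: prod_cat_def A.dom_closed A.cod_closed B.dom_closed B.cod_closed)
  next
    fix x assume "x \<in> Obj (A \<times>\<^sub>C B)"
    then show "Idt (A \<times>\<^sub>C B) x \<in> arrs (A \<times>\<^sub>C B) x x"
      using A.idt_closed B.idt_closed by (cases x) (auto simp: arrs_prod)
  next
    fix f g x y z assume fg: "f \<in> arrs (A \<times>\<^sub>C B) x y" "g \<in> arrs (A \<times>\<^sub>C B) y z"
    then show "g \<cdot>\<^bsub>A \<times>\<^sub>C B\<^esub> f \<in> arrs (A \<times>\<^sub>C B) x z"
      using A.cmp_closed B.cmp_closed unfolding cp[OF fg]
      by (cases f; cases g) (auto simp: arrs_prod)
  next
    fix f x y assume f: "f \<in> arrs (A \<times>\<^sub>C B) x y"
    obtain f1 f2 x1 x2 y1 y2 where e: "f = (f1, f2)" "x = (x1, x2)" "y = (y1, y2)"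
      by (cases f; cases x; cases y) auto
    have T: "f1 \<in> arrs A x1 y1" "f2 \<in> arrs B x2 y2" using f by (auto simp: e arrs_prod)
    then have O: "x1 \<in> Obj A" "y1 \<in> Obj A" "x2 \<in> Obj B" "y2 \<in> Obj B"
      using A.arrs_objs B.arrs_objs by auto
    show "Idt (A \<times>\<^sub>C B) y \<cdot>\<^bsub>A \<times>\<^sub>C B\<^esub> f = f"
      using O cmp_prod[OF T(1) A.idt_closed T(2) B.idt_closed] A.idt_left[OF T(1)] B.idt_left[OF T(2)]
      by (simp add: e)
    show "f \<cdot>\<^bsub>A \<times>\<^sub>C B\<^esub> Idt (A \<times>\<^sub>C B) x = f"
      using O cmp_prod[OF A.idt_closed T(1) B.idt_closed T(2)] A.idt_right[OF T(1)] B.idt_right[OF T(2)]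
      by (simp add: e)
  next
    fix f g h w x y z
    assume f: "f \<in> arrs (A \<times>\<^sub>C B) w x" and g: "g \<in> arrs (A \<times>\<^sub>C B) x y" and h: "h \<in> arrs (A \<times>\<^sub>C B) y z"
    obtain f1 f2 g1 g2 h1 h2 where e: "f = (f1, f2)" "g = (g1, g2)" "h = (h1, h2)"
      by (cases f; cases g; cases h) auto
    obtain w1 w2 x1 x2 y1 y2 z1 z2 where e': "w = (w1, w2)" "x = (x1, x2)" "y = (y1, y2)" "z = (z1, z2)"
      by (cases w; cases x; cases y; cases z) auto
    have T: "f1 \<in> arrs A w1 x1" "g1 \<in> arrs A x1 y1" "h1 \<in> arrs A y1 z1"
      "f2 \<in> arrs B w2 x2" "g2 \<in> arrs B x2 y2" "h2 \<in> arrs B y2 z2"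
      using f g h by (auto simp: e e' arrs_prod)
    have T': "g1 \<cdot>\<^bsub>A\<^esub> f1 \<in> arrs A w1 y1" "h1 \<cdot>\<^bsub>A\<^esub> g1 \<in> arrs A x1 z1"
      "g2 \<cdot>\<^bsub>B\<^esub> f2 \<in> arrs B w2 y2" "h2 \<cdot>\<^bsub>B\<^esub> g2 \<in> arrs B x2 z2"
      using T A.cmp_closed B.cmp_closed by auto
    show "h \<cdot>\<^bsub>A \<times>\<^sub>C B\<^esub> g \<cdot>\<^bsub>A \<times>\<^sub>C B\<^esub> f = h \<cdot>\<^bsub>A \<times>\<^sub>C B\<^esub> (g \<cdot>\<^bsub>A \<times>\<^sub>C B\<^esub> f)"
      unfolding e cmp_prod[OF T(2,3,5,6)] cmp_prod[OF T(1,2,4,5)]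
        cmp_prod[OF T(1) T'(2) T(4) T'(4)] cmp_prod[OF T'(1) T(3) T'(3) T(6)]
      using A.cmp_assoc[OF T(1-3)] B.cmp_assoc[OF T(4-6)] by simp
  qed (auto simp: prod_cat_def)
qed

lemma category_one: "category one_cat"
  by standard (auto simp: one_cat_def arrs_def extensional_def)

lemma iso_arrs_prod:
  assumes "f \<in> iso_arrs A x y" "g \<in> iso_arrs B x' y'"
    and "x \<in> Obj A" "y \<in> Obj A" "x' \<in> Obj B" "y' \<in> Obj B"
  shows "(f, g) \<in> iso_arrs (A \<times>\<^sub>C B) (x, x') (y, y')"
proof -
  obtain f' g' where
    fg': "f' \<in> arrs A y x" "f' \<cdot>\<^bsub>A\<^esub> f = Idt A x" "f \<cdot>\<^bsub>A\<^esub> f' = Idt A y"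
    "g' \<in> arrs B y' x'" "g' \<cdot>\<^bsub>B\<^esub> g = Idt B x'" "g \<cdot>\<^bsub>B\<^esub> g' = Idt B y'"
    using assms(1,2) by (auto simp: iso_arrs_def)
  moreover have "f \<in> arrs A x y" "g \<in> arrs B x' y'"
    using assms(1,2) by (simp_all add: iso_arrs_def)
  ultimately have "(f', g') \<cdot>\<^bsub>A \<times>\<^sub>C B\<^esub> (f, g) = Idt (A \<times>\<^sub>C B) (x, x')"
    "(f, g) \<cdot>\<^bsub>A \<times>\<^sub>C B\<^esub> (f', g') = Idt (A \<times>\<^sub>C B) (y, y')"
    "(f', g') \<in> arrs (A \<times>\<^sub>C B) (y, y') (x, x')" "(f, g) \<in> arrs (A \<times>\<^sub>C B) (x, x') (y, y')"
    using assms(3-) by (simp_all add: cmp_prod arrs_prod)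
  then show ?thesis
    unfolding iso_arrs_def by blast
qed

lemma is_functor_fid: "is_functor A A fid"
  by standard auto

lemma is_functor_fcomp:
  assumes "is_functor A B F" "is_functor B C G"
  shows "is_functor A C (G \<circ>\<^sub>F F)"
proof -
  interpret F: is_functor A B F by fact
  interpret G: is_functor B C G by fact
  show ?thesis
  proof
    fix f g x y z assume "f \<in> arrs A x y" "g \<in> arrs A y z"
    then show "FA (G \<circ>\<^sub>F F) (g \<cdot>\<^bsub>A\<^esub> f) = FA (G \<circ>\<^sub>F F) g \<cdot>\<^bsub>C\<^esub> FA (G \<circ>\<^sub>F F) f"
      by (simp add: F.pres_cmp G.pres_cmp[OF F.arr_closed F.arr_closed])
  qed (auto simp: F.obj_closed G.obj_closed F.arr_closed G.arr_closed F.pres_idt G.pres_idt)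
qed

lemma is_functor_fprod:
  assumes "is_functor A B F" "is_functor A' B' G"
  shows "is_functor (A \<times>\<^sub>C A') (B \<times>\<^sub>C B') (F \<times>\<^sub>F G)"
proof -
  interpret F: is_functor A B F by fact
  interpret G: is_functor A' B' G by fact
  show ?thesis
  proof
    fix f g x y z assume "f \<in> arrs (A \<times>\<^sub>C A') x y" "g \<in> arrs (A \<times>\<^sub>C A') y z"
    then show "FA (F \<times>\<^sub>F G) (g \<cdot>\<^bsub>A \<times>\<^sub>C A'\<^esub> f) =
        FA (F \<times>\<^sub>F G) g \<cdot>\<^bsub>B \<times>\<^sub>C B'\<^esub> FA (F \<times>\<^sub>F G) f"
      by (cases f; cases g)
        (auto simp: arrs_prod cmp_prod F.pres_cmp G.pres_cmp
          cmp_prod[OF F.arr_closed F.arr_closed G.arr_closed G.arr_closed])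
  next
    fix f x y assume "f \<in> arrs (A \<times>\<^sub>C A') x y"
    then show "FA (F \<times>\<^sub>F G) f \<in> arrs (B \<times>\<^sub>C B') (FO (F \<times>\<^sub>F G) x) (FO (F \<times>\<^sub>F G) y)"
      by (cases f; cases x; cases y) (auto simp: arrs_prod F.arr_closed G.arr_closed)
  qed (auto simp: F.obj_closed G.obj_closed F.pres_idt G.pres_idt)
qed

lemma is_functor_fassoc: "is_functor ((A \<times>\<^sub>C B) \<times>\<^sub>C C) (A \<times>\<^sub>C (B \<times>\<^sub>C C)) fassoc"
proof
  fix f g x y z
  assume f: "f \<in> arrs ((A \<times>\<^sub>C B) \<times>\<^sub>C C) x y" and g: "g \<in> arrs ((A \<times>\<^sub>C B) \<times>\<^sub>C C) y z"
  obtain f1 f2 f3 g1 g2 g3 where e: "f = ((f1, f2), f3)" "g = ((g1, g2), g3)"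
    by (cases f; cases g) (metis surj_pair)
  show "FA fassoc (g \<cdot>\<^bsub>(A \<times>\<^sub>C B) \<times>\<^sub>C C\<^esub> f) = FA fassoc g \<cdot>\<^bsub>A \<times>\<^sub>C B \<times>\<^sub>C C\<^esub> FA fassoc f"
    using f g
    by (cases x; cases y; cases z)
      (auto simp: e arrs_def prod_cat_def)
next
  fix f x y assume "f \<in> arrs ((A \<times>\<^sub>C B) \<times>\<^sub>C C) x y"
  then show "FA fassoc f \<in> arrs (A \<times>\<^sub>C B \<times>\<^sub>C C) (FO fassoc x) (FO fassoc y)"
    by (cases f; cases x; cases y) (auto simp: arrs_prod split: prod.splits)
qed auto

lemma is_functor_funit:
  "is_functor A (one_cat \<times>\<^sub>C A) funit_l" "is_functor A (A \<times>\<^sub>C one_cat) funit_r"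
  by standard (auto simp: arrs_def prod_cat_def one_cat_def)

lemma is_functor_pick:
  assumes "category A" "x \<in> Obj A"
  shows "is_functor one_cat A (pick A x)"
proof -
  interpret category A by fact
  show ?thesis
    by standard (use assms(2) idt_closed idt_left[OF idt_closed] in \<open>auto simp: one_cat_def\<close>)
qed

lemma nat_isoD:
  assumes "nat_iso A B F G \<tau>"
  shows "x \<in> Obj A \<Longrightarrow> \<tau> x \<in> iso_arrs B (FO F x) (FO G x)"
    and "f \<in> arrs A x y \<Longrightarrow> \<tau> y \<cdot>\<^bsub>B\<^esub> FA F f = FA G f \<cdot>\<^bsub>B\<^esub> \<tau> x"
  using assms by (auto simp: nat_iso_def)

lemma nat_iso_id:
  assumes "category A" "category B" "is_functor A B F"
  shows "nat_iso A B F F (\<lambda>x. Idt B (FO F x))"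
proof -
  interpret A: category A by fact
  interpret B: category B by fact
  interpret F: is_functor A B F by fact
  show ?thesis
    using B.idt_left[OF F.arr_closed] B.idt_right[OF F.arr_closed] B.iso_arrs_idt F.obj_closed
    by (auto simp: nat_iso_def)
qed

text \<open>The componentwise inverses are natural because the components of \<open>\<tau>\<close> can be cancelled.\<close>

lemma nat_iso_inverse:
  assumes A: "category A" and B: "category B" and F: "is_functor A B F" and G: "is_functor A B G"
    and \<tau>: "nat_iso A B F G \<tau>"
  shows "\<exists>\<sigma>. nat_iso A B G F \<sigma>"
proof -
  interpret A: category A by fact
  interpret B: category B by fact
  interpret F: is_functor A B F by fact
  interpret G: is_functor A B G by fact
  have "\<forall>x \<in> Obj A. \<exists>g. g \<in> iso_arrs B (FO G x) (FO F x) \<and>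
      g \<cdot>\<^bsub>B\<^esub> \<tau> x = Idt B (FO F x) \<and> \<tau> x \<cdot>\<^bsub>B\<^esub> g = Idt B (FO G x)"
    using nat_isoD(1)[OF \<tau>] by (meson B.iso_arrs_inverse)
  then obtain \<sigma> where \<sigma>: "\<And>x. x \<in> Obj A \<Longrightarrow> \<sigma> x \<in> iso_arrs B (FO G x) (FO F x)"
      "\<And>x. x \<in> Obj A \<Longrightarrow> \<sigma> x \<cdot>\<^bsub>B\<^esub> \<tau> x = Idt B (FO F x)"
      "\<And>x. x \<in> Obj A \<Longrightarrow> \<tau> x \<cdot>\<^bsub>B\<^esub> \<sigma> x = Idt B (FO G x)"
    by (metis (no_types, lifting))
  have "\<sigma> y \<cdot>\<^bsub>B\<^esub> FA G f = FA F f \<cdot>\<^bsub>B\<^esub> \<sigma> x" if f: "f \<in> arrs A x y" for f x y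
  proof -
    have o: "x \<in> Obj A" "y \<in> Obj A" using A.arrs_objs[OF f] by auto
    have T: "FA G f \<in> arrs B (FO G x) (FO G y)" "FA F f \<in> arrs B (FO F x) (FO F y)"
      "\<sigma> x \<in> arrs B (FO G x) (FO F x)" "\<sigma> y \<in> arrs B (FO G y) (FO F y)"
      "\<tau> x \<in> arrs B (FO F x) (FO G x)" "\<tau> y \<in> arrs B (FO F y) (FO G y)"
      using f o \<sigma>(1) nat_isoD(1)[OF \<tau>] F.arr_closed G.arr_closed by (auto dest: iso_arrsD)
    have "\<tau> y \<cdot>\<^bsub>B\<^esub> (\<sigma> y \<cdot>\<^bsub>B\<^esub> FA G f) = FA G f"
      using T \<sigma> o by (simp add: B.idt_left flip: B.cmp_assoc)
    also have "\<dots> = FA G f \<cdot>\<^bsub>B\<^esub> (\<tau> x \<cdot>\<^bsub>B\<^esub> \<sigma> x)"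
      using T \<sigma> o by (simp add: B.idt_right)
    also have "\<dots> = (\<tau> y \<cdot>\<^bsub>B\<^esub> FA F f) \<cdot>\<^bsub>B\<^esub> \<sigma> x"
      unfolding nat_isoD(2)[OF \<tau> f] using T by (simp add: B.cmp_assoc)
    also have "\<dots> = \<tau> y \<cdot>\<^bsub>B\<^esub> (FA F f \<cdot>\<^bsub>B\<^esub> \<sigma> x)"
      using T by (simp add: B.cmp_assoc)
    finally show ?thesis
      using B.iso_arrs_mono nat_isoD(1)[OF \<tau> o(2)] T B.cmp_closed by meson
  qed
  with \<sigma>(1) show ?thesis unfolding nat_iso_def by blast
qed

lemma nat_iso_vcomp:
  assumes A: "category A" and B: "category B"
    and F: "is_functor A B F" and G: "is_functor A B G" and H: "is_functor A B H"
    and \<tau>: "nat_iso A B F G \<tau>" and \<sigma>: "nat_iso A B G H \<sigma>"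
  shows "nat_iso A B F H (\<lambda>x. \<sigma> x \<cdot>\<^bsub>B\<^esub> \<tau> x)"
proof -
  interpret A: category A by fact
  interpret B: category B by fact
  interpret F: is_functor A B F by fact
  interpret G: is_functor A B G by fact
  interpret H: is_functor A B H by fact
  have "\<sigma> y \<cdot>\<^bsub>B\<^esub> \<tau> y \<cdot>\<^bsub>B\<^esub> FA F f = FA H f \<cdot>\<^bsub>B\<^esub> (\<sigma> x \<cdot>\<^bsub>B\<^esub> \<tau> x)" if f: "f \<in> arrs A x y" for f x y
  proof -
    have o: "x \<in> Obj A" "y \<in> Obj A" using A.arrs_objs[OF f] by auto
    have T: "FA F f \<in> arrs B (FO F x) (FO F y)" "FA G f \<in> arrs B (FO G x) (FO G y)"
      "FA H f \<in> arrs B (FO H x) (FO H y)"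
      "\<tau> x \<in> arrs B (FO F x) (FO G x)" "\<tau> y \<in> arrs B (FO F y) (FO G y)"
      "\<sigma> x \<in> arrs B (FO G x) (FO H x)" "\<sigma> y \<in> arrs B (FO G y) (FO H y)"
      using f o nat_isoD(1)[OF \<tau>] nat_isoD(1)[OF \<sigma>] F.arr_closed G.arr_closed H.arr_closed
      by (auto dest: iso_arrsD)
    have "\<sigma> y \<cdot>\<^bsub>B\<^esub> \<tau> y \<cdot>\<^bsub>B\<^esub> FA F f = \<sigma> y \<cdot>\<^bsub>B\<^esub> (FA G f \<cdot>\<^bsub>B\<^esub> \<tau> x)"
      using T nat_isoD(2)[OF \<tau> f] by (simp add: B.cmp_assoc)
    also have "\<dots> = (FA H f \<cdot>\<^bsub>B\<^esub> \<sigma> x) \<cdot>\<^bsub>B\<^esub> \<tau> x"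
      unfolding nat_isoD(2)[OF \<sigma> f, symmetric] using T by (simp add: B.cmp_assoc)
    also have "\<dots> = FA H f \<cdot>\<^bsub>B\<^esub> (\<sigma> x \<cdot>\<^bsub>B\<^esub> \<tau> x)"
      using T by (simp add: B.cmp_assoc)
    finally show ?thesis .
  qed
  then show ?thesis
    using B.iso_arrs_cmp[OF nat_isoD(1)[OF \<tau>] nat_isoD(1)[OF \<sigma>]] unfolding nat_iso_def by blast
qed

lemma nat_iso_whisker_left:
  assumes A: "category A" and B: "category B"
    and F: "is_functor A B F" and G: "is_functor A B G" and H: "is_functor B C H"
    and \<tau>: "nat_iso A B F G \<tau>"
  shows "nat_iso A C (H \<circ>\<^sub>F F) (H \<circ>\<^sub>F G) (\<lambda>x. FA H (\<tau> x))"
proof -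
  interpret A: category A by fact
  interpret H: is_functor B C H by fact
  interpret F: is_functor A B F by fact
  interpret G: is_functor A B G by fact
  have "FA H (\<tau> y) \<cdot>\<^bsub>C\<^esub> FA H (FA F f) = FA H (FA G f) \<cdot>\<^bsub>C\<^esub> FA H (\<tau> x)" if f: "f \<in> arrs A x y" for f x y
  proof -
    have o: "x \<in> Obj A" "y \<in> Obj A" using A.arrs_objs[OF f] by auto
    note n = nat_isoD(1)[OF \<tau>, THEN iso_arrsD]
    show ?thesis
      unfolding H.pres_cmp[OF F.arr_closed[OF f] n[OF o(2)], symmetric]
        H.pres_cmp[OF n[OF o(1)] G.arr_closed[OF f], symmetric] nat_isoD(2)[OF \<tau> f] ..
  qed
  then show ?thesis
    using is_functor_iso_arrs[OF B H nat_isoD(1)[OF \<tau>]] by (auto simp: nat_iso_def)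
qed

lemma nat_iso_whisker_right:
  assumes K: "is_functor X A K" and \<tau>: "nat_iso A B F G \<tau>"
  shows "nat_iso X B (F \<circ>\<^sub>F K) (G \<circ>\<^sub>F K) (\<lambda>x. \<tau> (FO K x))"
  using is_functor.obj_closed[OF K] is_functor.arr_closed[OF K] \<tau>
  unfolding nat_iso_def fcomp_sel by blast

lemma nat_iso_prod:
  assumes F: "is_functor A B F" and G: "is_functor A B G"
    and F': "is_functor A' B' F'" and G': "is_functor A' B' G'"
    and A: "category A" and A': "category A'"
    and \<tau>: "nat_iso A B F G \<tau>" and \<sigma>: "nat_iso A' B' F' G' \<sigma>"
  shows "nat_iso (A \<times>\<^sub>C A') (B \<times>\<^sub>C B') (F \<times>\<^sub>F F') (G \<times>\<^sub>F G') (map_prod \<tau> \<sigma>)"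
proof -
  interpret F: is_functor A B F by fact
  interpret G: is_functor A B G by fact
  interpret F': is_functor A' B' F' by fact
  interpret G': is_functor A' B' G' by fact
  interpret A: category A by fact
  interpret A': category A' by fact
  note n = nat_isoD(1)[OF \<tau>] nat_isoD(1)[OF \<sigma>]
  have "map_prod \<tau> \<sigma> x \<in> iso_arrs (B \<times>\<^sub>C B') (FO (F \<times>\<^sub>F F') x) (FO (G \<times>\<^sub>F G') x)"
    if "x \<in> Obj (A \<times>\<^sub>C A')" for x
    using that n F.obj_closed G.obj_closed F'.obj_closed G'.obj_closed by (auto intro!: iso_arrs_prod)
  moreover have "map_prod \<tau> \<sigma> y \<cdot>\<^bsub>B \<times>\<^sub>C B'\<^esub> FA (F \<times>\<^sub>F F') f = FA (G \<times>\<^sub>F G') f \<cdot>\<^bsub>B \<times>\<^sub>C B'\<^esub> map_prod \<tau> \<sigma> x"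
    if f: "f \<in> arrs (A \<times>\<^sub>C A') x y" for x y f
  proof -
  obtain f1 f2 x1 x2 y1 y2 where e: "f = (f1, f2)" "x = (x1, x2)" "y = (y1, y2)"
    by (cases f; cases x; cases y) auto
  have T: "f1 \<in> arrs A x1 y1" "f2 \<in> arrs A' x2 y2" using f by (auto simp: e arrs_prod)
  then have o: "x1 \<in> Obj A" "x2 \<in> Obj A'" "y1 \<in> Obj A" "y2 \<in> Obj A'"
    using A.arrs_objs A'.arrs_objs by auto
  show ?thesis
    using cmp_prod[OF F.arr_closed[OF T(1)] iso_arrsD[OF n(1)[OF o(3)]]
        F'.arr_closed[OF T(2)] iso_arrsD[OF n(2)[OF o(4)]]]
      cmp_prod[OF iso_arrsD[OF n(1)[OF o(1)]] G.arr_closed[OF T(1)]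
        iso_arrsD[OF n(2)[OF o(2)]] G'.arr_closed[OF T(2)]]
      nat_isoD(2)[OF \<tau> T(1)] nat_isoD(2)[OF \<sigma> T(2)]
    by (simp add: e)
  qed
  ultimately show ?thesis unfolding nat_iso_def by blast
qed

section \<open>Morphisms of Ho Cat and their representatives\<close>

lemma iso_rel_functors: "(F, G) \<in> iso_rel A B \<Longrightarrow> is_functor A B F \<and> is_functor A B G"
  by (simp add: iso_rel_def)

lemma iso_rel_refl:
  "\<lbrakk>category A; category B; is_functor A B F\<rbrakk> \<Longrightarrow> (F, F) \<in> iso_rel A B"
  using nat_iso_id by (auto simp: iso_rel_def)

lemma iso_rel_sym:
  "\<lbrakk>category A; category B; (F, G) \<in> iso_rel A B\<rbrakk> \<Longrightarrow> (G, F) \<in> iso_rel A B"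
  using nat_iso_inverse by (auto simp: iso_rel_def)

lemma iso_rel_trans:
  "\<lbrakk>category A; category B; (F, G) \<in> iso_rel A B; (G, H) \<in> iso_rel A B\<rbrakk> \<Longrightarrow> (F, H) \<in> iso_rel A B"
  unfolding iso_rel_def by (blast intro: nat_iso_vcomp)

lemma iso_rel_fcomp:
  assumes A: "category A" and B: "category B" and C: "category C"
    and F: "(F, F') \<in> iso_rel A B" and G: "(G, G') \<in> iso_rel B C"
  shows "(G \<circ>\<^sub>F F, G' \<circ>\<^sub>F F') \<in> iso_rel A C"
proof -
  have f: "is_functor A B F" "is_functor A B F'" "is_functor B C G" "is_functor B C G'"
    using iso_rel_functors F G by blast+
  obtain \<tau> \<sigma> where "nat_iso A B F F' \<tau>" "nat_iso B C G G' \<sigma>"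
    using F G by (auto simp: iso_rel_def)
  then have "nat_iso A C (G \<circ>\<^sub>F F) (G \<circ>\<^sub>F F') (\<lambda>x. FA G (\<tau> x))"
    "nat_iso A C (G \<circ>\<^sub>F F') (G' \<circ>\<^sub>F F') (\<lambda>x. \<sigma> (FO F' x))"
    using f nat_iso_whisker_left[OF A B] nat_iso_whisker_right by blast+
  then have "(G \<circ>\<^sub>F F, G \<circ>\<^sub>F F') \<in> iso_rel A C" "(G \<circ>\<^sub>F F', G' \<circ>\<^sub>F F') \<in> iso_rel A C"
    using f is_functor_fcomp by (auto simp: iso_rel_def)
  then show ?thesis using iso_rel_trans[OF A C] by blast
qed

lemma iso_rel_fprod:
  assumes A: "category A" and A': "category A'"
    and F: "(F, F') \<in> iso_rel A B" and G: "(G, G') \<in> iso_rel A' B'"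
  shows "(F \<times>\<^sub>F G, F' \<times>\<^sub>F G') \<in> iso_rel (A \<times>\<^sub>C A') (B \<times>\<^sub>C B')"
proof -
  have f: "is_functor A B F" "is_functor A B F'" "is_functor A' B' G" "is_functor A' B' G'"
    using iso_rel_functors F G by blast+
  obtain \<tau> \<sigma> where "nat_iso A B F F' \<tau>" "nat_iso A' B' G G' \<sigma>"
    using F G by (auto simp: iso_rel_def)
  then show ?thesis
    using f nat_iso_prod[OF f A A'] is_functor_fprod by (fastforce simp: iso_rel_def)
qed

lemma in_iso_class: "G \<in> iso_class A B F \<longleftrightarrow> (F, G) \<in> iso_rel A B"
  by (simp add: iso_class_def)

lemma iso_class_eqI:
  assumes "category A" "category B" and r: "(F, G) \<in> iso_rel A B"
  shows "iso_class A B F = iso_class A B G"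
  using iso_rel_trans[OF assms] iso_rel_trans[OF assms(1,2) iso_rel_sym[OF assms]]
  by (intro set_eqI) (metis in_iso_class)

lemma iso_class_eqD:
  assumes "category A" "category B" "is_functor A B G" "iso_class A B F = iso_class A B G"
  shows "(F, G) \<in> iso_rel A B"
  using iso_rel_refl[OF assms(1-3)] assms(4) by (simp flip: in_iso_class)

text \<open>For a morphism of Ho Cat, a functor in the class; as the class is nonempty this is a member of it.\<close>

definition rep :: "('o, 'a, 'p, 'b) funct set \<Rightarrow> ('o, 'a, 'p, 'b) funct" where
  "rep f = (SOME F. F \<in> f)"

lemma rep_ho_hom:
  assumes "category A" "category B" "f \<in> ho_hom A B"
  shows "is_functor A B (rep f)" "iso_class A B (rep f) = f"
proof -
  obtain F where F: "is_functor A B F" "f = iso_class A B F"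
    using assms(3) by (auto simp: ho_hom_def iso_class_def elim!: quotientE)
  then have "F \<in> f" using iso_rel_refl[OF assms(1,2)] by (simp add: in_iso_class)
  then have "rep f \<in> f" unfolding rep_def by (rule someI)
  then have r: "(F, rep f) \<in> iso_rel A B" by (simp add: F in_iso_class)
  then show "is_functor A B (rep f)" by (simp add: iso_rel_functors)
  show "iso_class A B (rep f) = f"
    using iso_class_eqI[OF assms(1,2) r] F(2) by (rule trans[OF sym sym])
qed

lemma ho_comp_iso_class:
  assumes A: "category A" and B: "category B" and C: "category C"
    and F: "is_functor A B F" and G: "is_functor B C G"
  shows "ho_comp A C (iso_class B C G) (iso_class A B F) = iso_class A C (G \<circ>\<^sub>F F)"
proof -
  have "iso_class A C (G' \<circ>\<^sub>F F') = iso_class A C (G \<circ>\<^sub>F F)"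
    if "(G, G') \<in> iso_rel B C" "(F, F') \<in> iso_rel A B" for F' G'
  proof -
    have r: "(G \<circ>\<^sub>F F, G' \<circ>\<^sub>F F') \<in> iso_rel A C"
      using that iso_rel_fcomp[OF A B C] by blast
    then show ?thesis
      using iso_class_eqI[OF A C r] by simp
  qed
  then have "ho_comp A C (iso_class B C G) (iso_class A B F) =
      (\<Union>G' \<in> iso_class B C G. \<Union>F' \<in> iso_class A B F. iso_class A C (G \<circ>\<^sub>F F))"
    unfolding ho_comp_def by (intro SUP_cong refl) (simp add: in_iso_class)
  moreover have "iso_class A B F \<noteq> {}" "iso_class B C G \<noteq> {}"
    using iso_rel_refl[OF A B F] iso_rel_refl[OF B C G] by (auto simp flip: in_iso_class)
  ultimately show ?thesis by simp
qed

lemma ho_prod_iso_class: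
  assumes A: "category A" and B: "category B" and A': "category A'" and B': "category B'"
    and F: "is_functor A B F" and G: "is_functor A' B' G"
  shows "ho_prod A B A' B' (iso_class A B F) (iso_class A' B' G)
    = iso_class (A \<times>\<^sub>C A') (B \<times>\<^sub>C B') (F \<times>\<^sub>F G)"
proof -
  have "iso_class (A \<times>\<^sub>C A') (B \<times>\<^sub>C B') (F' \<times>\<^sub>F G') = iso_class (A \<times>\<^sub>C A') (B \<times>\<^sub>C B') (F \<times>\<^sub>F G)"
    if "(F, F') \<in> iso_rel A B" "(G, G') \<in> iso_rel A' B'" for F' G'
  proof -
    have r: "(F \<times>\<^sub>F G, F' \<times>\<^sub>F G') \<in> iso_rel (A \<times>\<^sub>C A') (B \<times>\<^sub>C B')"
      using that iso_rel_fprod[OF A A'] by blast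
    then show ?thesis
      using iso_class_eqI[OF category_prod[OF A A'] category_prod[OF B B'] r] by simp
  qed
  then have "ho_prod A B A' B' (iso_class A B F) (iso_class A' B' G) =
      (\<Union>F' \<in> iso_class A B F. \<Union>G' \<in> iso_class A' B' G. iso_class (A \<times>\<^sub>C A') (B \<times>\<^sub>C B') (F \<times>\<^sub>F G))"
    unfolding ho_prod_def by (intro SUP_cong refl) (simp add: in_iso_class)
  moreover have "iso_class A B F \<noteq> {}" "iso_class A' B' G \<noteq> {}"
    using iso_rel_refl[OF A B F] iso_rel_refl[OF A' B' G] by (auto simp flip: in_iso_class)
  ultimately show ?thesis by simp
qed

text \<open>The functors whose class is an isomorphism of Ho Cat.  Having a quasi-inverse, rather than being
  fully faithful and essentially surjective, is the form in which such functors can be composed and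
  cancelled by pure algebra with natural isomorphism.\<close>

definition ho_iso :: "('o, 'a) cat \<Rightarrow> ('p, 'b) cat \<Rightarrow> ('o, 'a, 'p, 'b) funct \<Rightarrow> bool" where
  "ho_iso A B F \<longleftrightarrow> is_functor A B F \<and>
    (\<exists>G. is_functor B A G \<and> (G \<circ>\<^sub>F F, fid) \<in> iso_rel A A \<and> (F \<circ>\<^sub>F G, fid) \<in> iso_rel B B)"

lemma fcomp_assoc: "(H \<circ>\<^sub>F G) \<circ>\<^sub>F F = H \<circ>\<^sub>F G \<circ>\<^sub>F F"
  by (simp add: fcomp_def comp_assoc)

lemma fcomp_fid [simp]: "F \<circ>\<^sub>F fid = F" "fid \<circ>\<^sub>F F = F"
  by (rule funct_eqI; simp)+

text \<open>Naturality of \<open>\<tau> : G F \<cong> 1\<close> recovers \<open>f\<close> from \<open>F f\<close> as \<open>\<tau> (G F f) \<tau>\<inverse>\<close>.\<close>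

lemma faithful_of_left_inverse:
  assumes A: "category A" and r: "(G \<circ>\<^sub>F F, fid) \<in> iso_rel A A"
  shows "inj_on (FA F) (arrs A x y)"
proof (rule inj_onI)
  interpret category A by fact
  obtain \<tau> where \<tau>: "nat_iso A A (G \<circ>\<^sub>F F) fid \<tau>" using r by (auto simp: iso_rel_def)
  fix f g assume fg: "f \<in> arrs A x y" "g \<in> arrs A x y" "FA F f = FA F g"
  have "f \<cdot>\<^bsub>A\<^esub> \<tau> x = g \<cdot>\<^bsub>A\<^esub> \<tau> x"
    using nat_isoD(2)[OF \<tau> fg(1)] nat_isoD(2)[OF \<tau> fg(2)] fg(3) by simp
  moreover have "\<tau> x \<in> iso_arrs A (FO G (FO F x)) x"
    using nat_isoD(1)[OF \<tau>] arrs_objs[OF fg(1)] by simp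
  ultimately show "f = g" using iso_arrs_epi fg by blast
qed

text \<open>Both \<open>F\<close> and its quasi-inverse \<open>G\<close> are faithful by the previous lemma.  For fullness, conjugating
  \<open>G b\<close> by the components of \<open>G F \<cong> 1\<close> gives an arrow \<open>f\<close> with \<open>G (F f) = G b\<close>, whence \<open>F f = b\<close>.\<close>

lemma ho_iso_imp_cat_equivalence:
  assumes A: "category A" and B: "category B" and F: "ho_iso A B F"
  shows "cat_equivalence A B F"
proof -
  interpret A: category A by fact
  interpret B: category B by fact
  obtain G where G: "is_functor B A G" "(G \<circ>\<^sub>F F, fid) \<in> iso_rel A A" "(F \<circ>\<^sub>F G, fid) \<in> iso_rel B B"
    using F by (auto simp: ho_iso_def)
  interpret F: is_functor A B F using F by (simp add: ho_iso_def)
  interpret G: is_functor B A G by fact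
  obtain \<tau> \<sigma> where \<tau>: "nat_iso A A (G \<circ>\<^sub>F F) fid \<tau>" and \<sigma>: "nat_iso B B (F \<circ>\<^sub>F G) fid \<sigma>"
    using G by (auto simp: iso_rel_def)
  have "bij_betw (FA F) (arrs A x y) (arrs B (FO F x) (FO F y))"
    if o: "x \<in> Obj A" "y \<in> Obj A" for x y
    unfolding bij_betw_def
  proof (intro conjI equalityI subsetI)
    show "inj_on (FA F) (arrs A x y)"
      using faithful_of_left_inverse[OF A G(2)] .
    fix b assume b: "b \<in> arrs B (FO F x) (FO F y)"
    have x: "\<tau> x \<in> iso_arrs A (FO G (FO F x)) x" and y: "\<tau> y \<in> iso_arrs A (FO G (FO F y)) y"
      using nat_isoD(1)[OF \<tau>] o by auto
    obtain t where t: "t \<in> iso_arrs A x (FO G (FO F x))" "t \<cdot>\<^bsub>A\<^esub> \<tau> x = Idt A (FO G (FO F x))"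
      using x by (rule A.iso_arrs_inverse)
    define f where "f = (\<tau> y \<cdot>\<^bsub>A\<^esub> FA G b) \<cdot>\<^bsub>A\<^esub> t"
    have gb: "FA G b \<in> arrs A (FO G (FO F x)) (FO G (FO F y))" using G.arr_closed[OF b] .
    have tb: "\<tau> y \<cdot>\<^bsub>A\<^esub> FA G b \<in> arrs A (FO G (FO F x)) y"
      using A.cmp_closed[OF gb iso_arrsD[OF y]] .
    then have f: "f \<in> arrs A x y"
      unfolding f_def using A.cmp_closed t(1) by (blast dest: iso_arrsD)
    have "f \<cdot>\<^bsub>A\<^esub> \<tau> x = \<tau> y \<cdot>\<^bsub>A\<^esub> FA G b"
      unfolding f_def A.cmp_assoc[OF iso_arrsD[OF x] iso_arrsD[OF t(1)] tb] t(2)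
      using A.idt_right[OF tb] .
    then have "\<tau> y \<cdot>\<^bsub>A\<^esub> FA G (FA F f) = \<tau> y \<cdot>\<^bsub>A\<^esub> FA G b"
      using nat_isoD(2)[OF \<tau> f] by simp
    then have "FA G (FA F f) = FA G b"
      using A.iso_arrs_mono[OF y] G.arr_closed[OF F.arr_closed[OF f]] gb by blast
    then have "FA F f = b"
      using faithful_of_left_inverse[OF B G(3)] F.arr_closed[OF f] b by (auto dest: inj_onD)
    then show "b \<in> FA F ` arrs A x y" using f by blast
  qed (use F.arr_closed in auto)
  moreover have "\<exists>x \<in> Obj A. isomorphic B (FO F x) z" if "z \<in> Obj B" for z
    using nat_isoD(1)[OF \<sigma> that] G.obj_closed[OF that] by (auto simp: isomorphic_def)
  ultimately show ?thesis
    by (auto simp: cat_equivalence_def F.is_functor_axioms)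
qed

lemma ho_iso_fcomp:
  assumes A: "category A" and B: "category B" and C: "category C"
    and F: "ho_iso A B F" and G: "ho_iso B C G"
  shows "ho_iso A C (G \<circ>\<^sub>F F)"
proof -
  obtain F' where F': "is_functor B A F'" "(F' \<circ>\<^sub>F F, fid) \<in> iso_rel A A" "(F \<circ>\<^sub>F F', fid) \<in> iso_rel B B"
    using F by (auto simp: ho_iso_def)
  obtain G' where G': "is_functor C B G'" "(G' \<circ>\<^sub>F G, fid) \<in> iso_rel B B" "(G \<circ>\<^sub>F G', fid) \<in> iso_rel C C"
    using G by (auto simp: ho_iso_def)
  have f: "is_functor A B F" "is_functor B C G" using F G by (auto simp: ho_iso_def)
  note refl = iso_rel_refl[OF A B f(1)] iso_rel_refl[OF B A F'(1)]
    iso_rel_refl[OF B C f(2)] iso_rel_refl[OF C B G'(1)]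
  have "(F' \<circ>\<^sub>F (G' \<circ>\<^sub>F G) \<circ>\<^sub>F F, F' \<circ>\<^sub>F fid \<circ>\<^sub>F F) \<in> iso_rel A A"
    by (rule iso_rel_fcomp[OF A B A iso_rel_fcomp[OF A B B refl(1) G'(2)] refl(2)])
  then have 1: "((F' \<circ>\<^sub>F G') \<circ>\<^sub>F (G \<circ>\<^sub>F F), fid) \<in> iso_rel A A"
    using iso_rel_trans[OF A A _ F'(2)] by (simp add: fcomp_assoc)
  have "(G \<circ>\<^sub>F (F \<circ>\<^sub>F F') \<circ>\<^sub>F G', G \<circ>\<^sub>F fid \<circ>\<^sub>F G') \<in> iso_rel C C"
    by (rule iso_rel_fcomp[OF C B C iso_rel_fcomp[OF C B B refl(4) F'(3)] refl(3)])
  then have "((G \<circ>\<^sub>F F) \<circ>\<^sub>F (F' \<circ>\<^sub>F G'), fid) \<in> iso_rel C C"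
    using iso_rel_trans[OF C C _ G'(3)] by (simp add: fcomp_assoc)
  with 1 show ?thesis
    using is_functor_fcomp[OF f] is_functor_fcomp[OF G'(1) F'(1)] unfolding ho_iso_def by blast
qed

lemma ho_iso_cong:
  assumes A: "category A" and B: "category B"
    and r: "(F, F') \<in> iso_rel A B" and F: "ho_iso A B F"
  shows "ho_iso A B F'"
proof -
  obtain G where G: "is_functor B A G" "(G \<circ>\<^sub>F F, fid) \<in> iso_rel A A" "(F \<circ>\<^sub>F G, fid) \<in> iso_rel B B"
    using F by (auto simp: ho_iso_def)
  note r' = iso_rel_sym[OF A B r] and gg = iso_rel_refl[OF B A G(1)]
  have "(G \<circ>\<^sub>F F', fid) \<in> iso_rel A A" "(F' \<circ>\<^sub>F G, fid) \<in> iso_rel B B"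
    using iso_rel_trans[OF A A iso_rel_fcomp[OF A B A r' gg] G(2)]
      iso_rel_trans[OF B B iso_rel_fcomp[OF B A B gg r'] G(3)] by auto
  then show ?thesis
    using G(1) iso_rel_functors[OF r] unfolding ho_iso_def by blast
qed

text \<open>With \<open>K\<close> inverse to \<open>G F\<close> and \<open>L\<close> inverse to \<open>H G\<close>, the functor \<open>G\<close> has the right inverse \<open>F K\<close> and
  the left inverse \<open>L H\<close>.  These agree, so \<open>F K G \<cong> L H G \<cong> 1\<close>, and \<open>K G\<close> is inverse to \<open>F\<close>.\<close>

lemma ho_iso_two_of_six:
  assumes A: "category A" and B: "category B" and C: "category C" and D: "category D"
    and F: "is_functor A B F" and G: "is_functor B C G" and H: "is_functor C D H"
    and GF: "ho_iso A C (G \<circ>\<^sub>F F)" and HG: "ho_iso B D (H \<circ>\<^sub>F G)"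
  shows "ho_iso A B F"
proof -
  obtain K where K: "is_functor C A K" "(K \<circ>\<^sub>F G \<circ>\<^sub>F F, fid) \<in> iso_rel A A"
      "(G \<circ>\<^sub>F F \<circ>\<^sub>F K, fid) \<in> iso_rel C C"
    using GF unfolding ho_iso_def fcomp_assoc by blast
  obtain L where L: "is_functor D B L" "(L \<circ>\<^sub>F H \<circ>\<^sub>F G, fid) \<in> iso_rel B B"
    using HG unfolding ho_iso_def fcomp_assoc by blast
  have KG: "is_functor B A (K \<circ>\<^sub>F G)" using is_functor_fcomp[OF G K(1)] .
  have FK: "is_functor C B (F \<circ>\<^sub>F K)" using is_functor_fcomp[OF K(1) F] .
  have LH: "is_functor C B (L \<circ>\<^sub>F H)" using is_functor_fcomp[OF H L(1)] .
  have 1: "((L \<circ>\<^sub>F H \<circ>\<^sub>F G) \<circ>\<^sub>F F \<circ>\<^sub>F K, F \<circ>\<^sub>F K) \<in> iso_rel C B"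
    using iso_rel_fcomp[OF C B B iso_rel_refl[OF C B FK] L(2)] by simp
  have 2: "((L \<circ>\<^sub>F H) \<circ>\<^sub>F G \<circ>\<^sub>F F \<circ>\<^sub>F K, L \<circ>\<^sub>F H) \<in> iso_rel C B"
    using iso_rel_fcomp[OF C C B K(3) iso_rel_refl[OF C B LH]] by simp
  have "(F \<circ>\<^sub>F K, L \<circ>\<^sub>F H) \<in> iso_rel C B"
    using iso_rel_trans[OF C B iso_rel_sym[OF C B 1]] 2 by (simp add: fcomp_assoc)
  then have "((F \<circ>\<^sub>F K) \<circ>\<^sub>F G, (L \<circ>\<^sub>F H) \<circ>\<^sub>F G) \<in> iso_rel B B"
    by (rule iso_rel_fcomp[OF B C B iso_rel_refl[OF B C G]])
  then have "(F \<circ>\<^sub>F K \<circ>\<^sub>F G, fid) \<in> iso_rel B B"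
    using iso_rel_trans[OF B B _ L(2)] by (simp add: fcomp_assoc)
  then show ?thesis
    using K(2) KG F unfolding ho_iso_def by (auto simp: fcomp_assoc)
qed

text \<open>Here \<open>T \<cong> R\<inverse> L S\<close>.\<close>

lemma ho_iso_square:
  assumes cats: "category A" "category B" "category B'" "category C"
    and L: "ho_iso B C L" and R: "ho_iso B' C R"
    and S: "ho_iso A B S" and T: "is_functor A B' T"
    and sq: "(L \<circ>\<^sub>F S, R \<circ>\<^sub>F T) \<in> iso_rel A C"
  shows "ho_iso A B' T"
proof -
  obtain R' where R': "is_functor C B' R'" "(R' \<circ>\<^sub>F R, fid) \<in> iso_rel B' B'" "(R \<circ>\<^sub>F R', fid) \<in> iso_rel C C"
    using R by (auto simp: ho_iso_def)
  then have iR': "ho_iso C B' R'" using R by (auto simp: ho_iso_def)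
  have 1: "((R' \<circ>\<^sub>F R) \<circ>\<^sub>F T, T) \<in> iso_rel A B'"
    using iso_rel_fcomp[OF cats(1,3,3) iso_rel_refl[OF cats(1,3) T] R'(2)] by simp
  have "(R' \<circ>\<^sub>F L \<circ>\<^sub>F S, R' \<circ>\<^sub>F R \<circ>\<^sub>F T) \<in> iso_rel A B'"
    using iso_rel_fcomp[OF cats(1,4,3) sq iso_rel_refl[OF cats(4,3) R'(1)]] .
  then have "(R' \<circ>\<^sub>F L \<circ>\<^sub>F S, T) \<in> iso_rel A B'"
    using iso_rel_trans[OF cats(1,3) _ 1] by (simp add: fcomp_assoc)
  then show ?thesis
    using ho_iso_cong[OF cats(1,3)] ho_iso_fcomp[OF cats(1,4,3) ho_iso_fcomp[OF cats(1,2,4) S L] iR'] by blast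
qed

section \<open>Enriched equivalences are local equivalences\<close>

text \<open>Each composite of classes in the unit laws, in enriched naturality and in the composition of the
  underlying category, and one side of associativity, has the form \<open>M \<circ> (U \<times> V) \<circ> K\<close> with a structural
  functor \<open>K\<close>; this reduces them to composites of representatives.\<close>

lemma ho_comp_prod_iso_class:
  assumes cats: "category A" "category X" "category X'" "category Y" "category Y'" "category Z"
    and K: "is_functor A (X \<times>\<^sub>C Y) K" and U: "is_functor X X' U" and V: "is_functor Y Y' V"
    and M: "is_functor (X' \<times>\<^sub>C Y') Z M"
  shows "ho_comp A Z (iso_class (X' \<times>\<^sub>C Y') Z M)
      (ho_comp A (X' \<times>\<^sub>C Y') (ho_prod X X' Y Y' (iso_class X X' U) (iso_class Y Y' V))
        (iso_class A (X \<times>\<^sub>C Y) K))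
    = iso_class A Z (M \<circ>\<^sub>F (U \<times>\<^sub>F V) \<circ>\<^sub>F K)"
    and "is_functor A Z (M \<circ>\<^sub>F (U \<times>\<^sub>F V) \<circ>\<^sub>F K)"
proof -
  note XY = category_prod[OF cats(2,4)] and XY' = category_prod[OF cats(3,5)]
  note UV = is_functor_fprod[OF U V]
  note UVK = is_functor_fcomp[OF K UV]
  show "ho_comp A Z (iso_class (X' \<times>\<^sub>C Y') Z M)
      (ho_comp A (X' \<times>\<^sub>C Y') (ho_prod X X' Y Y' (iso_class X X' U) (iso_class Y Y' V))
        (iso_class A (X \<times>\<^sub>C Y) K))
    = iso_class A Z (M \<circ>\<^sub>F (U \<times>\<^sub>F V) \<circ>\<^sub>F K)"
    unfolding ho_prod_iso_class[OF cats(2-5) U V] ho_comp_iso_class[OF cats(1) XY XY' K UV]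
      ho_comp_iso_class[OF cats(1) XY' cats(6) UVK M] ..
  show "is_functor A Z (M \<circ>\<^sub>F (U \<times>\<^sub>F V) \<circ>\<^sub>F K)"
    using is_functor_fcomp[OF UVK M] .
qed

context ho_category
begin

definition comp_rep :: "'o \<Rightarrow> 'o \<Rightarrow> 'o \<Rightarrow> ('h \<times> 'h, 'm \<times> 'm, 'h, 'm) funct" where
  "comp_rep a b c = rep (EComp C a b c)"

definition unit_rep :: "'o \<Rightarrow> (unit, unit, 'h, 'm) funct" where
  "unit_rep a = rep (EId C a)"

lemma comp_rep:
  assumes "a \<in> EOb C" "b \<in> EOb C" "c \<in> EOb C"
  shows "is_functor (EHom C b c \<times>\<^sub>C EHom C a b) (EHom C a c) (comp_rep a b c)"
    and "EComp C a b c = iso_class (EHom C b c \<times>\<^sub>C EHom C a b) (EHom C a c) (comp_rep a b c)"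
  unfolding comp_rep_def
  using rep_ho_hom[OF category_prod[OF hom_category hom_category] hom_category comp_mor] assms by simp_all

lemma unit_rep:
  assumes "a \<in> EOb C"
  shows "is_functor one_cat (EHom C a a) (unit_rep a)"
    and "EId C a = iso_class one_cat (EHom C a a) (unit_rep a)"
  unfolding unit_rep_def
  using rep_ho_hom[OF category_one hom_category id_mor] assms by simp_all

lemma assoc_rep:
  assumes o: "a \<in> EOb C" "b \<in> EOb C" "c \<in> EOb C" "d \<in> EOb C"
  shows "(comp_rep a b d \<circ>\<^sub>F (comp_rep b c d \<times>\<^sub>F fid),
      comp_rep a c d \<circ>\<^sub>F (fid \<times>\<^sub>F comp_rep a b c) \<circ>\<^sub>F fassoc)
    \<in> iso_rel ((EHom C c d \<times>\<^sub>C EHom C b c) \<times>\<^sub>C EHom C a b) (EHom C a d)"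
proof -
  note h = hom_category
  note ab = h[OF o(1,2)] and bc = h[OF o(2,3)] and cd = h[OF o(3,4)]
    and bd = h[OF o(2,4)] and ac = h[OF o(1,3)] and ad = h[OF o(1,4)]
  note P = category_prod[OF cd bc] and Q = category_prod[OF bc ab]
  note lhs = is_functor_fprod[OF comp_rep(1)[OF o(2,3,4)] is_functor_fid[of "EHom C a b"]]
  note rhs = ho_comp_prod_iso_class[OF category_prod[OF P ab] cd cd Q ac ad is_functor_fassoc
      is_functor_fid comp_rep(1)[OF o(1,2,3)] comp_rep(1)[OF o(1,3,4)]]
  show ?thesis
    using assoc[OF o]
    unfolding Let_def ho_id_def comp_rep(2)[OF o(1,2,4)] comp_rep(2)[OF o(2,3,4)]
      comp_rep(2)[OF o(1,2,3)] comp_rep(2)[OF o(1,3,4)] rhs(1)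
      ho_prod_iso_class[OF P bd ab ab comp_rep(1)[OF o(2,3,4)] is_functor_fid]
      ho_comp_iso_class[OF category_prod[OF P ab] category_prod[OF bd ab] ad lhs comp_rep(1)[OF o(1,2,4)]]
    by (rule iso_class_eqD[OF category_prod[OF P ab] ad rhs(2)])
qed

lemma unit_left_rep:
  assumes o: "a \<in> EOb C" "b \<in> EOb C"
  shows "(comp_rep a b b \<circ>\<^sub>F (unit_rep b \<times>\<^sub>F fid) \<circ>\<^sub>F funit_l, fid)
    \<in> iso_rel (EHom C a b) (EHom C a b)"
proof -
  note ab = hom_category[OF o] and bb = hom_category[OF o(2,2)]
  note lhs = ho_comp_prod_iso_class[OF ab category_one bb ab ab ab is_functor_funit(1)
      unit_rep(1)[OF o(2)] is_functor_fid comp_rep(1)[OF o(1,2,2)]]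
  show ?thesis
    using unit_left[OF o]
    unfolding Let_def ho_id_def comp_rep(2)[OF o(1,2,2)] unit_rep(2)[OF o(2)] lhs(1)
    by (rule iso_class_eqD[OF ab ab is_functor_fid])
qed

lemma unit_right_rep:
  assumes o: "a \<in> EOb C" "b \<in> EOb C"
  shows "(comp_rep a a b \<circ>\<^sub>F (fid \<times>\<^sub>F unit_rep a) \<circ>\<^sub>F funit_r, fid)
    \<in> iso_rel (EHom C a b) (EHom C a b)"
proof -
  note ab = hom_category[OF o] and aa = hom_category[OF o(1,1)]
  note lhs = ho_comp_prod_iso_class[OF ab ab ab category_one aa ab is_functor_funit(2)
      is_functor_fid unit_rep(1)[OF o(1)] comp_rep(1)[OF o(1,1,2)]]
  show ?thesis
    using unit_right[OF o]
    unfolding Let_def ho_id_def comp_rep(2)[OF o(1,1,2)] unit_rep(2)[OF o(1)] lhs(1)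
    by (rule iso_class_eqD[OF ab ab is_functor_fid])
qed

text \<open>A functor \<open>1 \<rightarrow> C(a,b)\<close> stands for a 1-cell \<open>a \<rightarrow> b\<close> of \<open>C\<close>.  The following are composition of such
  1-cells, and the functors \<open>C(a,b) \<rightarrow> C(a,c)\<close> and \<open>C(b,c) \<rightarrow> C(a,c)\<close> which compose with one of them
  after and before.\<close>

definition under :: "'o \<Rightarrow> 'o \<Rightarrow> 'o \<Rightarrow> (unit, unit, 'h, 'm) funct \<Rightarrow> (unit, unit, 'h, 'm) funct
    \<Rightarrow> (unit, unit, 'h, 'm) funct" where
  "under a b c v u = comp_rep a b c \<circ>\<^sub>F (v \<times>\<^sub>F u) \<circ>\<^sub>F funit_l"

definition post :: "'o \<Rightarrow> 'o \<Rightarrow> 'o \<Rightarrow> (unit, unit, 'h, 'm) funct \<Rightarrow> ('h, 'm, 'h, 'm) funct" where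
  "post a b c u = comp_rep a b c \<circ>\<^sub>F (u \<times>\<^sub>F fid) \<circ>\<^sub>F funit_l"

definition pre :: "'o \<Rightarrow> 'o \<Rightarrow> 'o \<Rightarrow> (unit, unit, 'h, 'm) funct \<Rightarrow> ('h, 'm, 'h, 'm) funct" where
  "pre a b c u = comp_rep a b c \<circ>\<^sub>F (fid \<times>\<^sub>F u) \<circ>\<^sub>F funit_r"

lemma post_cong:
  assumes o: "a \<in> EOb C" "b \<in> EOb C" "c \<in> EOb C"
    and r: "(u, u') \<in> iso_rel one_cat (EHom C b c)"
  shows "(post a b c u, post a b c u') \<in> iso_rel (EHom C a b) (EHom C a c)"
proof -
  note ab = hom_category[OF o(1,2)] and bc = hom_category[OF o(2,3)] and ac = hom_category[OF o(1,3)]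
  note p1 = category_prod[OF category_one ab] and p2 = category_prod[OF bc ab]
  show ?thesis
    unfolding post_def
    by (rule iso_rel_fcomp[OF ab p2 ac iso_rel_fcomp[OF ab p1 p2 iso_rel_refl[OF ab p1 is_functor_funit(1)]
      iso_rel_fprod[OF category_one ab r iso_rel_refl[OF ab ab is_functor_fid]]]
      iso_rel_refl[OF p2 ac comp_rep(1)[OF o]]])
qed

lemma pre_cong:
  assumes o: "a \<in> EOb C" "b \<in> EOb C" "c \<in> EOb C"
    and r: "(u, u') \<in> iso_rel one_cat (EHom C a b)"
  shows "(pre a b c u, pre a b c u') \<in> iso_rel (EHom C b c) (EHom C a c)"
proof -
  note ab = hom_category[OF o(1,2)] and bc = hom_category[OF o(2,3)] and ac = hom_category[OF o(1,3)]
  note p1 = category_prod[OF bc category_one] and p2 = category_prod[OF bc ab]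
  show ?thesis
    unfolding pre_def
    by (rule iso_rel_fcomp[OF bc p2 ac iso_rel_fcomp[OF bc p1 p2 iso_rel_refl[OF bc p1 is_functor_funit(2)]
      iso_rel_fprod[OF bc category_one iso_rel_refl[OF bc bc is_functor_fid] r]]
      iso_rel_refl[OF p2 ac comp_rep(1)[OF o]]])
qed

text \<open>Associativity, restricted along the functor \<open>K : f \<mapsto> ((v, u), f)\<close>.\<close>

lemma post_under:
  assumes o: "a \<in> EOb C" "b \<in> EOb C" "c \<in> EOb C" "d \<in> EOb C"
    and u: "is_functor one_cat (EHom C b c) u" and v: "is_functor one_cat (EHom C c d) v"
  shows "(post a c d v \<circ>\<^sub>F post a b c u, post a b d (under b c d v u)) \<in> iso_rel (EHom C a b) (EHom C a d)"
proof -
  note ab = hom_category[OF o(1,2)] and bc = hom_category[OF o(2,3)] and cd = hom_category[OF o(3,4)]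
    and ad = hom_category[OF o(1,4)]
  define K where "K = (((v \<times>\<^sub>F u) \<circ>\<^sub>F funit_l) \<times>\<^sub>F fid) \<circ>\<^sub>F (funit_l :: ('h, 'm, unit \<times> 'h, unit \<times> 'm) funct)"
  let ?X = "(EHom C c d \<times>\<^sub>C EHom C b c) \<times>\<^sub>C EHom C a b"
  note X = category_prod[OF category_prod[OF cd bc] ab]
  have K: "is_functor (EHom C a b) ?X K"
    unfolding K_def
    by (rule is_functor_fcomp[OF is_functor_funit(1) is_functor_fprod[OF
      is_functor_fcomp[OF is_functor_funit(1) is_functor_fprod[OF v u]] is_functor_fid]])
  have "((comp_rep a b d \<circ>\<^sub>F (comp_rep b c d \<times>\<^sub>F fid)) \<circ>\<^sub>F K,
      (comp_rep a c d \<circ>\<^sub>F (fid \<times>\<^sub>F comp_rep a b c) \<circ>\<^sub>F fassoc) \<circ>\<^sub>F K) \<in> iso_rel (EHom C a b) (EHom C a d)"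
    by (rule iso_rel_fcomp[OF ab X ad iso_rel_refl[OF ab X K] assoc_rep[OF o]])
  also have "(comp_rep a b d \<circ>\<^sub>F (comp_rep b c d \<times>\<^sub>F fid)) \<circ>\<^sub>F K = post a b d (under b c d v u)"
    by (rule funct_eqI) (simp_all add: K_def post_def under_def)
  also have "(comp_rep a c d \<circ>\<^sub>F (fid \<times>\<^sub>F comp_rep a b c) \<circ>\<^sub>F fassoc) \<circ>\<^sub>F K
      = post a c d v \<circ>\<^sub>F post a b c u"
    by (rule funct_eqI) (simp_all add: K_def post_def)
  finally show ?thesis by (rule iso_rel_sym[OF ab ad])
qed

text \<open>Associativity, restricted along the functor \<open>K : f \<mapsto> ((f, v), u)\<close>.\<close>

lemma pre_under:
  assumes o: "a \<in> EOb C" "b \<in> EOb C" "c \<in> EOb C" "d \<in> EOb C"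
    and u: "is_functor one_cat (EHom C a b) u" and v: "is_functor one_cat (EHom C b c) v"
  shows "(pre a b d u \<circ>\<^sub>F pre b c d v, pre a c d (under a b c v u)) \<in> iso_rel (EHom C c d) (EHom C a d)"
proof -
  note ab = hom_category[OF o(1,2)] and bc = hom_category[OF o(2,3)] and cd = hom_category[OF o(3,4)]
    and ad = hom_category[OF o(1,4)]
  define K where "K = (((fid \<times>\<^sub>F v) \<circ>\<^sub>F funit_r) \<times>\<^sub>F u) \<circ>\<^sub>F (funit_r :: ('h, 'm, 'h \<times> unit, 'm \<times> unit) funct)"
  let ?X = "(EHom C c d \<times>\<^sub>C EHom C b c) \<times>\<^sub>C EHom C a b"
  note X = category_prod[OF category_prod[OF cd bc] ab]
  have K: "is_functor (EHom C c d) ?X K"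
    unfolding K_def
    by (rule is_functor_fcomp[OF is_functor_funit(2) is_functor_fprod[OF
      is_functor_fcomp[OF is_functor_funit(2) is_functor_fprod[OF is_functor_fid v]] u]])
  have "((comp_rep a b d \<circ>\<^sub>F (comp_rep b c d \<times>\<^sub>F fid)) \<circ>\<^sub>F K,
      (comp_rep a c d \<circ>\<^sub>F (fid \<times>\<^sub>F comp_rep a b c) \<circ>\<^sub>F fassoc) \<circ>\<^sub>F K) \<in> iso_rel (EHom C c d) (EHom C a d)"
    by (rule iso_rel_fcomp[OF cd X ad iso_rel_refl[OF cd X K] assoc_rep[OF o]])
  also have "(comp_rep a b d \<circ>\<^sub>F (comp_rep b c d \<times>\<^sub>F fid)) \<circ>\<^sub>F K = pre a b d u \<circ>\<^sub>F pre b c d v"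
    by (rule funct_eqI) (simp_all add: K_def pre_def)
  also have "(comp_rep a c d \<circ>\<^sub>F (fid \<times>\<^sub>F comp_rep a b c) \<circ>\<^sub>F fassoc) \<circ>\<^sub>F K
      = pre a c d (under a b c v u)"
    by (rule funct_eqI) (simp_all add: K_def pre_def under_def)
  finally show ?thesis .
qed

text \<open>If \<open>v\<close> is inverse to \<open>u\<close>, composing with \<open>v\<close> is inverse to composing with \<open>u\<close>: combine
  the composites into composition with \<open>v u\<close> or \<open>u v\<close>, replace that by the identity, and apply the unit law.\<close>

lemma ho_iso_post:
  assumes o: "a \<in> EOb C" "b \<in> EOb C" "c \<in> EOb C"
    and vu: "(under b c b v u, unit_rep b) \<in> iso_rel one_cat (EHom C b b)"
    and uv: "(under c b c u v, unit_rep c) \<in> iso_rel one_cat (EHom C c c)"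
    and u: "is_functor one_cat (EHom C b c) u" and v: "is_functor one_cat (EHom C c b) v"
  shows "ho_iso (EHom C a b) (EHom C a c) (post a b c u)"
proof -
  note ab = hom_category[OF o(1,2)] and ac = hom_category[OF o(1,3)]
  have "(post a c b v \<circ>\<^sub>F post a b c u, fid) \<in> iso_rel (EHom C a b) (EHom C a b)"
    using iso_rel_trans[OF ab ab post_under[OF o(1,2,3,2) u v]]
      iso_rel_trans[OF ab ab post_cong[OF o(1,2,2) vu]] unit_left_rep[OF o(1,2)]
    by (simp add: post_def)
  moreover have "(post a b c u \<circ>\<^sub>F post a c b v, fid) \<in> iso_rel (EHom C a c) (EHom C a c)"
    using iso_rel_trans[OF ac ac post_under[OF o(1,3,2,3) v u]]
      iso_rel_trans[OF ac ac post_cong[OF o(1,3,3) uv]] unit_left_rep[OF o(1,3)]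
    by (simp add: post_def)
  moreover have "is_functor (EHom C a b) (EHom C a c) (post a b c u)"
      "is_functor (EHom C a c) (EHom C a b) (post a c b v)"
    using post_cong[OF o iso_rel_refl[OF category_one hom_category u]]
      post_cong[OF o(1,3,2) iso_rel_refl[OF category_one hom_category v]] o
    by (auto dest: iso_rel_functors)
  ultimately show ?thesis unfolding ho_iso_def by blast
qed

lemma ho_iso_pre:
  assumes o: "a \<in> EOb C" "b \<in> EOb C" "c \<in> EOb C"
    and vu: "(under a b a v u, unit_rep a) \<in> iso_rel one_cat (EHom C a a)"
    and uv: "(under b a b u v, unit_rep b) \<in> iso_rel one_cat (EHom C b b)"
    and u: "is_functor one_cat (EHom C a b) u" and v: "is_functor one_cat (EHom C b a) v"
  shows "ho_iso (EHom C b c) (EHom C a c) (pre a b c u)"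
proof -
  note bc = hom_category[OF o(2,3)] and ac = hom_category[OF o(1,3)]
  have "(pre b a c v \<circ>\<^sub>F pre a b c u, fid) \<in> iso_rel (EHom C b c) (EHom C b c)"
    using iso_rel_trans[OF bc bc pre_under[OF o(2,1,2,3) v u]]
      iso_rel_trans[OF bc bc pre_cong[OF o(2,2,3) uv]] unit_right_rep[OF o(2,3)]
    by (simp add: pre_def)
  moreover have "(pre a b c u \<circ>\<^sub>F pre b a c v, fid) \<in> iso_rel (EHom C a c) (EHom C a c)"
    using iso_rel_trans[OF ac ac pre_under[OF o(1,2,1,3) u v]]
      iso_rel_trans[OF ac ac pre_cong[OF o(1,1,3) vu]] unit_right_rep[OF o(1,3)]
    by (simp add: pre_def)
  moreover have "is_functor (EHom C b c) (EHom C a c) (pre a b c u)"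
      "is_functor (EHom C a c) (EHom C b c) (pre b a c v)"
    using pre_cong[OF o iso_rel_refl[OF category_one hom_category u]]
      pre_cong[OF o(2,1,3) iso_rel_refl[OF category_one hom_category v]] o
    by (auto dest: iso_rel_functors)
  ultimately show ?thesis unfolding ho_iso_def by blast
qed

lemma ho_under_comp_eq_EId:
  assumes o: "a \<in> EOb C" "b \<in> EOb C"
    and u: "u \<in> ho_hom one_cat (EHom C a b)" and v: "v \<in> ho_hom one_cat (EHom C b a)"
    and eq: "ho_under_comp C a b a v u = EId C a"
  shows "(under a b a (rep v) (rep u), unit_rep a) \<in> iso_rel one_cat (EHom C a a)"
proof -
  note aa = hom_category[OF o(1,1)] and ab = hom_category[OF o(1,2)] and ba = hom_category[OF o(2,1)]
  note u' = rep_ho_hom[OF category_one ab u] and v' = rep_ho_hom[OF category_one ba v]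
  note c = ho_comp_prod_iso_class[OF category_one category_one ba category_one ab aa
      is_functor_funit(1) v'(1) u'(1) comp_rep(1)[OF o(1,2,1)]]
  have "iso_class one_cat (EHom C a a) (under a b a (rep v) (rep u))
      = iso_class one_cat (EHom C a a) (unit_rep a)"
    using eq unfolding ho_under_comp_def comp_rep(2)[OF o(1,2,1)] unit_rep(2)[OF o(1)]
    using c(1) by (simp add: u'(2) v'(2) under_def)
  then show ?thesis
    by (rule iso_class_eqD[OF category_one aa unit_rep(1)[OF o(1)]])
qed

end

lemma ho_nat_isomorphic_sym:
  "ho_nat_isomorphic C D F G \<Longrightarrow> ho_nat_isomorphic C D G F"
  unfolding ho_nat_isomorphic_def by blast

text \<open>By naturality, following \<open>F\<close> on \<open>C(a,b)\<close> by composition after with \<open>\<alpha> b\<close> is the same as following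
  \<open>G\<close> by composition before with \<open>\<alpha> a\<close>; both compositions are invertible.\<close>

lemma ho_nat_isomorphic_ho_iso:
  fixes C :: "('o, 'h, 'm) hocat" and D :: "('p, 'k, 'n) hocat"
  assumes D: "ho_category D" and FG: "ho_nat_isomorphic C D F G"
    and o: "a \<in> EOb C" "b \<in> EOb C" and X: "category (EHom C a b)"
    and F: "EFO F a \<in> EOb D" "EFO F b \<in> EOb D"
    and G: "EFO G a \<in> EOb D" "EFO G b \<in> EOb D"
    and S: "EFA F a b = iso_class (EHom C a b) (EHom D (EFO F a) (EFO F b)) S"
      "ho_iso (EHom C a b) (EHom D (EFO F a) (EFO F b)) S"
    and T: "EFA G a b = iso_class (EHom C a b) (EHom D (EFO G a) (EFO G b)) T"
      "is_functor (EHom C a b) (EHom D (EFO G a) (EFO G b)) T"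
  shows "ho_iso (EHom C a b) (EHom D (EFO G a) (EFO G b)) T"
proof -
  interpret D: ho_category D by fact
  obtain \<alpha> \<beta> where \<alpha>: "ho_nat_trans C D F G \<alpha>" and \<beta>: "ho_nat_trans C D G F \<beta>"
    and inv: "\<And>a. a \<in> EOb C \<Longrightarrow>
        ho_under_comp D (EFO F a) (EFO G a) (EFO F a) (\<beta> a) (\<alpha> a) = EId D (EFO F a)"
      "\<And>a. a \<in> EOb C \<Longrightarrow>
        ho_under_comp D (EFO G a) (EFO F a) (EFO G a) (\<alpha> a) (\<beta> a) = EId D (EFO G a)"
    using FG by (auto simp: ho_nat_isomorphic_def)
  have mor: "\<alpha> a \<in> ho_hom one_cat (EHom D (EFO F a) (EFO G a))" "\<alpha> b \<in> ho_hom one_cat (EHom D (EFO F b) (EFO G b))"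
    "\<beta> a \<in> ho_hom one_cat (EHom D (EFO G a) (EFO F a))" "\<beta> b \<in> ho_hom one_cat (EHom D (EFO G b) (EFO F b))"
    using \<alpha> \<beta> o by (auto simp: ho_nat_trans_def)
  note h = D.hom_category
  note \<alpha>a = rep_ho_hom[OF category_one h[OF F(1) G(1)] mor(1)]
  note \<alpha>b = rep_ho_hom[OF category_one h[OF F(2) G(2)] mor(2)]
  note \<beta>a = rep_ho_hom[OF category_one h[OF G(1) F(1)] mor(3)]
  note \<beta>b = rep_ho_hom[OF category_one h[OF G(2) F(2)] mor(4)]
  let ?A = "EFO F a" and ?B = "EFO F b" and ?A' = "EFO G a" and ?B' = "EFO G b"
  have sS: "is_functor (EHom C a b) (EHom D ?A ?B) S" using S(2) by (simp add: ho_iso_def)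
  note l = ho_comp_prod_iso_class[OF X category_one h[OF F(2) G(2)] X h[OF F] h[OF F(1) G(2)]
      is_functor_funit(1) \<alpha>b(1) sS D.comp_rep(1)[OF F G(2)]]
  note r = ho_comp_prod_iso_class[OF X X h[OF G] category_one h[OF F(1) G(1)] h[OF F(1) G(2)]
      is_functor_funit(2) T(2) \<alpha>a(1) D.comp_rep(1)[OF F(1) G]]
  have nat: "iso_class (EHom C a b) (EHom D ?A ?B')
      (D.comp_rep ?A ?B ?B' \<circ>\<^sub>F (rep (\<alpha> b) \<times>\<^sub>F S) \<circ>\<^sub>F funit_l)
    = iso_class (EHom C a b) (EHom D ?A ?B')
      (D.comp_rep ?A ?A' ?B' \<circ>\<^sub>F (T \<times>\<^sub>F rep (\<alpha> a)) \<circ>\<^sub>F funit_r)"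
    unfolding l(1)[symmetric] r(1)[symmetric]
    unfolding \<alpha>a(2) \<alpha>b(2) S(1)[symmetric] T(1)[symmetric]
      D.comp_rep(2)[OF F G(2), symmetric] D.comp_rep(2)[OF F(1) G, symmetric]
    using \<alpha> o unfolding ho_nat_trans_def Let_def by blast
  have "D.comp_rep ?A ?B ?B' \<circ>\<^sub>F (rep (\<alpha> b) \<times>\<^sub>F S) \<circ>\<^sub>F funit_l = D.post ?A ?B ?B' (rep (\<alpha> b)) \<circ>\<^sub>F S"
    by (rule funct_eqI) (simp_all add: D.post_def)
  moreover have "D.comp_rep ?A ?A' ?B' \<circ>\<^sub>F (T \<times>\<^sub>F rep (\<alpha> a)) \<circ>\<^sub>F funit_r = D.pre ?A ?A' ?B' (rep (\<alpha> a)) \<circ>\<^sub>F T"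
    by (rule funct_eqI) (simp_all add: D.pre_def)
  ultimately have sq: "(D.post ?A ?B ?B' (rep (\<alpha> b)) \<circ>\<^sub>F S, D.pre ?A ?A' ?B' (rep (\<alpha> a)) \<circ>\<^sub>F T)
      \<in> iso_rel (EHom C a b) (EHom D ?A ?B')"
    using iso_class_eqD[OF X h[OF F(1) G(2)] r(2) nat] by simp
  have "ho_iso (EHom D ?A ?B) (EHom D ?A ?B') (D.post ?A ?B ?B' (rep (\<alpha> b)))"
    by (rule D.ho_iso_post[OF F G(2)
      D.ho_under_comp_eq_EId[OF F(2) G(2) mor(2,4) inv(1)[OF o(2)]]
      D.ho_under_comp_eq_EId[OF G(2) F(2) mor(4,2) inv(2)[OF o(2)]] \<alpha>b(1) \<beta>b(1)])
  moreover have "ho_iso (EHom D ?A' ?B') (EHom D ?A ?B') (D.pre ?A ?A' ?B' (rep (\<alpha> a)))"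
    by (rule D.ho_iso_pre[OF F(1) G
      D.ho_under_comp_eq_EId[OF F(1) G(1) mor(1,3) inv(1)[OF o(1)]]
      D.ho_under_comp_eq_EId[OF G(1) F(1) mor(3,1) inv(2)[OF o(1)]] \<alpha>a(1) \<beta>a(1)])
  ultimately show ?thesis
    by (rule ho_iso_square[OF X h[OF F] h[OF G] h[OF F(1) G(2)] _ _ S(2) T(2) sq])
qed

lemma ho_iso_fid: "category A \<Longrightarrow> ho_iso A A fid"
  using iso_rel_refl[OF _ _ is_functor_fid] is_functor_fid unfolding ho_iso_def by fastforce

text \<open>The chain \<open>C(a,b) \<rightarrow> D(F a, F b) \<rightarrow> C(G F a, G F b) \<rightarrow> D(F G F a, F G F b)\<close> satisfies the hypotheses of
  the 2-out-of-6 property, because \<open>G F\<close> and \<open>F G\<close> are naturally isomorphic to identity functors.\<close>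

lemma ho_equivalence_ho_iso:
  fixes C :: "('o, 'h, 'm) hocat" and D :: "('p, 'k, 'n) hocat"
  assumes C: "ho_category C" and D: "ho_category D" and F: "ho_equivalence C D F"
    and o: "a \<in> EOb C" "b \<in> EOb C"
    and S: "EFA F a b = iso_class (EHom C a b) (EHom D (EFO F a) (EFO F b)) S"
      "is_functor (EHom C a b) (EHom D (EFO F a) (EFO F b)) S"
  shows "ho_iso (EHom C a b) (EHom D (EFO F a) (EFO F b)) S"
proof -
  interpret C: ho_category C by fact
  interpret D: ho_category D by fact
  obtain G where G: "ho_functor D C G"
    and \<eta>: "ho_nat_isomorphic C C (ho_functor_id C) (ho_functor_comp C C G F)"
    and \<epsilon>: "ho_nat_isomorphic D D (ho_functor_comp D D F G) (ho_functor_id D)"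
    using F by (auto simp: ho_equivalence_def)
  interpret F: ho_functor C D F using F by (simp add: ho_equivalence_def)
  interpret G: ho_functor D C G by fact
  let ?a = "EFO F a" and ?b = "EFO F b"
  let ?a' = "EFO G ?a" and ?b' = "EFO G ?b"
  note fo = F.obj_closed[OF o(1)] F.obj_closed[OF o(2)]
  note gfo = G.obj_closed[OF fo(1)] G.obj_closed[OF fo(2)]
  note fgfo = F.obj_closed[OF gfo(1)] F.obj_closed[OF gfo(2)]
  note X = C.hom_category[OF o] and Y = D.hom_category[OF fo] and X' = C.hom_category[OF gfo]
    and Y' = D.hom_category[OF fgfo]
  define T where "T = rep (EFA G ?a ?b)"
  define S' where "S' = rep (EFA F ?a' ?b')"
  have T: "is_functor (EHom D ?a ?b) (EHom C ?a' ?b') T"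
      "iso_class (EHom D ?a ?b) (EHom C ?a' ?b') T = EFA G ?a ?b"
    unfolding T_def using rep_ho_hom[OF Y X' G.hom_mor[OF fo]] .
  have S': "is_functor (EHom C ?a' ?b') (EHom D (EFO F ?a') (EFO F ?b')) S'"
      "iso_class (EHom C ?a' ?b') (EHom D (EFO F ?a') (EFO F ?b')) S' = EFA F ?a' ?b'"
    unfolding S'_def using rep_ho_hom[OF X' Y' F.hom_mor[OF gfo]] .
  have "ho_iso (EHom C a b) (EHom C ?a' ?b') (T \<circ>\<^sub>F S)"
    using ho_nat_isomorphic_ho_iso[OF C \<eta> o X, of fid "T \<circ>\<^sub>F S"] o gfo ho_iso_fid[OF X]
      ho_comp_iso_class[OF X Y X' S(2) T(1)] is_functor_fcomp[OF S(2) T(1)]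
    by (simp add: ho_functor_id_def ho_functor_comp_def ho_id_def S(1) T(2))
  moreover have "ho_iso (EHom D ?a ?b) (EHom D (EFO F ?a') (EFO F ?b')) (S' \<circ>\<^sub>F T)"
    using ho_nat_isomorphic_ho_iso[OF D ho_nat_isomorphic_sym[OF \<epsilon>] fo Y, of fid "S' \<circ>\<^sub>F T"]
      fo fgfo ho_iso_fid[OF Y]
      ho_comp_iso_class[OF Y X' Y' T(1) S'(1)] is_functor_fcomp[OF T(1) S'(1)]
    by (simp add: ho_functor_id_def ho_functor_comp_def ho_id_def T(2) S'(2))
  ultimately show ?thesis
    by (rule ho_iso_two_of_six[OF X Y X' Y' S(2) T(1) S'(1)])
qed

section \<open>Pseudofunctors whose underlying functor is an equivalence\<close>

text \<open>Enriched invertibility only provides an equation between classes of functors out of the terminal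
  category; evaluated at the object of that category it is an invertible 2-cell.\<close>

lemma isomorphic_of_ho_under_comp_eq_EId:
  assumes D: "ho_category D" and E: "bicategory E" and u: "underlies_bicategory D E"
    and o: "a \<in> BOb E" "b \<in> BOb E"
    and f: "f \<in> ho_hom one_cat (EHom D a b)" and g: "g \<in> ho_hom one_cat (EHom D b a)"
    and eq: "ho_under_comp D a b a g f = EId D a"
  shows "isomorphic (BHom E a a) (hcomp1 E a b a (FO (rep g) ()) (FO (rep f) ())) (BId E a)"
proof -
  interpret E: bicategory E by fact
  note aa = E.hom_category[OF o(1,1)] and ab = E.hom_category[OF o(1,2)] and ba = E.hom_category[OF o(2,1)]
  have hom: "EHom D a b = BHom E a b" "EHom D b a = BHom E b a" "EHom D a a = BHom E a a"
    and id: "EId D a = iso_class one_cat (BHom E a a) (pick (BHom E a a) (BId E a))"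
    and comp: "EComp D a b a = iso_class (BHom E b a \<times>\<^sub>C BHom E a b) (BHom E a a) (BComp E a b a)"
    using u o by (simp_all add: underlies_bicategory_def)
  note f' = rep_ho_hom[OF category_one ab f[unfolded hom]] and g' = rep_ho_hom[OF category_one ba g[unfolded hom]]
  note c = ho_comp_prod_iso_class[OF category_one category_one ba category_one ab aa
      is_functor_funit(1) g'(1) f'(1) E.comp_functor[OF o(1,2,1)]]
  have "iso_class one_cat (BHom E a a) (BComp E a b a \<circ>\<^sub>F (rep g \<times>\<^sub>F rep f) \<circ>\<^sub>F funit_l)
      = iso_class one_cat (BHom E a a) (pick (BHom E a a) (BId E a))"
    using eq unfolding ho_under_comp_def hom id comp c(1)[symmetric] f'(2) g'(2) .
  then have "(BComp E a b a \<circ>\<^sub>F (rep g \<times>\<^sub>F rep f) \<circ>\<^sub>F funit_l, pick (BHom E a a) (BId E a))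
      \<in> iso_rel one_cat (BHom E a a)"
    by (rule iso_class_eqD[OF category_one aa is_functor_pick[OF aa E.id_closed[OF o(1)]]])
  then show ?thesis
    by (auto simp: iso_rel_def isomorphic_def nat_iso_def one_cat_def)
qed

text \<open>The hom-functors of \<open>P\<close> represent those of \<open>F\<close>, which are invertible; and for an inverse \<open>G\<close> of \<open>F\<close>,
  each object \<open>y\<close> is equivalent to the image of \<open>G y\<close> along the components of \<open>F G \<cong> 1\<close>.\<close>

proposition bicategorical_equivalence_of_ho_equivalence:
  fixes C :: "('o, 'h, 'm) hocat" and D :: "('p, 'k, 'n) hocat"
  assumes C: "ho_category C" and D: "ho_category D" and F: "ho_equivalence C D F"
    and E: "bicategory E" and P: "pseudofunctor B E P"
    and uB: "underlies_bicategory C B" and uE: "underlies_bicategory D E"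
    and uP: "underlies_pseudofunctor F B E P"
  shows "bicategorical_equivalence B E P"
proof -
  interpret C: ho_category C by fact
  interpret D: ho_category D by fact
  interpret E: bicategory E by fact
  interpret P: pseudofunctor B E P by fact
  have obC: "EOb C = BOb B" and obD: "EOb D = BOb E"
    using uB uE by (simp_all add: underlies_bicategory_def)
  have "cat_equivalence (BHom B a b) (BHom E (PO P a) (PO P b)) (PF P a b)"
    if o: "a \<in> BOb B" "b \<in> BOb B" for a b
  proof -
    have hom: "EHom C a b = BHom B a b" "EHom D (PO P a) (PO P b) = BHom E (PO P a) (PO P b)"
      "EFO F a = PO P a" "EFO F b = PO P b"
      "EFA F a b = iso_class (BHom B a b) (BHom E (PO P a) (PO P b)) (PF P a b)"
      using uB uE uP o P.obj_closed
      by (simp_all add: underlies_bicategory_def underlies_pseudofunctor_def)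
    have "ho_iso (BHom B a b) (BHom E (PO P a) (PO P b)) (PF P a b)"
      using ho_equivalence_ho_iso[OF C D F, of a b "PF P a b"] o P.hom_functor[OF o]
      by (simp add: obC hom)
    moreover have "category (BHom B a b)" using C.hom_category[of a b] o by (simp add: obC hom)
    ultimately show ?thesis
      using ho_iso_imp_cat_equivalence E.hom_category o P.obj_closed by blast
  qed
  moreover have "\<exists>x \<in> BOb B. equivalent_objs E (PO P x) y" if y: "y \<in> BOb E" for y
  proof -
    obtain G where G: "ho_functor D C G"
      and \<epsilon>: "ho_nat_isomorphic D D (ho_functor_comp D D F G) (ho_functor_id D)"
      using F by (auto simp: ho_equivalence_def)
    define x where "x = EFO G y"
    have x: "x \<in> BOb B"
      using ho_functor.obj_closed[OF G] y by (simp add: x_def obC obD)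
    then have Fx: "EFO F x = PO P x" "PO P x \<in> BOb E"
      using uP P.obj_closed by (simp_all add: underlies_pseudofunctor_def)
    have FGy: "EFO F (EFO G y) = PO P x" using Fx(1) by (simp add: x_def)
    obtain \<alpha> \<beta> where \<alpha>: "ho_nat_trans D D (ho_functor_comp D D F G) (ho_functor_id D) \<alpha>"
      and \<beta>: "ho_nat_trans D D (ho_functor_id D) (ho_functor_comp D D F G) \<beta>"
      and inv: "ho_under_comp D (PO P x) y (PO P x) (\<beta> y) (\<alpha> y) = EId D (PO P x)"
        "ho_under_comp D y (PO P x) y (\<alpha> y) (\<beta> y) = EId D y"
      using \<epsilon> y
      by (auto simp: ho_nat_isomorphic_def ho_functor_comp_def ho_functor_id_def obD FGy)
    have mor: "\<alpha> y \<in> ho_hom one_cat (EHom D (PO P x) y)" "\<beta> y \<in> ho_hom one_cat (EHom D y (PO P x))"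
      using conjunct1[OF \<alpha>[unfolded ho_nat_trans_def]] conjunct1[OF \<beta>[unfolded ho_nat_trans_def]] y
      by (auto simp: ho_functor_comp_def ho_functor_id_def obD FGy[symmetric])
    have hom: "EHom D (PO P x) y = BHom E (PO P x) y" "EHom D y (PO P x) = BHom E y (PO P x)"
      using uE Fx y by (simp_all add: underlies_bicategory_def)
    have "FO (rep (\<alpha> y)) () \<in> Obj (BHom E (PO P x) y)" "FO (rep (\<beta> y)) () \<in> Obj (BHom E y (PO P x))"
      using rep_ho_hom(1)[OF category_one E.hom_category[OF Fx(2) y] mor(1)[unfolded hom]]
        rep_ho_hom(1)[OF category_one E.hom_category[OF y Fx(2)] mor(2)[unfolded hom]]
      by (auto simp: is_functor_def one_cat_def)
    then have "equivalent_objs E (PO P x) y"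
      using isomorphic_of_ho_under_comp_eq_EId[OF D E uE Fx(2) y mor inv(1)]
        isomorphic_of_ho_under_comp_eq_EId[OF D E uE y Fx(2) mor(2,1) inv(2)]
      unfolding equivalent_objs_def by blast
    with x show ?thesis by blast
  qed
  ultimately show ?thesis
    using P by (simp add: bicategorical_equivalence_def)
qed

section \<open>Lifting the constraints of a bicategory\<close>

lemma full_faithful_reflects_iso:
  assumes A: "category A" and B: "category B" and P: "is_functor A B P"
    and ff: "\<And>x y. \<lbrakk>x \<in> Obj A; y \<in> Obj A\<rbrakk> \<Longrightarrow> bij_betw (FA P) (arrs A x y) (arrs B (FO P x) (FO P y))"
    and f: "f \<in> arrs A x y" "FA P f \<in> iso_arrs B (FO P x) (FO P y)"
  shows "f \<in> iso_arrs A x y"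
proof -
  interpret A: category A by fact
  interpret B: category B by fact
  interpret P: is_functor A B P by fact
  have o: "x \<in> Obj A" "y \<in> Obj A" using A.arrs_objs[OF f(1)] by auto
  obtain b where b: "b \<in> iso_arrs B (FO P y) (FO P x)" "b \<cdot>\<^bsub>B\<^esub> FA P f = Idt B (FO P x)"
      "FA P f \<cdot>\<^bsub>B\<^esub> b = Idt B (FO P y)"
    using f(2) by (rule B.iso_arrs_inverse)
  obtain g where g: "g \<in> arrs A y x" "FA P g = b"
    using bij_betw_imp_surj_on[OF ff[OF o(2,1)]] iso_arrsD[OF b(1)] by (metis imageE)
  have "FA P (g \<cdot>\<^bsub>A\<^esub> f) = FA P (Idt A x)" "FA P (f \<cdot>\<^bsub>A\<^esub> g) = FA P (Idt A y)"
    using P.pres_cmp[OF f(1) g(1)] P.pres_cmp[OF g(1) f(1)] b g(2) o by (simp_all add: P.pres_idt)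
  then have "g \<cdot>\<^bsub>A\<^esub> f = Idt A x" "f \<cdot>\<^bsub>A\<^esub> g = Idt A y"
    using ff[OF o(1,1)] ff[OF o(2,2)] A.cmp_closed[OF f(1) g(1)] A.cmp_closed[OF g(1) f(1)]
      A.idt_closed[OF o(1)] A.idt_closed[OF o(2)]
    by (auto simp: bij_betw_def dest: inj_onD)
  with f(1) g(1) show ?thesis by (auto simp: iso_arrs_def)
qed

text \<open>A fully faithful \<open>P\<close> lifts isomorphisms of functors.  The isomorphism to be lifted is given as a span
  \<open>P S \<leftarrow> K \<rightarrow> P T\<close>, so that \<open>\<alpha>\<close> is specified by an equation without inverses; this is also the form in
  which the axioms of a pseudofunctor mention the constraints of its domain.\<close>

lemma nat_iso_lift:
  assumes X: "category X" and A: "category A" and B: "category B"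
    and S: "is_functor X A S" and T: "is_functor X A T" and P: "is_functor A B P"
    and K: "is_functor X B K"
    and ff: "\<And>x y. \<lbrakk>x \<in> Obj A; y \<in> Obj A\<rbrakk> \<Longrightarrow> bij_betw (FA P) (arrs A x y) (arrs B (FO P x) (FO P y))"
    and \<tau>: "nat_iso X B K (P \<circ>\<^sub>F S) \<tau>" and \<sigma>: "nat_iso X B K (P \<circ>\<^sub>F T) \<sigma>"
  shows "\<exists>\<alpha>. nat_iso X A S T \<alpha> \<and> (\<forall>x \<in> Obj X. FA P (\<alpha> x) \<cdot>\<^bsub>B\<^esub> \<tau> x = \<sigma> x)"
proof -
  interpret X: category X by fact
  interpret A: category A by fact
  interpret B: category B by fact
  interpret S: is_functor X A S by fact
  interpret T: is_functor X A T by fact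
  interpret P: is_functor A B P by fact
  interpret K: is_functor X B K by fact
  have \<tau>_iso: "\<tau> x \<in> iso_arrs B (FO K x) (FO P (FO S x))"
    and \<sigma>_iso: "\<sigma> x \<in> iso_arrs B (FO K x) (FO P (FO T x))" if "x \<in> Obj X" for x
    using nat_isoD(1)[OF \<tau> that] nat_isoD(1)[OF \<sigma> that] by simp_all
  have "\<exists>f \<in> iso_arrs A (FO S x) (FO T x). FA P f \<cdot>\<^bsub>B\<^esub> \<tau> x = \<sigma> x" if x: "x \<in> Obj X" for x
  proof -
    note t = \<tau>_iso[OF x] and s = \<sigma>_iso[OF x]
    obtain r where r: "r \<in> iso_arrs B (FO P (FO S x)) (FO K x)" "r \<cdot>\<^bsub>B\<^esub> \<tau> x = Idt B (FO K x)"
      using t by (rule B.iso_arrs_inverse)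
    have sr: "\<sigma> x \<cdot>\<^bsub>B\<^esub> r \<in> iso_arrs B (FO P (FO S x)) (FO P (FO T x))"
      using B.iso_arrs_cmp[OF r(1) s] .
    then obtain f where f: "f \<in> arrs A (FO S x) (FO T x)" "FA P f = \<sigma> x \<cdot>\<^bsub>B\<^esub> r"
      using bij_betw_imp_surj_on[OF ff[OF S.obj_closed[OF x] T.obj_closed[OF x]]] iso_arrsD[OF sr]
      by (metis imageE)
    have "FA P f \<cdot>\<^bsub>B\<^esub> \<tau> x = \<sigma> x"
      unfolding f(2) B.cmp_assoc[OF iso_arrsD[OF t] iso_arrsD[OF r(1)] iso_arrsD[OF s]] r(2)
      using B.idt_right[OF iso_arrsD[OF s]] .
    moreover have "f \<in> iso_arrs A (FO S x) (FO T x)"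
      using full_faithful_reflects_iso[OF A B P ff f(1)] sr f(2) by simp
    ultimately show ?thesis by blast
  qed
  then obtain \<alpha> where \<alpha>: "\<And>x. x \<in> Obj X \<Longrightarrow> \<alpha> x \<in> iso_arrs A (FO S x) (FO T x)"
      "\<And>x. x \<in> Obj X \<Longrightarrow> FA P (\<alpha> x) \<cdot>\<^bsub>B\<^esub> \<tau> x = \<sigma> x"
    by metis
  have "\<alpha> y \<cdot>\<^bsub>A\<^esub> FA S f = FA T f \<cdot>\<^bsub>A\<^esub> \<alpha> x" if f: "f \<in> arrs X x y" for f x y
  proof -
    have o: "x \<in> Obj X" "y \<in> Obj X" using X.arrs_objs[OF f] by auto
    note ax = iso_arrsD[OF \<alpha>(1)[OF o(1)]] and ay = iso_arrsD[OF \<alpha>(1)[OF o(2)]]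
    note tx = iso_arrsD[OF \<tau>_iso[OF o(1)]] and ty = iso_arrsD[OF \<tau>_iso[OF o(2)]]
    note Sf = S.arr_closed[OF f] and Tf = T.arr_closed[OF f] and Kf = K.arr_closed[OF f]
    note l = A.cmp_closed[OF Sf ay] and r = A.cmp_closed[OF ax Tf]
    have "FA P (\<alpha> y \<cdot>\<^bsub>A\<^esub> FA S f) \<cdot>\<^bsub>B\<^esub> \<tau> x = FA P (\<alpha> y) \<cdot>\<^bsub>B\<^esub> (FA P (FA S f) \<cdot>\<^bsub>B\<^esub> \<tau> x)"
      unfolding P.pres_cmp[OF Sf ay]
      by (rule B.cmp_assoc[OF tx P.arr_closed[OF Sf] P.arr_closed[OF ay]])
    also have "\<dots> = FA P (\<alpha> y) \<cdot>\<^bsub>B\<^esub> (\<tau> y \<cdot>\<^bsub>B\<^esub> FA K f)"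
      using nat_isoD(2)[OF \<tau> f] by simp
    also have "\<dots> = \<sigma> y \<cdot>\<^bsub>B\<^esub> FA K f"
      using B.cmp_assoc[OF Kf ty P.arr_closed[OF ay]] \<alpha>(2)[OF o(2)] by simp
    also have "\<dots> = FA P (FA T f) \<cdot>\<^bsub>B\<^esub> (FA P (\<alpha> x) \<cdot>\<^bsub>B\<^esub> \<tau> x)"
      using nat_isoD(2)[OF \<sigma> f] \<alpha>(2)[OF o(1)] by simp
    also have "\<dots> = FA P (FA T f \<cdot>\<^bsub>A\<^esub> \<alpha> x) \<cdot>\<^bsub>B\<^esub> \<tau> x"
      unfolding P.pres_cmp[OF ax Tf]
      by (rule B.cmp_assoc[OF tx P.arr_closed[OF ax] P.arr_closed[OF Tf], symmetric])
    finally have "FA P (\<alpha> y \<cdot>\<^bsub>A\<^esub> FA S f) = FA P (FA T f \<cdot>\<^bsub>A\<^esub> \<alpha> x)"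
      by (rule B.iso_arrs_epi[OF \<tau>_iso[OF o(1)] P.arr_closed[OF l] P.arr_closed[OF r]])
    then show ?thesis
      using ff[OF S.obj_closed[OF o(1)] T.obj_closed[OF o(2)]] l r
      by (auto simp: bij_betw_def dest: inj_onD)
  qed
  with \<alpha> show ?thesis unfolding nat_iso_def by blast
qed

lemma bifunctor:
  assumes M: "is_functor (B \<times>\<^sub>C A) C M"
  shows "\<lbrakk>g \<in> Obj B; f \<in> Obj A\<rbrakk> \<Longrightarrow> FO M (g, f) \<in> Obj C"
    and "\<lbrakk>\<beta> \<in> arrs B g g'; \<alpha> \<in> arrs A f f'\<rbrakk> \<Longrightarrow> FA M (\<beta>, \<alpha>) \<in> arrs C (FO M (g, f)) (FO M (g', f'))"
    and "\<lbrakk>g \<in> Obj B; f \<in> Obj A\<rbrakk> \<Longrightarrow> FA M (Idt B g, Idt A f) = Idt C (FO M (g, f))"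
    and "\<lbrakk>\<beta> \<in> arrs B g g'; \<alpha> \<in> arrs A f f'; \<beta>' \<in> arrs B g' g''; \<alpha>' \<in> arrs A f' f''\<rbrakk>
      \<Longrightarrow> FA M (\<beta>' \<cdot>\<^bsub>B\<^esub> \<beta>, \<alpha>' \<cdot>\<^bsub>A\<^esub> \<alpha>) = FA M (\<beta>', \<alpha>') \<cdot>\<^bsub>C\<^esub> FA M (\<beta>, \<alpha>)"
proof -
  interpret is_functor "B \<times>\<^sub>C A" C M by fact
  show "\<lbrakk>g \<in> Obj B; f \<in> Obj A\<rbrakk> \<Longrightarrow> FO M (g, f) \<in> Obj C"
    using obj_closed by simp
  show "\<lbrakk>\<beta> \<in> arrs B g g'; \<alpha> \<in> arrs A f f'\<rbrakk> \<Longrightarrow> FA M (\<beta>, \<alpha>) \<in> arrs C (FO M (g, f)) (FO M (g', f'))"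
    by (rule arr_closed) (simp add: arrs_prod)
  show "\<lbrakk>g \<in> Obj B; f \<in> Obj A\<rbrakk> \<Longrightarrow> FA M (Idt B g, Idt A f) = Idt C (FO M (g, f))"
    using pres_idt[of "(g, f)"] by simp
  show "\<lbrakk>\<beta> \<in> arrs B g g'; \<alpha> \<in> arrs A f f'; \<beta>' \<in> arrs B g' g''; \<alpha>' \<in> arrs A f' f''\<rbrakk>
      \<Longrightarrow> FA M (\<beta>' \<cdot>\<^bsub>B\<^esub> \<beta>, \<alpha>' \<cdot>\<^bsub>A\<^esub> \<alpha>) = FA M (\<beta>', \<alpha>') \<cdot>\<^bsub>C\<^esub> FA M (\<beta>, \<alpha>)"
    using pres_cmp[of "(\<beta>, \<alpha>)" "(g, f)" "(g', f')" "(\<beta>', \<alpha>')" "(g'', f'')"]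
    by (simp add: arrs_prod cmp_prod)
qed

context category
begin

lemma arrs_DomCod: "f \<in> arrs A x y \<longleftrightarrow> f \<in> Arr A \<and> Dom A f = x \<and> Cod A f = y"
  by (simp add: arrs_def)

lemma cmp_DomCod:
  assumes "f \<in> Arr A" "g \<in> Arr A" "Dom A g = Cod A f"
  shows "g \<cdot> f \<in> Arr A" "Dom A (g \<cdot> f) = Dom A f" "Cod A (g \<cdot> f) = Cod A g"
  using cmp_closed[of f "Dom A f" "Cod A f" g "Cod A g"] assms by (simp_all add: arrs_def)

lemma cmp_assoc_DomCod:
  assumes "f \<in> Arr A" "g \<in> Arr A" "h \<in> Arr A" "Dom A g = Cod A f" "Dom A h = Cod A g"
  shows "(h \<cdot> g) \<cdot> f = h \<cdot> (g \<cdot> f)"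
  using cmp_assoc[of f "Dom A f" "Cod A f" g "Cod A g" h "Cod A h"] assms by (simp add: arrs_def)

text \<open>Rebracketing by simplification: with domains and codomains as equations, composability of composites
  can be decided by rewriting, while \<open>cmp_assoc\<close> would have to guess the objects in between.\<close>

lemmas reassoc = arrs_DomCod cmp_DomCod cmp_assoc_DomCod

end

text \<open>The data of a pseudofunctor \<open>(p, P, \<phi>, \<psi>)\<close> into a bicategory, from objects, hom-categories and
  composition functors that carry no associator or unitors yet.\<close>

locale lifted_composition = bicategory E for E :: "('p, 'k, 'n) bicat" +
  fixes Ob :: "'o set" and H :: "'o \<Rightarrow> 'o \<Rightarrow> ('h, 'm) cat"
    and M :: "'o \<Rightarrow> 'o \<Rightarrow> 'o \<Rightarrow> ('h \<times> 'h, 'm \<times> 'm, 'h, 'm) funct" and I :: "'o \<Rightarrow> 'h"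
    and p :: "'o \<Rightarrow> 'p" and P :: "'o \<Rightarrow> 'o \<Rightarrow> ('h, 'm, 'k, 'n) funct"
    and \<phi> :: "'o \<Rightarrow> 'o \<Rightarrow> 'o \<Rightarrow> 'h \<times> 'h \<Rightarrow> 'n" and \<psi> :: "'o \<Rightarrow> 'n"
  assumes H_category: "\<lbrakk>a \<in> Ob; b \<in> Ob\<rbrakk> \<Longrightarrow> category (H a b)"
    and p_closed: "a \<in> Ob \<Longrightarrow> p a \<in> BOb E"
    and P_functor: "\<lbrakk>a \<in> Ob; b \<in> Ob\<rbrakk> \<Longrightarrow> is_functor (H a b) (BHom E (p a) (p b)) (P a b)"
    and P_bij: "\<lbrakk>a \<in> Ob; b \<in> Ob; x \<in> Obj (H a b); y \<in> Obj (H a b)\<rbrakk> \<Longrightarrow>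
      bij_betw (FA (P a b)) (arrs (H a b) x y) (arrs (BHom E (p a) (p b)) (FO (P a b) x) (FO (P a b) y))"
    and M_functor: "\<lbrakk>a \<in> Ob; b \<in> Ob; c \<in> Ob\<rbrakk> \<Longrightarrow> is_functor (H b c \<times>\<^sub>C H a b) (H a c) (M a b c)"
    and I_closed: "a \<in> Ob \<Longrightarrow> I a \<in> Obj (H a a)"
    and \<phi>_iso: "\<lbrakk>a \<in> Ob; b \<in> Ob; c \<in> Ob\<rbrakk> \<Longrightarrow>
      nat_iso (H b c \<times>\<^sub>C H a b) (BHom E (p a) (p c))
        (BComp E (p a) (p b) (p c) \<circ>\<^sub>F (P b c \<times>\<^sub>F P a b)) (P a c \<circ>\<^sub>F M a b c) (\<phi> a b c)"
    and \<psi>_iso: "a \<in> Ob \<Longrightarrow>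
      \<psi> a \<in> iso_arrs (BHom E (p a) (p a)) (BId E (p a)) (FO (P a a) (I a))"
begin

abbreviation D :: "'o \<Rightarrow> 'o \<Rightarrow> ('k, 'n) cat" where
  "D a b \<equiv> BHom E (p a) (p b)"

abbreviation N :: "'o \<Rightarrow> 'o \<Rightarrow> 'o \<Rightarrow> ('k \<times> 'k, 'n \<times> 'n, 'k, 'n) funct" where
  "N a b c \<equiv> BComp E (p a) (p b) (p c)"

abbreviation \<omega> :: "'o \<Rightarrow> 'o \<Rightarrow> 'o \<Rightarrow> 'o \<Rightarrow> 'k \<Rightarrow> 'k \<Rightarrow> 'k \<Rightarrow> 'n" where
  "\<omega> a b c e h g f \<equiv> BAssoc E (p a) (p b) (p c) (p e) ((h, g), f)"

lemma D_category: "\<lbrakk>a \<in> Ob; b \<in> Ob\<rbrakk> \<Longrightarrow> category (D a b)"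
  using hom_category p_closed by blast

lemma N_functor: "\<lbrakk>a \<in> Ob; b \<in> Ob; c \<in> Ob\<rbrakk> \<Longrightarrow> is_functor (D b c \<times>\<^sub>C D a b) (D a c) (N a b c)"
  using comp_functor p_closed by blast

text \<open>The associators of \<open>M\<close> at four given objects which are compatible with \<open>\<phi>\<close>.\<close>

definition assoc_lift :: "'o \<Rightarrow> 'o \<Rightarrow> 'o \<Rightarrow> 'o \<Rightarrow> (('h \<times> 'h) \<times> 'h \<Rightarrow> 'm) \<Rightarrow> bool" where
  "assoc_lift a b c e \<alpha> \<longleftrightarrow>
    nat_iso ((H c e \<times>\<^sub>C H b c) \<times>\<^sub>C H a b) (H a e)
      (M a b e \<circ>\<^sub>F (M b c e \<times>\<^sub>F fid)) (M a c e \<circ>\<^sub>F (fid \<times>\<^sub>F M a b c) \<circ>\<^sub>F fassoc) \<alpha> \<and>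
    (\<forall>h \<in> Obj (H c e). \<forall>g \<in> Obj (H b c). \<forall>f \<in> Obj (H a b).
      FA (P a e) (\<alpha> ((h, g), f)) \<cdot>\<^bsub>D a e\<^esub>
        (\<phi> a b e (FO (M b c e) (h, g), f) \<cdot>\<^bsub>D a e\<^esub>
          FA (N a b e) (\<phi> b c e (h, g), Idt (D a b) (FO (P a b) f)))
      = \<phi> a c e (h, FO (M a b c) (g, f)) \<cdot>\<^bsub>D a e\<^esub>
        (FA (N a c e) (Idt (D c e) (FO (P c e) h), \<phi> a b c (g, f)) \<cdot>\<^bsub>D a e\<^esub>
          \<omega> a b c e (FO (P c e) h) (FO (P b c) g) (FO (P a b) f)))"

text \<open>The span to be lifted starts at \<open>K : ((h, g), f) \<mapsto> (P h P g) P f\<close>.  One leg \<open>\<tau>\<close> applies \<open>\<phi>\<close> twice and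
  ends at \<open>P ((h g) f)\<close>; the other leg \<open>\<sigma>\<close> reassociates in \<open>E\<close> first and ends at \<open>P (h (g f))\<close>.\<close>

lemma assoc_lift_ex:
  assumes o: "a \<in> Ob" "b \<in> Ob" "c \<in> Ob" "e \<in> Ob"
  shows "\<exists>\<alpha>. assoc_lift a b c e \<alpha>"
proof -
  let ?id = "fid :: ('h, 'm, 'h, 'm) funct"
  let ?as = "fassoc :: (('h \<times> 'h) \<times> 'h, ('m \<times> 'm) \<times> 'm, 'h \<times> 'h \<times> 'h, 'm \<times> 'm \<times> 'm) funct"
  note hc = H_category and dc = D_category
  note Hab = hc[OF o(1,2)] and Hbc = hc[OF o(2,3)] and Hce = hc[OF o(3,4)]
    and Hbe = hc[OF o(2,4)] and Hac = hc[OF o(1,3)] and Hae = hc[OF o(1,4)]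
  note Dab = dc[OF o(1,2)] and Dbc = dc[OF o(2,3)] and Dce = dc[OF o(3,4)]
    and Dbe = dc[OF o(2,4)] and Dac = dc[OF o(1,3)] and Dae = dc[OF o(1,4)]
  let ?X = "(H c e \<times>\<^sub>C H b c) \<times>\<^sub>C H a b"
  let ?Y = "H c e \<times>\<^sub>C (H b c \<times>\<^sub>C H a b)"
  note cp = category_prod
  note X = cp[OF cp[OF Hce Hbc] Hab] and Y = cp[OF Hce cp[OF Hbc Hab]]
  note fc = is_functor_fcomp and fp = is_functor_fprod and id = is_functor_fid
  let ?S = "M a b e \<circ>\<^sub>F (M b c e \<times>\<^sub>F fid)"
  let ?T = "M a c e \<circ>\<^sub>F (fid \<times>\<^sub>F M a b c) \<circ>\<^sub>F fassoc"
  let ?PP = "(P c e \<times>\<^sub>F P b c) \<times>\<^sub>F P a b"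
  let ?K = "N a b e \<circ>\<^sub>F ((N b c e \<circ>\<^sub>F (P c e \<times>\<^sub>F P b c)) \<times>\<^sub>F P a b)"
  let ?K' = "N a b e \<circ>\<^sub>F ((P b e \<circ>\<^sub>F M b c e) \<times>\<^sub>F P a b)"
  let ?L = "N a c e \<circ>\<^sub>F (P c e \<times>\<^sub>F (N a b c \<circ>\<^sub>F (P b c \<times>\<^sub>F P a b)))"
  let ?L' = "N a c e \<circ>\<^sub>F (P c e \<times>\<^sub>F (P a c \<circ>\<^sub>F M a b c))"
  note P = P_functor[OF o(1,2)] P_functor[OF o(2,3)] P_functor[OF o(3,4)]
    P_functor[OF o(2,4)] P_functor[OF o(1,3)] P_functor[OF o(1,4)]
  note dP = fc[OF fp[OF P(3,2)] N_functor[OF o(2,3,4)]] fc[OF fp[OF P(2,1)] N_functor[OF o(1,2,3)]]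
  note PM = fc[OF M_functor[OF o(2,3,4)] P(4)] fc[OF M_functor[OF o(1,2,3)] P(5)]
  have S: "is_functor ?X (H a e) ?S"
    by (rule fc[OF fp[OF M_functor[OF o(2,3,4)] id] M_functor[OF o(1,2,4)]])
  have T: "is_functor ?X (H a e) ?T"
    by (rule fc[OF fc[OF is_functor_fassoc fp[OF id M_functor[OF o(1,2,3)]]] M_functor[OF o(1,3,4)]])
  have K: "is_functor ?X (D a e) ?K" by (rule fc[OF fp[OF dP(1) P(1)] N_functor[OF o(1,2,4)]])
  have K': "is_functor ?X (D a e) ?K'" by (rule fc[OF fp[OF PM(1) P(1)] N_functor[OF o(1,2,4)]])
  have L: "is_functor ?Y (D a e) ?L" by (rule fc[OF fp[OF P(3) dP(2)] N_functor[OF o(1,3,4)]])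
  have L': "is_functor ?Y (D a e) ?L'" by (rule fc[OF fp[OF P(3) PM(2)] N_functor[OF o(1,3,4)]])
  have PS: "is_functor ?X (D a e) (P a e \<circ>\<^sub>F ?S)" and PT: "is_functor ?X (D a e) (P a e \<circ>\<^sub>F ?T)"
    using fc[OF S P(6)] fc[OF T P(6)] .
  have "nat_iso ?X (D a e) ?K ?K' (\<lambda>x. FA (N a b e) (map_prod (\<phi> b c e) (\<lambda>f. Idt (D a b) (FO (P a b) f)) x))"
    by (rule nat_iso_whisker_left[OF X cp[OF Dbe Dab] fp[OF dP(1) P(1)] fp[OF PM(1) P(1)]
      N_functor[OF o(1,2,4)] nat_iso_prod[OF dP(1) PM(1) P(1,1) cp[OF Hce Hbc] Hab
      \<phi>_iso[OF o(2,3,4)] nat_iso_id[OF Hab Dab P(1)]]])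
  moreover have "nat_iso ?X (D a e) ?K' (P a e \<circ>\<^sub>F ?S) (\<lambda>x. \<phi> a b e (FO (M b c e \<times>\<^sub>F ?id) x))"
  proof -
    have "(N a b e \<circ>\<^sub>F (P b e \<times>\<^sub>F P a b)) \<circ>\<^sub>F (M b c e \<times>\<^sub>F fid) = ?K'"
      by (rule funct_eqI) (auto simp: fprod_def)
    then show ?thesis
      using nat_iso_whisker_right[OF fp[OF M_functor[OF o(2,3,4)] id] \<phi>_iso[OF o(1,2,4)]]
      by (simp add: fcomp_assoc)
  qed
  ultimately have \<tau>: "nat_iso ?X (D a e) ?K (P a e \<circ>\<^sub>F ?S)
      (\<lambda>x. \<phi> a b e (FO (M b c e \<times>\<^sub>F ?id) x) \<cdot>\<^bsub>D a e\<^esub>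
        FA (N a b e) (map_prod (\<phi> b c e) (\<lambda>f. Idt (D a b) (FO (P a b) f)) x))"
    by (rule nat_iso_vcomp[OF X Dae K K' PS])
  have "nat_iso ?X (D a e) ?K (?L \<circ>\<^sub>F fassoc) (\<lambda>x. BAssoc E (p a) (p b) (p c) (p e) (FO ?PP x))"
  proof -
    have "(N a b e \<circ>\<^sub>F (N b c e \<times>\<^sub>F fid)) \<circ>\<^sub>F ?PP = ?K"
      by (rule funct_eqI) (auto simp: fprod_def)
    moreover have "(N a c e \<circ>\<^sub>F (fid \<times>\<^sub>F N a b c) \<circ>\<^sub>F fassoc) \<circ>\<^sub>F ?PP = ?L \<circ>\<^sub>F fassoc"
      by (rule funct_eqI) (auto simp: fprod_def fassoc_def split: prod.splits)
    ultimately show ?thesis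
      using nat_iso_whisker_right[OF fp[OF fp[OF P(3,2)] P(1)]
        assoc_iso[OF p_closed[OF o(1)] p_closed[OF o(2)] p_closed[OF o(3)] p_closed[OF o(4)]]]
      by simp
  qed
  moreover have "nat_iso ?X (D a e) (?L \<circ>\<^sub>F fassoc) (?L' \<circ>\<^sub>F fassoc)
      (\<lambda>x. FA (N a c e) (map_prod (\<lambda>h. Idt (D c e) (FO (P c e) h)) (\<phi> a b c) (FO ?as x)))"
    by (rule nat_iso_whisker_right[OF is_functor_fassoc nat_iso_whisker_left[OF Y cp[OF Dce Dac]
      fp[OF P(3) dP(2)] fp[OF P(3) PM(2)] N_functor[OF o(1,3,4)]
      nat_iso_prod[OF P(3,3) dP(2) PM(2) Hce cp[OF Hbc Hab] nat_iso_id[OF Hce Dce P(3)] \<phi>_iso[OF o(1,2,3)]]]])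
  ultimately have \<sigma>1: "nat_iso ?X (D a e) ?K (?L' \<circ>\<^sub>F fassoc)
      (\<lambda>x. FA (N a c e) (map_prod (\<lambda>h. Idt (D c e) (FO (P c e) h)) (\<phi> a b c) (FO ?as x)) \<cdot>\<^bsub>D a e\<^esub>
        BAssoc E (p a) (p b) (p c) (p e) (FO ?PP x))"
    by (rule nat_iso_vcomp[OF X Dae K fc[OF is_functor_fassoc L] fc[OF is_functor_fassoc L']])
  have "nat_iso ?X (D a e) (?L' \<circ>\<^sub>F fassoc) (P a e \<circ>\<^sub>F ?T)
      (\<lambda>x. \<phi> a c e (FO ((?id \<times>\<^sub>F M a b c) \<circ>\<^sub>F ?as) x))"
  proof -
    have "(N a c e \<circ>\<^sub>F (P c e \<times>\<^sub>F P a c)) \<circ>\<^sub>F (fid \<times>\<^sub>F M a b c) \<circ>\<^sub>F fassoc = ?L' \<circ>\<^sub>F fassoc"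
      by (rule funct_eqI) (auto simp: fprod_def fassoc_def split: prod.splits)
    then show ?thesis
      using nat_iso_whisker_right[OF fc[OF is_functor_fassoc fp[OF id M_functor[OF o(1,2,3)]]] \<phi>_iso[OF o(1,3,4)]]
      by (simp add: fcomp_assoc)
  qed
  note \<sigma> = nat_iso_vcomp[OF X Dae K fc[OF is_functor_fassoc L'] PT \<sigma>1 this]
  obtain \<alpha> where \<alpha>: "nat_iso ?X (H a e) ?S ?T \<alpha>"
    "\<And>x. x \<in> Obj ?X \<Longrightarrow> FA (P a e) (\<alpha> x) \<cdot>\<^bsub>D a e\<^esub> (\<phi> a b e (FO (M b c e \<times>\<^sub>F ?id) x) \<cdot>\<^bsub>D a e\<^esub>
        FA (N a b e) (map_prod (\<phi> b c e) (\<lambda>f. Idt (D a b) (FO (P a b) f)) x))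
      = \<phi> a c e (FO ((?id \<times>\<^sub>F M a b c) \<circ>\<^sub>F ?as) x) \<cdot>\<^bsub>D a e\<^esub>
       (FA (N a c e) (map_prod (\<lambda>h. Idt (D c e) (FO (P c e) h)) (\<phi> a b c) (FO ?as x)) \<cdot>\<^bsub>D a e\<^esub>
        BAssoc E (p a) (p b) (p c) (p e) (FO ?PP x))"
    using nat_iso_lift[OF X Hae Dae S T P(6) K P_bij[OF o(1,4)] \<tau> \<sigma>] by blast
  show ?thesis
    unfolding assoc_lift_def using \<alpha>(1) \<alpha>(2)[of "((_, _), _)"] by (intro exI[of _ \<alpha>]) auto
qed

definition lunit_lift :: "'o \<Rightarrow> 'o \<Rightarrow> ('h \<Rightarrow> 'm) \<Rightarrow> bool" where
  "lunit_lift a b \<alpha> \<longleftrightarrow>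
    nat_iso (H a b) (H a b) (M a b b \<circ>\<^sub>F (pick (H b b) (I b) \<times>\<^sub>F fid) \<circ>\<^sub>F funit_l) fid \<alpha> \<and>
    (\<forall>f \<in> Obj (H a b). FA (P a b) (\<alpha> f) \<cdot>\<^bsub>D a b\<^esub>
        (\<phi> a b b (I b, f) \<cdot>\<^bsub>D a b\<^esub> FA (N a b b) (\<psi> b, Idt (D a b) (FO (P a b) f)))
      = BLunit E (p a) (p b) (FO (P a b) f))"

text \<open>Here \<open>K : f \<mapsto> 1 P f\<close>, one leg inserts \<open>\<psi>\<close> and applies \<open>\<phi>\<close>, and the other is the unitor of \<open>E\<close>.\<close>

lemma lunit_lift_ex:
  assumes o: "a \<in> Ob" "b \<in> Ob"
  shows "\<exists>\<alpha>. lunit_lift a b \<alpha>"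
proof -
  let ?id = "fid :: ('h, 'm, 'h, 'm) funct"
  let ?u = "funit_l :: ('h, 'm, unit \<times> 'h, unit \<times> 'm) funct"
  note ab = H_category[OF o] and bb = H_category[OF o(2,2)]
  note Dab = D_category[OF o] and Dbb = D_category[OF o(2,2)]
  note fc = is_functor_fcomp and fp = is_functor_fprod and id = is_functor_fid
  note cp = category_prod
  note P = P_functor[OF o] P_functor[OF o(2,2)]
  note I = is_functor_pick[OF bb I_closed[OF o(2)]]
  note J = is_functor_pick[OF Dbb id_closed[OF p_closed[OF o(2)]]]
  note PI = fc[OF I P(2)]
  note u = is_functor_funit(1)[of "H a b"]
  let ?S = "M a b b \<circ>\<^sub>F (pick (H b b) (I b) \<times>\<^sub>F fid) \<circ>\<^sub>F funit_l"
  let ?K = "N a b b \<circ>\<^sub>F (pick (D b b) (BId E (p b)) \<times>\<^sub>F P a b) \<circ>\<^sub>F funit_l"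
  let ?K' = "N a b b \<circ>\<^sub>F ((P b b \<circ>\<^sub>F pick (H b b) (I b)) \<times>\<^sub>F P a b) \<circ>\<^sub>F funit_l"
  note uI = fc[OF u fp[OF I id]]
  have S: "is_functor (H a b) (H a b) ?S" by (rule fc[OF uI M_functor[OF o(1,2,2)]])
  have K: "is_functor (H a b) (D a b) ?K" by (rule fc[OF fc[OF u fp[OF J P(1)]] N_functor[OF o(1,2,2)]])
  have K': "is_functor (H a b) (D a b) ?K'" by (rule fc[OF fc[OF u fp[OF PI P(1)]] N_functor[OF o(1,2,2)]])
  have \<psi>: "nat_iso one_cat (D b b) (pick (D b b) (BId E (p b))) (P b b \<circ>\<^sub>F pick (H b b) (I b)) (\<lambda>_. \<psi> b)"
  proof -
    interpret category "D b b" by fact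
    interpret P: is_functor "H b b" "D b b" "P b b" by fact
    show ?thesis
      using \<psi>_iso[OF o(2)] iso_arrsD[OF \<psi>_iso[OF o(2)]]
      by (auto simp: nat_iso_def P.pres_idt I_closed[OF o(2)] idt_left idt_right)
  qed
  have "nat_iso (H a b) (D a b) ?K ?K'
      (\<lambda>x. FA (N a b b) (map_prod (\<lambda>_. \<psi> b) (\<lambda>f. Idt (D a b) (FO (P a b) f)) (FO ?u x)))"
    using nat_iso_whisker_right[OF u nat_iso_whisker_left[OF cp[OF category_one ab] cp[OF Dbb Dab]
      fp[OF J P(1)] fp[OF PI P(1)] N_functor[OF o(1,2,2)] nat_iso_prod[OF J PI P(1,1) category_one ab
      \<psi> nat_iso_id[OF ab Dab P(1)]]]]
    by (simp add: fcomp_assoc)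
  moreover have "nat_iso (H a b) (D a b) ?K' (P a b \<circ>\<^sub>F ?S)
      (\<lambda>x. \<phi> a b b (FO ((pick (H b b) (I b) \<times>\<^sub>F ?id) \<circ>\<^sub>F ?u) x))"
  proof -
    have "(N a b b \<circ>\<^sub>F (P b b \<times>\<^sub>F P a b)) \<circ>\<^sub>F (pick (H b b) (I b) \<times>\<^sub>F fid) \<circ>\<^sub>F funit_l = ?K'"
      by (rule funct_eqI) simp_all
    then show ?thesis
      using nat_iso_whisker_right[OF uI \<phi>_iso[OF o(1,2,2)]] by (simp add: fcomp_assoc)
  qed
  ultimately have \<tau>: "nat_iso (H a b) (D a b) ?K (P a b \<circ>\<^sub>F ?S)
      (\<lambda>x. \<phi> a b b (FO ((pick (H b b) (I b) \<times>\<^sub>F ?id) \<circ>\<^sub>F ?u) x) \<cdot>\<^bsub>D a b\<^esub>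
        FA (N a b b) (map_prod (\<lambda>_. \<psi> b) (\<lambda>f. Idt (D a b) (FO (P a b) f)) (FO ?u x)))"
    by (rule nat_iso_vcomp[OF ab Dab K K' fc[OF S P(1)]])
  have \<sigma>: "nat_iso (H a b) (D a b) ?K (P a b \<circ>\<^sub>F fid) (\<lambda>f. BLunit E (p a) (p b) (FO (P a b) f))"
  proof -
    have "(N a b b \<circ>\<^sub>F (pick (D b b) (BId E (p b)) \<times>\<^sub>F fid) \<circ>\<^sub>F funit_l) \<circ>\<^sub>F P a b = ?K"
      by (rule funct_eqI) simp_all
    then show ?thesis
      using nat_iso_whisker_right[OF P(1) lunit_iso[OF p_closed[OF o(1)] p_closed[OF o(2)]]] by simp
  qed
  show ?thesis
    unfolding lunit_lift_def
    using nat_iso_lift[OF ab ab Dab S id P(1) K P_bij[OF o] \<tau> \<sigma>] by simp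
qed

definition runit_lift :: "'o \<Rightarrow> 'o \<Rightarrow> ('h \<Rightarrow> 'm) \<Rightarrow> bool" where
  "runit_lift a b \<alpha> \<longleftrightarrow>
    nat_iso (H a b) (H a b) (M a a b \<circ>\<^sub>F (fid \<times>\<^sub>F pick (H a a) (I a)) \<circ>\<^sub>F funit_r) fid \<alpha> \<and>
    (\<forall>f \<in> Obj (H a b). FA (P a b) (\<alpha> f) \<cdot>\<^bsub>D a b\<^esub>
        (\<phi> a a b (f, I a) \<cdot>\<^bsub>D a b\<^esub> FA (N a a b) (Idt (D a b) (FO (P a b) f), \<psi> a))
      = BRunit E (p a) (p b) (FO (P a b) f))"

lemma runit_lift_ex:
  assumes o: "a \<in> Ob" "b \<in> Ob"
  shows "\<exists>\<alpha>. runit_lift a b \<alpha>"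
proof -
  let ?id = "fid :: ('h, 'm, 'h, 'm) funct"
  let ?u = "funit_r :: ('h, 'm, 'h \<times> unit, 'm \<times> unit) funct"
  note ab = H_category[OF o] and aa = H_category[OF o(1,1)]
  note Dab = D_category[OF o] and Daa = D_category[OF o(1,1)]
  note fc = is_functor_fcomp and fp = is_functor_fprod and id = is_functor_fid
  note cp = category_prod
  note P = P_functor[OF o] P_functor[OF o(1,1)]
  note I = is_functor_pick[OF aa I_closed[OF o(1)]]
  note J = is_functor_pick[OF Daa id_closed[OF p_closed[OF o(1)]]]
  note PI = fc[OF I P(2)]
  note u = is_functor_funit(2)[of "H a b"]
  let ?S = "M a a b \<circ>\<^sub>F (fid \<times>\<^sub>F pick (H a a) (I a)) \<circ>\<^sub>F funit_r"
  let ?K = "N a a b \<circ>\<^sub>F (P a b \<times>\<^sub>F pick (D a a) (BId E (p a))) \<circ>\<^sub>F funit_r"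
  let ?K' = "N a a b \<circ>\<^sub>F (P a b \<times>\<^sub>F (P a a \<circ>\<^sub>F pick (H a a) (I a))) \<circ>\<^sub>F funit_r"
  note uI = fc[OF u fp[OF id I]]
  have S: "is_functor (H a b) (H a b) ?S" by (rule fc[OF uI M_functor[OF o(1,1,2)]])
  have K: "is_functor (H a b) (D a b) ?K" by (rule fc[OF fc[OF u fp[OF P(1) J]] N_functor[OF o(1,1,2)]])
  have K': "is_functor (H a b) (D a b) ?K'" by (rule fc[OF fc[OF u fp[OF P(1) PI]] N_functor[OF o(1,1,2)]])
  have \<psi>: "nat_iso one_cat (D a a) (pick (D a a) (BId E (p a))) (P a a \<circ>\<^sub>F pick (H a a) (I a)) (\<lambda>_. \<psi> a)"
  proof -
    interpret category "D a a" by fact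
    interpret P: is_functor "H a a" "D a a" "P a a" by fact
    show ?thesis
      using \<psi>_iso[OF o(1)] iso_arrsD[OF \<psi>_iso[OF o(1)]]
      by (auto simp: nat_iso_def P.pres_idt I_closed[OF o(1)] idt_left idt_right)
  qed
  have "nat_iso (H a b) (D a b) ?K ?K'
      (\<lambda>x. FA (N a a b) (map_prod (\<lambda>f. Idt (D a b) (FO (P a b) f)) (\<lambda>_. \<psi> a) (FO ?u x)))"
    using nat_iso_whisker_right[OF u nat_iso_whisker_left[OF cp[OF ab category_one] cp[OF Dab Daa]
      fp[OF P(1) J] fp[OF P(1) PI] N_functor[OF o(1,1,2)] nat_iso_prod[OF P(1,1) J PI ab category_one
      nat_iso_id[OF ab Dab P(1)] \<psi>]]]
    by (simp add: fcomp_assoc)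
  moreover have "nat_iso (H a b) (D a b) ?K' (P a b \<circ>\<^sub>F ?S)
      (\<lambda>x. \<phi> a a b (FO ((?id \<times>\<^sub>F pick (H a a) (I a)) \<circ>\<^sub>F ?u) x))"
  proof -
    have "(N a a b \<circ>\<^sub>F (P a b \<times>\<^sub>F P a a)) \<circ>\<^sub>F (fid \<times>\<^sub>F pick (H a a) (I a)) \<circ>\<^sub>F funit_r = ?K'"
      by (rule funct_eqI) simp_all
    then show ?thesis
      using nat_iso_whisker_right[OF uI \<phi>_iso[OF o(1,1,2)]] by (simp add: fcomp_assoc)
  qed
  ultimately have \<tau>: "nat_iso (H a b) (D a b) ?K (P a b \<circ>\<^sub>F ?S)
      (\<lambda>x. \<phi> a a b (FO ((?id \<times>\<^sub>F pick (H a a) (I a)) \<circ>\<^sub>F ?u) x) \<cdot>\<^bsub>D a b\<^esub>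
        FA (N a a b) (map_prod (\<lambda>f. Idt (D a b) (FO (P a b) f)) (\<lambda>_. \<psi> a) (FO ?u x)))"
    by (rule nat_iso_vcomp[OF ab Dab K K' fc[OF S P(1)]])
  have \<sigma>: "nat_iso (H a b) (D a b) ?K (P a b \<circ>\<^sub>F fid) (\<lambda>f. BRunit E (p a) (p b) (FO (P a b) f))"
  proof -
    have "(N a a b \<circ>\<^sub>F (fid \<times>\<^sub>F pick (D a a) (BId E (p a))) \<circ>\<^sub>F funit_r) \<circ>\<^sub>F P a b = ?K"
      by (rule funct_eqI) simp_all
    then show ?thesis
      using nat_iso_whisker_right[OF P(1) runit_iso[OF p_closed[OF o(1)] p_closed[OF o(2)]]] by simp
  qed
  show ?thesis
    unfolding runit_lift_def
    using nat_iso_lift[OF ab ab Dab S id P(1) K P_bij[OF o] \<tau> \<sigma>] by simp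
qed

end

section \<open>Coherence of the lifted constraints\<close>

lemma bifunctor_iso:
  assumes "category A" "category B" and M: "is_functor (B \<times>\<^sub>C A) C M"
    and \<beta>: "\<beta> \<in> iso_arrs B g g'" and \<alpha>: "\<alpha> \<in> iso_arrs A f f'"
  shows "FA M (\<beta>, \<alpha>) \<in> iso_arrs C (FO M (g, f)) (FO M (g', f'))"
proof -
  interpret A: category A by fact
  interpret B: category B by fact
  show ?thesis
    using A.arrs_objs[OF iso_arrsD[OF \<alpha>]] B.arrs_objs[OF iso_arrsD[OF \<beta>]]
    by (intro is_functor_iso_arrs[OF category_prod[OF assms(2,1)] M] iso_arrs_prod[OF \<beta> \<alpha>]) auto
qed

context lifted_composition
begin

definition lifted_assoc :: "'o \<Rightarrow> 'o \<Rightarrow> 'o \<Rightarrow> 'o \<Rightarrow> ('h \<times> 'h) \<times> 'h \<Rightarrow> 'm" where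
  "lifted_assoc a b c e = (SOME \<alpha>. assoc_lift a b c e \<alpha>)"

definition lifted_lunit :: "'o \<Rightarrow> 'o \<Rightarrow> 'h \<Rightarrow> 'm" where
  "lifted_lunit a b = (SOME \<alpha>. lunit_lift a b \<alpha>)"

definition lifted_runit :: "'o \<Rightarrow> 'o \<Rightarrow> 'h \<Rightarrow> 'm" where
  "lifted_runit a b = (SOME \<alpha>. runit_lift a b \<alpha>)"

lemma lifted_assoc_iso:
  "\<lbrakk>a \<in> Ob; b \<in> Ob; c \<in> Ob; e \<in> Ob\<rbrakk> \<Longrightarrow>
      nat_iso ((H c e \<times>\<^sub>C H b c) \<times>\<^sub>C H a b) (H a e)
        (M a b e \<circ>\<^sub>F (M b c e \<times>\<^sub>F fid)) (M a c e \<circ>\<^sub>F (fid \<times>\<^sub>F M a b c) \<circ>\<^sub>F fassoc) (lifted_assoc a b c e)"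
  using someI_ex[OF assoc_lift_ex, of a b c e] unfolding lifted_assoc_def assoc_lift_def by blast

lemma lifted_assoc_coherence:
  "\<lbrakk>a \<in> Ob; b \<in> Ob; c \<in> Ob; e \<in> Ob;
        h \<in> Obj (H c e); g \<in> Obj (H b c); f \<in> Obj (H a b)\<rbrakk> \<Longrightarrow>
      FA (P a e) (lifted_assoc a b c e ((h, g), f)) \<cdot>\<^bsub>D a e\<^esub>
        (\<phi> a b e (FO (M b c e) (h, g), f) \<cdot>\<^bsub>D a e\<^esub>
          FA (N a b e) (\<phi> b c e (h, g), Idt (D a b) (FO (P a b) f)))
      = \<phi> a c e (h, FO (M a b c) (g, f)) \<cdot>\<^bsub>D a e\<^esub>
        (FA (N a c e) (Idt (D c e) (FO (P c e) h), \<phi> a b c (g, f)) \<cdot>\<^bsub>D a e\<^esub>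
          \<omega> a b c e (FO (P c e) h) (FO (P b c) g) (FO (P a b) f))"
  using someI_ex[OF assoc_lift_ex, of a b c e] unfolding lifted_assoc_def assoc_lift_def by blast

lemma lifted_lunit_iso:
  "\<lbrakk>a \<in> Ob; b \<in> Ob\<rbrakk> \<Longrightarrow>
      nat_iso (H a b) (H a b) (M a b b \<circ>\<^sub>F (pick (H b b) (I b) \<times>\<^sub>F fid) \<circ>\<^sub>F funit_l) fid (lifted_lunit a b)"
  using someI_ex[OF lunit_lift_ex, of a b] unfolding lifted_lunit_def lunit_lift_def by blast

lemma lifted_lunit_coherence:
  "\<lbrakk>a \<in> Ob; b \<in> Ob; f \<in> Obj (H a b)\<rbrakk> \<Longrightarrow>
      FA (P a b) (lifted_lunit a b f) \<cdot>\<^bsub>D a b\<^esub>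
        (\<phi> a b b (I b, f) \<cdot>\<^bsub>D a b\<^esub> FA (N a b b) (\<psi> b, Idt (D a b) (FO (P a b) f)))
      = BLunit E (p a) (p b) (FO (P a b) f)"
  using someI_ex[OF lunit_lift_ex, of a b] unfolding lifted_lunit_def lunit_lift_def by blast

lemma lifted_runit_iso:
  "\<lbrakk>a \<in> Ob; b \<in> Ob\<rbrakk> \<Longrightarrow>
      nat_iso (H a b) (H a b) (M a a b \<circ>\<^sub>F (fid \<times>\<^sub>F pick (H a a) (I a)) \<circ>\<^sub>F funit_r) fid (lifted_runit a b)"
  using someI_ex[OF runit_lift_ex, of a b] unfolding lifted_runit_def runit_lift_def by blast

lemma lifted_runit_coherence:
  "\<lbrakk>a \<in> Ob; b \<in> Ob; f \<in> Obj (H a b)\<rbrakk> \<Longrightarrow>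
      FA (P a b) (lifted_runit a b f) \<cdot>\<^bsub>D a b\<^esub>
        (\<phi> a a b (f, I a) \<cdot>\<^bsub>D a b\<^esub> FA (N a a b) (Idt (D a b) (FO (P a b) f), \<psi> a))
      = BRunit E (p a) (p b) (FO (P a b) f)"
  using someI_ex[OF runit_lift_ex, of a b] unfolding lifted_runit_def runit_lift_def by blast

abbreviation nO :: "'o \<Rightarrow> 'o \<Rightarrow> 'o \<Rightarrow> 'k \<Rightarrow> 'k \<Rightarrow> 'k" where
  "nO a b c v u \<equiv> FO (N a b c) (v, u)"

abbreviation nA :: "'o \<Rightarrow> 'o \<Rightarrow> 'o \<Rightarrow> 'n \<Rightarrow> 'n \<Rightarrow> 'n" where
  "nA a b c \<beta> \<alpha> \<equiv> FA (N a b c) (\<beta>, \<alpha>)"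

abbreviation mO :: "'o \<Rightarrow> 'o \<Rightarrow> 'o \<Rightarrow> 'h \<Rightarrow> 'h \<Rightarrow> 'h" where
  "mO a b c v u \<equiv> FO (M a b c) (v, u)"

abbreviation mA :: "'o \<Rightarrow> 'o \<Rightarrow> 'o \<Rightarrow> 'm \<Rightarrow> 'm \<Rightarrow> 'm" where
  "mA a b c \<beta> \<alpha> \<equiv> FA (M a b c) (\<beta>, \<alpha>)"

abbreviation idD :: "'o \<Rightarrow> 'o \<Rightarrow> 'k \<Rightarrow> 'n" where
  "idD a b \<equiv> Idt (D a b)"

lemmas N_bifunctor = bifunctor[OF N_functor]
lemmas M_bifunctor = bifunctor[OF M_functor]

lemma P_obj: "\<lbrakk>a \<in> Ob; b \<in> Ob; f \<in> Obj (H a b)\<rbrakk> \<Longrightarrow> FO (P a b) f \<in> Obj (D a b)"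
  using is_functor.obj_closed[OF P_functor] .

lemma \<phi>_arr:
  assumes "a \<in> Ob" "b \<in> Ob" "c \<in> Ob" "g \<in> Obj (H b c)" "f \<in> Obj (H a b)"
  shows "\<phi> a b c (g, f) \<in> iso_arrs (D a c) (nO a b c (FO (P b c) g) (FO (P a b) f)) (FO (P a c) (mO a b c g f))"
  using nat_isoD(1)[OF \<phi>_iso[OF assms(1-3)], of "(g, f)"] assms by simp

lemma \<phi>_nat:
  assumes "a \<in> Ob" "b \<in> Ob" "c \<in> Ob" "\<beta> \<in> arrs (H b c) g g'" "\<alpha> \<in> arrs (H a b) f f'"
  shows "FA (P a c) (mA a b c \<beta> \<alpha>) \<cdot>\<^bsub>D a c\<^esub> \<phi> a b c (g, f)
    = \<phi> a b c (g', f') \<cdot>\<^bsub>D a c\<^esub> nA a b c (FA (P b c) \<beta>) (FA (P a b) \<alpha>)"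
  using nat_isoD(2)[OF \<phi>_iso[OF assms(1-3)], of "(\<beta>, \<alpha>)" "(g, f)" "(g', f')"] assms
  by (simp add: arrs_prod)

lemma \<omega>_arr:
  assumes o: "a \<in> Ob" "b \<in> Ob" "c \<in> Ob" "e \<in> Ob"
    and "h \<in> Obj (D c e)" "g \<in> Obj (D b c)" "f \<in> Obj (D a b)"
  shows "\<omega> a b c e h g f \<in> iso_arrs (D a e) (nO a b e (nO b c e h g) f) (nO a c e h (nO a b c g f))"
  using nat_isoD(1)[OF assoc_iso[OF o[THEN p_closed]], of "((h, g), f)"] assms by simp

lemma \<omega>_nat:
  assumes o: "a \<in> Ob" "b \<in> Ob" "c \<in> Ob" "e \<in> Ob"
    and "\<gamma> \<in> arrs (D c e) h h'" "\<beta> \<in> arrs (D b c) g g'" "\<alpha> \<in> arrs (D a b) f f'"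
  shows "\<omega> a b c e h' g' f' \<cdot>\<^bsub>D a e\<^esub> nA a b e (nA b c e \<gamma> \<beta>) \<alpha>
    = nA a c e \<gamma> (nA a b c \<beta> \<alpha>) \<cdot>\<^bsub>D a e\<^esub> \<omega> a b c e h g f"
  using nat_isoD(2)[OF assoc_iso[OF o[THEN p_closed]],
      of "((\<gamma>, \<beta>), \<alpha>)" "((h, g), f)" "((h', g'), f')"] assms
  by (simp add: arrs_prod)

lemma lifted_assoc_arr:
  assumes o: "a \<in> Ob" "b \<in> Ob" "c \<in> Ob" "e \<in> Ob"
    and "h \<in> Obj (H c e)" "g \<in> Obj (H b c)" "f \<in> Obj (H a b)"
  shows "lifted_assoc a b c e ((h, g), f) \<in> arrs (H a e) (mO a b e (mO b c e h g) f) (mO a c e h (mO a b c g f))"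
  using nat_isoD(1)[OF lifted_assoc_iso[OF o], of "((h, g), f)", THEN iso_arrsD] assms by simp

lemma lifted_lunit_arr:
  assumes "a \<in> Ob" "b \<in> Ob" "f \<in> Obj (H a b)"
  shows "lifted_lunit a b f \<in> arrs (H a b) (mO a b b (I b) f) f"
  using nat_isoD(1)[OF lifted_lunit_iso[OF assms(1,2)] assms(3), THEN iso_arrsD] by simp

lemma lifted_runit_arr:
  assumes "a \<in> Ob" "b \<in> Ob" "f \<in> Obj (H a b)"
  shows "lifted_runit a b f \<in> arrs (H a b) (mO a a b f (I a)) f"
  using nat_isoD(1)[OF lifted_runit_iso[OF assms(1,2)] assms(3), THEN iso_arrsD] by simp

text \<open>Equations between 2-cells over \<open>H\<close> can be checked in \<open>E\<close>, after composing with comparison cells.\<close>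

lemma P_cancel:
  assumes o: "a \<in> Ob" "b \<in> Ob" and t: "t \<in> iso_arrs (D a b) w (FO (P a b) x)"
    and st: "\<alpha> \<in> arrs (H a b) x y" "\<beta> \<in> arrs (H a b) x y"
    and eq: "FA (P a b) \<alpha> \<cdot>\<^bsub>D a b\<^esub> t = FA (P a b) \<beta> \<cdot>\<^bsub>D a b\<^esub> t"
  shows "\<alpha> = \<beta>"
proof -
  interpret H: category "H a b" using H_category[OF o] .
  interpret D: category "D a b" using D_category[OF o] .
  interpret P: is_functor "H a b" "D a b" "P a b" using P_functor[OF o] .
  have "FA (P a b) \<alpha> = FA (P a b) \<beta>"
    using D.iso_arrs_epi[OF t P.arr_closed[OF st(1)] P.arr_closed[OF st(2)] eq] .
  then show ?thesis
    using P_bij[OF o] H.arrs_objs[OF st(1)] st by (auto simp: bij_betw_def dest: inj_onD)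
qed

lemma N_left3:
  assumes o: "a \<in> Ob" "b \<in> Ob" "c \<in> Ob" and g: "g \<in> Obj (D b c)"
    and \<alpha>: "\<alpha>0 \<in> arrs (D a b) x0 x1" "\<alpha>1 \<in> arrs (D a b) x1 x2" "\<alpha>2 \<in> arrs (D a b) x2 x3"
  shows "nA a b c (idD b c g) (\<alpha>2 \<cdot>\<^bsub>D a b\<^esub> (\<alpha>1 \<cdot>\<^bsub>D a b\<^esub> \<alpha>0))
    = nA a b c (idD b c g) \<alpha>2 \<cdot>\<^bsub>D a c\<^esub> (nA a b c (idD b c g) \<alpha>1 \<cdot>\<^bsub>D a c\<^esub> nA a b c (idD b c g) \<alpha>0)"
proof -
  interpret G: category "D b c" using D_category o by blast
  interpret F: category "D a b" using D_category o by blast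
  note i = G.idt_closed[OF g]
  show ?thesis
    using N_bifunctor(4)[OF o i F.cmp_closed[OF \<alpha>(1,2)] i \<alpha>(3)] N_bifunctor(4)[OF o i \<alpha>(1) i \<alpha>(2)]
    by (simp add: G.idt_left[OF i])
qed

lemma N_right3:
  assumes o: "a \<in> Ob" "b \<in> Ob" "c \<in> Ob" and f: "f \<in> Obj (D a b)"
    and \<beta>: "\<beta>0 \<in> arrs (D b c) x0 x1" "\<beta>1 \<in> arrs (D b c) x1 x2" "\<beta>2 \<in> arrs (D b c) x2 x3"
  shows "nA a b c (\<beta>2 \<cdot>\<^bsub>D b c\<^esub> (\<beta>1 \<cdot>\<^bsub>D b c\<^esub> \<beta>0)) (idD a b f)
    = nA a b c \<beta>2 (idD a b f) \<cdot>\<^bsub>D a c\<^esub> (nA a b c \<beta>1 (idD a b f) \<cdot>\<^bsub>D a c\<^esub> nA a b c \<beta>0 (idD a b f))"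
proof -
  interpret G: category "D b c" using D_category o by blast
  interpret F: category "D a b" using D_category o by blast
  note i = F.idt_closed[OF f]
  show ?thesis
    using N_bifunctor(4)[OF o G.cmp_closed[OF \<beta>(1,2)] i \<beta>(3) i] N_bifunctor(4)[OF o \<beta>(1) i \<beta>(2) i]
    by (simp add: F.idt_left[OF i])
qed

text \<open>Write \<open>f'\<close> for \<open>P f\<close>.  Apply \<open>P\<close> to both sides and precompose with the comparison
  \<open>((k' h') g') f' \<cong> P (((k h) g) f)\<close>.  The coherence equations move every constraint to the start of the
  composite, as a constraint of \<open>E\<close>; what follows it is on both sides the comparison
  \<open>k' (h' (g' f')) \<cong> P (k (h (g f)))\<close>.  So the claim becomes the pentagon of \<open>E\<close>.\<close>

lemma lifted_pentagon:
  assumes o: "a \<in> Ob" "b \<in> Ob" "c \<in> Ob" "d \<in> Ob" "e \<in> Ob"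
    and f: "f \<in> Obj (H a b)" and g: "g \<in> Obj (H b c)" and h: "h \<in> Obj (H c d)" and k: "k \<in> Obj (H d e)"
  shows "lifted_assoc a c d e ((k, h), mO a b c g f) \<cdot>\<^bsub>H a e\<^esub> lifted_assoc a b c e ((mO c d e k h, g), f)
    = mA a d e (Idt (H d e) k) (lifted_assoc a b c d ((h, g), f)) \<cdot>\<^bsub>H a e\<^esub>
      (lifted_assoc a b d e ((k, mO b c d h g), f) \<cdot>\<^bsub>H a e\<^esub> mA a b e (lifted_assoc b c d e ((k, h), g)) (Idt (H a b) f))"
    (is "?l2 \<cdot>\<^bsub>_\<^esub> ?l1 = ?r3 \<cdot>\<^bsub>_\<^esub> (?r2 \<cdot>\<^bsub>_\<^esub> ?r1)")
proof -
  note Hc = H_category and Dc = D_category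
  interpret X: category "D a e" using Dc o by blast
  interpret Xbe: category "D b e" using Dc o by blast
  interpret Xad: category "D a d" using Dc o by blast
  interpret Xab: category "D a b" using Dc o by blast
  interpret Xde: category "D d e" using Dc o by blast
  interpret Xce: category "D c e" using Dc o by blast
  interpret Xac: category "D a c" using Dc o by blast
  interpret Xbc: category "D b c" using Dc o by blast
  interpret Hae: category "H a e" using Hc o by blast
  interpret Hab: category "H a b" using Hc o by blast
  interpret Hde: category "H d e" using Hc o by blast
  interpret P: is_functor "H a e" "D a e" "P a e" using P_functor o by blast
  interpret Pab: is_functor "H a b" "D a b" "P a b" using P_functor o by blast
  interpret Pde: is_functor "H d e" "D d e" "P d e" using P_functor o by blast
  interpret Pbe: is_functor "H b e" "D b e" "P b e" using P_functor o by blast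
  interpret Pad: is_functor "H a d" "D a d" "P a d" using P_functor o by blast

  define f' g' h' k' where cells: "f' = FO (P a b) f" "g' = FO (P b c) g" "h' = FO (P c d) h" "k' = FO (P d e) k"
  define gf hg kh where comps: "gf = mO a b c g f" "hg = mO b c d h g" "kh = mO c d e k h"
  have obj': "f' \<in> Obj (D a b)" "g' \<in> Obj (D b c)" "h' \<in> Obj (D c d)" "k' \<in> Obj (D d e)"
    unfolding cells using P_obj o f g h k by simp_all
  have obj: "gf \<in> Obj (H a c)" "hg \<in> Obj (H b d)" "kh \<in> Obj (H c e)"
    unfolding comps using M_bifunctor(1) o f g h k by simp_all
  define gf' hg' kh' where comps': "gf' = FO (P a c) gf" "hg' = FO (P b d) hg" "kh' = FO (P c e) kh"
  have obj'': "gf' \<in> Obj (D a c)" "hg' \<in> Obj (D b d)" "kh' \<in> Obj (D c e)"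
    unfolding comps' using P_obj o obj by simp_all
  have nobj: "nO a b c g' f' \<in> Obj (D a c)" "nO b c d h' g' \<in> Obj (D b d)" "nO c d e k' h' \<in> Obj (D c e)"
    using N_bifunctor(1) o obj' by simp_all
  have mobj: "mO b c e kh g \<in> Obj (H b e)" "mO b d e k hg \<in> Obj (H b e)"
    "mO a c d h gf \<in> Obj (H a d)" "mO a b d hg f \<in> Obj (H a d)"
    using M_bifunctor(1) o obj f g h k by simp_all

  have ph: "\<phi> a b c (g, f) \<in> iso_arrs (D a c) (nO a b c g' f') gf'"
    "\<phi> b c d (h, g) \<in> iso_arrs (D b d) (nO b c d h' g') hg'"
    "\<phi> c d e (k, h) \<in> iso_arrs (D c e) (nO c d e k' h') kh'"
    "\<phi> b c e (kh, g) \<in> iso_arrs (D b e) (nO b c e kh' g') (FO (P b e) (mO b c e kh g))"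
    "\<phi> b d e (k, hg) \<in> iso_arrs (D b e) (nO b d e k' hg') (FO (P b e) (mO b d e k hg))"
    "\<phi> a c d (h, gf) \<in> iso_arrs (D a d) (nO a c d h' gf') (FO (P a d) (mO a c d h gf))"
    "\<phi> a b d (hg, f) \<in> iso_arrs (D a d) (nO a b d hg' f') (FO (P a d) (mO a b d hg f))"
    unfolding cells comps comps' using \<phi>_arr o f g h k obj unfolding comps by simp_all
  note pha = ph[THEN iso_arrsD]
  have i1: "idD a b f' \<in> iso_arrs (D a b) f' f'" "idD b c g' \<in> iso_arrs (D b c) g' g'"
    using Xab.iso_arrs_idt Xbc.iso_arrs_idt obj' by auto
  have ida: "idD a b f' \<in> arrs (D a b) f' f'" "idD b c g' \<in> arrs (D b c) g' g'"
    "idD d e k' \<in> arrs (D d e) k' k'"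
    using i1[THEN iso_arrsD] Xde.idt_closed obj' by auto

  \<comment> \<open>\<open>x2 x1 x0\<close> is the composite of comparison cells from \<open>((k' h') g') f'\<close> to the image of
    \<open>((k h) g) f\<close>, along which both sides of the pentagon are compared.\<close>
  define x0 x1 x2 where x: "x0 = nA a b e (nA b c e (\<phi> c d e (k, h)) (idD b c g')) (idD a b f')"
    "x1 = nA a b e (\<phi> b c e (kh, g)) (idD a b f')" "x2 = \<phi> a b e (mO b c e kh g, f)"
  have xi: "x0 \<in> iso_arrs (D a e) (nO a b e (nO b c e (nO c d e k' h') g') f') (nO a b e (nO b c e kh' g') f')"
    "x1 \<in> iso_arrs (D a e) (nO a b e (nO b c e kh' g') f') (nO a b e (FO (P b e) (mO b c e kh g)) f')"
    "x2 \<in> iso_arrs (D a e) (nO a b e (FO (P b e) (mO b c e kh g)) f') (FO (P a e) (mO a b e (mO b c e kh g) f))"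
    unfolding x cells(1)
    using bifunctor_iso[OF Dc Dc N_functor] ph i1 \<phi>_arr mobj f o unfolding cells(1) by simp_all
  note xa = xi[THEN iso_arrsD]

  define a1 a2 where a: "a1 = FA (P a e) ?l1" "a2 = FA (P a e) ?l2"
  define b1 b2 b3 where b: "b1 = FA (P a e) ?r1" "b2 = FA (P a e) ?r2" "b3 = FA (P a e) ?r3"
  have lr: "?l1 \<in> arrs (H a e) (mO a b e (mO b c e kh g) f) (mO a c e kh gf)"
    "?l2 \<in> arrs (H a e) (mO a c e kh gf) (mO a d e k (mO a c d h gf))"
    "?r1 \<in> arrs (H a e) (mO a b e (mO b c e kh g) f) (mO a b e (mO b d e k hg) f)"
    "?r2 \<in> arrs (H a e) (mO a b e (mO b d e k hg) f) (mO a d e k (mO a b d hg f))"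
    "?r3 \<in> arrs (H a e) (mO a d e k (mO a b d hg f)) (mO a d e k (mO a c d h gf))"
    using lifted_assoc_arr o f g h k obj M_bifunctor(2)[OF o(1,4,5) Hde.idt_closed[OF k] lifted_assoc_arr[OF o(1-4) h g f]]
      M_bifunctor(2)[OF o(1,2,5) lifted_assoc_arr[OF o(2-5) k h g] Hab.idt_closed[OF f]]
    unfolding comps by simp_all
  have ab: "a1 \<in> arrs (D a e) (FO (P a e) (mO a b e (mO b c e kh g) f)) (FO (P a e) (mO a c e kh gf))"
    "a2 \<in> arrs (D a e) (FO (P a e) (mO a c e kh gf)) (FO (P a e) (mO a d e k (mO a c d h gf)))"
    "b1 \<in> arrs (D a e) (FO (P a e) (mO a b e (mO b c e kh g) f)) (FO (P a e) (mO a b e (mO b d e k hg) f))"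
    "b2 \<in> arrs (D a e) (FO (P a e) (mO a b e (mO b d e k hg) f)) (FO (P a e) (mO a d e k (mO a b d hg f)))"
    "b3 \<in> arrs (D a e) (FO (P a e) (mO a d e k (mO a b d hg f))) (FO (P a e) (mO a d e k (mO a c d h gf)))"
    unfolding a b using lr[THEN P.arr_closed] .

  \<comment> \<open>\<open>u2 u1 v\<close> is the analogous composite from \<open>k' (h' (g' f'))\<close> to the image of \<open>k (h (g f))\<close>, and
    \<open>w4 w2\<close> is the two-step side of the pentagon of \<open>E\<close>.\<close>
  define u2 u1 v w4 w2 where u: "u2 = \<phi> a d e (k, mO a c d h gf)"
    "u1 = nA a d e (idD d e k') (\<phi> a c d (h, gf))"
    "v = nA a d e (idD d e k') (nA a c d (idD c d h') (\<phi> a b c (g, f)))"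
    "w4 = \<omega> a c d e k' h' (nO a b c g' f')" "w2 = \<omega> a b c e (nO c d e k' h') g' f'"
  have idh: "idD c d h' \<in> arrs (D c d) h' h'" "idD c e kh' \<in> arrs (D c e) kh' kh'"
    "idD c e (nO c d e k' h') \<in> arrs (D c e) (nO c d e k' h') (nO c d e k' h')"
    "idD a c gf' \<in> arrs (D a c) gf' gf'"
    "idD a c (nO a b c g' f') \<in> arrs (D a c) (nO a b c g' f') (nO a b c g' f')"
    using Xce.idt_closed Xac.idt_closed category.idt_closed[OF Dc] o obj' obj'' nobj by simp_all

  define y2 y1 z z' w w1 w3 where y: "y2 = \<phi> a c e (kh, gf)"
    "y1 = nA a c e (idD c e kh') (\<phi> a b c (g, f))"
    "z = nA a c e (\<phi> c d e (k, h)) (idD a c (nO a b c g' f'))"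
    "z' = nA a c e (\<phi> c d e (k, h)) (idD a c gf')"
    "w = nA a c e (idD c e (nO c d e k' h')) (\<phi> a b c (g, f))"
    "w1 = \<omega> a b c e kh' g' f'" "w3 = \<omega> a c d e k' h' gf'"
  have e1: "a1 \<cdot>\<^bsub>D a e\<^esub> (x2 \<cdot>\<^bsub>D a e\<^esub> x1) = y2 \<cdot>\<^bsub>D a e\<^esub> (y1 \<cdot>\<^bsub>D a e\<^esub> w1)"
    using lifted_assoc_coherence[OF o(1,2,3,5) obj(3) g f] unfolding a x y cells comps comps' .
  have e2: "w1 \<cdot>\<^bsub>D a e\<^esub> x0 = z \<cdot>\<^bsub>D a e\<^esub> w2"
    using \<omega>_nat[OF o(1,2,3,5) pha(3) ida(2,1)] N_bifunctor(3)[OF o(1,2,3) obj'(2,1)]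
    unfolding x y u by simp
  have e3: "y1 \<cdot>\<^bsub>D a e\<^esub> z = z' \<cdot>\<^bsub>D a e\<^esub> w"
    using N_bifunctor(4)[OF o(1,3,5) pha(3) idh(5) idh(2) pha(1)]
      N_bifunctor(4)[OF o(1,3,5) idh(3) pha(1) pha(3) idh(4)]
      Xce.idt_left[OF pha(3)] Xce.idt_right[OF pha(3)] Xac.idt_left[OF pha(1)] Xac.idt_right[OF pha(1)]
    unfolding y by simp
  have e4: "a2 \<cdot>\<^bsub>D a e\<^esub> (y2 \<cdot>\<^bsub>D a e\<^esub> z') = u2 \<cdot>\<^bsub>D a e\<^esub> (u1 \<cdot>\<^bsub>D a e\<^esub> w3)"
    using lifted_assoc_coherence[OF o(1,3,4,5) k h obj(1)] unfolding a u y cells comps comps' .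
  have e5: "w3 \<cdot>\<^bsub>D a e\<^esub> w = v \<cdot>\<^bsub>D a e\<^esub> w4"
    using \<omega>_nat[OF o(1,3,4,5) ida(3) idh(1) pha(1)] N_bifunctor(3)[OF o(3,4,5) obj'(4,3)]
    unfolding y u by simp

  define x2' s t1 t0 w5 w6 w7 w8 r2 r1 q va where r: "x2' = \<phi> a b e (mO b d e k hg, f)"
    "s = nA a b e (FA (P b e) (lifted_assoc b c d e ((k, h), g))) (idD a b f')"
    "t1 = nA a b e (\<phi> b d e (k, hg)) (idD a b f')"
    "t0 = nA a b e (nA b d e (idD d e k') (\<phi> b c d (h, g))) (idD a b f')"
    "w5 = nA a b e (\<omega> b c d e k' h' g') (idD a b f')"
    "w6 = \<omega> a b d e k' hg' f'" "w7 = \<omega> a b d e k' (nO b c d h' g') f'"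
    "w8 = nA a d e (idD d e k') (\<omega> a b c d h' g' f')"
    "r2 = \<phi> a d e (k, mO a b d hg f)" "r1 = nA a d e (idD d e k') (\<phi> a b d (hg, f))"
    "q = nA a d e (idD d e k') (nA a b d (\<phi> b c d (h, g)) (idD a b f'))"
    "va = nA a d e (idD d e k') (FA (P a d) (lifted_assoc a b c d ((h, g), f)))"
  have PA: "FA (P b e) (lifted_assoc b c d e ((k, h), g)) \<in> arrs (D b e) (FO (P b e) (mO b c e kh g)) (FO (P b e) (mO b d e k hg))"
    "FA (P a d) (lifted_assoc a b c d ((h, g), f)) \<in> arrs (D a d) (FO (P a d) (mO a b d hg f)) (FO (P a d) (mO a c d h gf))"
    unfolding comps using Pbe.arr_closed[OF lifted_assoc_arr[OF o(2-5) k h g]] Pad.arr_closed[OF lifted_assoc_arr[OF o(1-4) h g f]] .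
  have om: "\<omega> b c d e k' h' g' \<in> arrs (D b e) (nO b c e (nO c d e k' h') g') (nO b d e k' (nO b c d h' g'))"
    "\<omega> a b c d h' g' f' \<in> arrs (D a d) (nO a b d (nO b c d h' g') f') (nO a c d h' (nO a b c g' f'))"
    using \<omega>_arr[THEN iso_arrsD] o obj' by simp_all
  have nn: "nA b c e (\<phi> c d e (k, h)) (idD b c g') \<in> arrs (D b e) (nO b c e (nO c d e k' h') g') (nO b c e kh' g')"
    "nA b d e (idD d e k') (\<phi> b c d (h, g)) \<in> arrs (D b e) (nO b d e k' (nO b c d h' g')) (nO b d e k' hg')"
    "nA a b d (\<phi> b c d (h, g)) (idD a b f') \<in> arrs (D a d) (nO a b d (nO b c d h' g') f') (nO a b d hg' f')"
    "nA a c d (idD c d h') (\<phi> a b c (g, f)) \<in> arrs (D a d) (nO a c d h' (nO a b c g' f')) (nO a c d h' gf')"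
    using N_bifunctor(2) o pha ida idh by simp_all
  have f1: "b1 \<cdot>\<^bsub>D a e\<^esub> x2 = x2' \<cdot>\<^bsub>D a e\<^esub> s"
    using \<phi>_nat[OF o(1,2,5) lifted_assoc_arr[OF o(2-5) k h g] Hab.idt_closed[OF f]] Pab.pres_idt[OF f]
    unfolding b x r cells comps by simp
  have f2: "s \<cdot>\<^bsub>D a e\<^esub> (x1 \<cdot>\<^bsub>D a e\<^esub> x0) = t1 \<cdot>\<^bsub>D a e\<^esub> (t0 \<cdot>\<^bsub>D a e\<^esub> w5)"
    unfolding x r N_right3[OF o(1,2,5) obj'(1) nn(1) pha(4) PA(1), symmetric]
      N_right3[OF o(1,2,5) obj'(1) om(1) nn(2) pha(5), symmetric]
    using lifted_assoc_coherence[OF o(2-5) k h g] unfolding cells comps comps' by simp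
  have f3: "b2 \<cdot>\<^bsub>D a e\<^esub> (x2' \<cdot>\<^bsub>D a e\<^esub> t1) = r2 \<cdot>\<^bsub>D a e\<^esub> (r1 \<cdot>\<^bsub>D a e\<^esub> w6)"
    using lifted_assoc_coherence[OF o(1,2,4,5) k obj(2) f] unfolding b r cells comps comps' .
  have f4: "w6 \<cdot>\<^bsub>D a e\<^esub> t0 = q \<cdot>\<^bsub>D a e\<^esub> w7"
    using \<omega>_nat[OF o(1,2,4,5) ida(3) pha(2) ida(1)] unfolding r .
  have f5: "b3 \<cdot>\<^bsub>D a e\<^esub> r2 = u2 \<cdot>\<^bsub>D a e\<^esub> va"
    using \<phi>_nat[OF o(1,4,5) Hde.idt_closed[OF k] lifted_assoc_arr[OF o(1-4) h g f]] Pde.pres_idt[OF k]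
    unfolding b u r cells comps by simp
  have f6: "va \<cdot>\<^bsub>D a e\<^esub> (r1 \<cdot>\<^bsub>D a e\<^esub> q) = u1 \<cdot>\<^bsub>D a e\<^esub> (v \<cdot>\<^bsub>D a e\<^esub> w8)"
    unfolding u r N_left3[OF o(1,4,5) obj'(4) nn(3) pha(7) PA(2), symmetric]
      N_left3[OF o(1,4,5) obj'(4) om(2) nn(4) pha(6), symmetric]
    using lifted_assoc_coherence[OF o(1-4) h g f] unfolding cells comps comps' by simp
  have f7: "w8 \<cdot>\<^bsub>D a e\<^esub> (w7 \<cdot>\<^bsub>D a e\<^esub> w5) = w4 \<cdot>\<^bsub>D a e\<^esub> w2"
    using pentagon[OF o[THEN p_closed] obj'] unfolding u r by simp

  have ty: "y2 \<in> arrs (D a e) (nO a c e kh' gf') (FO (P a e) (mO a c e kh gf))"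
    "y1 \<in> arrs (D a e) (nO a c e kh' (nO a b c g' f')) (nO a c e kh' gf')"
    "z \<in> arrs (D a e) (nO a c e (nO c d e k' h') (nO a b c g' f')) (nO a c e kh' (nO a b c g' f'))"
    "z' \<in> arrs (D a e) (nO a c e (nO c d e k' h') gf') (nO a c e kh' gf')"
    "w \<in> arrs (D a e) (nO a c e (nO c d e k' h') (nO a b c g' f')) (nO a c e (nO c d e k' h') gf')"
    "w1 \<in> arrs (D a e) (nO a b e (nO b c e kh' g') f') (nO a c e kh' (nO a b c g' f'))"
    "w3 \<in> arrs (D a e) (nO a c e (nO c d e k' h') gf') (nO a d e k' (nO a c d h' gf'))"
    "w4 \<in> arrs (D a e) (nO a c e (nO c d e k' h') (nO a b c g' f')) (nO a d e k' (nO a c d h' (nO a b c g' f')))"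
    "w2 \<in> arrs (D a e) (nO a b e (nO b c e (nO c d e k' h') g') f') (nO a c e (nO c d e k' h') (nO a b c g' f'))"
    "v \<in> arrs (D a e) (nO a d e k' (nO a c d h' (nO a b c g' f'))) (nO a d e k' (nO a c d h' gf'))"
    "u1 \<in> arrs (D a e) (nO a d e k' (nO a c d h' gf')) (nO a d e k' (FO (P a d) (mO a c d h gf)))"
    "u2 \<in> arrs (D a e) (nO a d e k' (FO (P a d) (mO a c d h gf))) (FO (P a e) (mO a d e k (mO a c d h gf)))"
    "x2' \<in> arrs (D a e) (nO a b e (FO (P b e) (mO b d e k hg)) f') (FO (P a e) (mO a b e (mO b d e k hg) f))"
    "s \<in> arrs (D a e) (nO a b e (FO (P b e) (mO b c e kh g)) f') (nO a b e (FO (P b e) (mO b d e k hg)) f')"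
    "t1 \<in> arrs (D a e) (nO a b e (nO b d e k' hg') f') (nO a b e (FO (P b e) (mO b d e k hg)) f')"
    "t0 \<in> arrs (D a e) (nO a b e (nO b d e k' (nO b c d h' g')) f') (nO a b e (nO b d e k' hg') f')"
    "w5 \<in> arrs (D a e) (nO a b e (nO b c e (nO c d e k' h') g') f') (nO a b e (nO b d e k' (nO b c d h' g')) f')"
    "w6 \<in> arrs (D a e) (nO a b e (nO b d e k' hg') f') (nO a d e k' (nO a b d hg' f'))"
    "w7 \<in> arrs (D a e) (nO a b e (nO b d e k' (nO b c d h' g')) f') (nO a d e k' (nO a b d (nO b c d h' g') f'))"
    "w8 \<in> arrs (D a e) (nO a d e k' (nO a b d (nO b c d h' g') f')) (nO a d e k' (nO a c d h' (nO a b c g' f')))"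
    "r2 \<in> arrs (D a e) (nO a d e k' (FO (P a d) (mO a b d hg f))) (FO (P a e) (mO a d e k (mO a b d hg f)))"
    "r1 \<in> arrs (D a e) (nO a d e k' (nO a b d hg' f')) (nO a d e k' (FO (P a d) (mO a b d hg f)))"
    "q \<in> arrs (D a e) (nO a d e k' (nO a b d (nO b c d h' g') f')) (nO a d e k' (nO a b d hg' f'))"
    "va \<in> arrs (D a e) (nO a d e k' (FO (P a d) (mO a b d hg f))) (nO a d e k' (FO (P a d) (mO a c d h gf)))"
    using \<phi>_arr[OF o(1,3,5) obj(3,1), THEN iso_arrsD, folded comps']
      \<phi>_arr[OF o(1,4,5) k mobj(3), THEN iso_arrsD, folded cells]
      \<phi>_arr[OF o(1,4,5) k mobj(4), THEN iso_arrsD, folded cells]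
      \<phi>_arr[OF o(1,2,5) mobj(2) f, THEN iso_arrsD, folded cells]
      \<omega>_arr[THEN iso_arrsD] N_bifunctor(2) o obj' obj'' nobj pha ida idh nn PA om
    unfolding y u r by simp_all
  note T = xa ab ty

  \<comment> \<open>The two-step side: two coherence equations, joined by naturality of \<open>\<omega>\<close> and interchange.\<close>
  have "a2 \<cdot>\<^bsub>D a e\<^esub> (a1 \<cdot>\<^bsub>D a e\<^esub> (x2 \<cdot>\<^bsub>D a e\<^esub> (x1 \<cdot>\<^bsub>D a e\<^esub> x0)))
      = a2 \<cdot>\<^bsub>D a e\<^esub> ((a1 \<cdot>\<^bsub>D a e\<^esub> (x2 \<cdot>\<^bsub>D a e\<^esub> x1)) \<cdot>\<^bsub>D a e\<^esub> x0)"
    using T by (simp add: X.reassoc)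
  also have "\<dots> = a2 \<cdot>\<^bsub>D a e\<^esub> ((y2 \<cdot>\<^bsub>D a e\<^esub> (y1 \<cdot>\<^bsub>D a e\<^esub> w1)) \<cdot>\<^bsub>D a e\<^esub> x0)"
    unfolding e1 ..
  also have "\<dots> = a2 \<cdot>\<^bsub>D a e\<^esub> (y2 \<cdot>\<^bsub>D a e\<^esub> (y1 \<cdot>\<^bsub>D a e\<^esub> (w1 \<cdot>\<^bsub>D a e\<^esub> x0)))"
    using T by (simp add: X.reassoc)
  also have "\<dots> = a2 \<cdot>\<^bsub>D a e\<^esub> (y2 \<cdot>\<^bsub>D a e\<^esub> (y1 \<cdot>\<^bsub>D a e\<^esub> (z \<cdot>\<^bsub>D a e\<^esub> w2)))"
    unfolding e2 ..
  also have "\<dots> = a2 \<cdot>\<^bsub>D a e\<^esub> (y2 \<cdot>\<^bsub>D a e\<^esub> ((y1 \<cdot>\<^bsub>D a e\<^esub> z) \<cdot>\<^bsub>D a e\<^esub> w2))"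
    using T by (simp add: X.reassoc)
  also have "\<dots> = a2 \<cdot>\<^bsub>D a e\<^esub> (y2 \<cdot>\<^bsub>D a e\<^esub> ((z' \<cdot>\<^bsub>D a e\<^esub> w) \<cdot>\<^bsub>D a e\<^esub> w2))"
    unfolding e3 ..
  also have "\<dots> = (a2 \<cdot>\<^bsub>D a e\<^esub> (y2 \<cdot>\<^bsub>D a e\<^esub> z')) \<cdot>\<^bsub>D a e\<^esub> (w \<cdot>\<^bsub>D a e\<^esub> w2)"
    using T by (simp add: X.reassoc)
  also have "\<dots> = (u2 \<cdot>\<^bsub>D a e\<^esub> (u1 \<cdot>\<^bsub>D a e\<^esub> w3)) \<cdot>\<^bsub>D a e\<^esub> (w \<cdot>\<^bsub>D a e\<^esub> w2)"
    unfolding e4 ..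
  also have "\<dots> = u2 \<cdot>\<^bsub>D a e\<^esub> (u1 \<cdot>\<^bsub>D a e\<^esub> ((w3 \<cdot>\<^bsub>D a e\<^esub> w) \<cdot>\<^bsub>D a e\<^esub> w2))"
    using T by (simp add: X.reassoc)
  also have "\<dots> = u2 \<cdot>\<^bsub>D a e\<^esub> (u1 \<cdot>\<^bsub>D a e\<^esub> ((v \<cdot>\<^bsub>D a e\<^esub> w4) \<cdot>\<^bsub>D a e\<^esub> w2))"
    unfolding e5 ..
  also have "\<dots> = u2 \<cdot>\<^bsub>D a e\<^esub> (u1 \<cdot>\<^bsub>D a e\<^esub> (v \<cdot>\<^bsub>D a e\<^esub> (w4 \<cdot>\<^bsub>D a e\<^esub> w2)))"
    using T by (simp add: X.reassoc)
  finally have left: "a2 \<cdot>\<^bsub>D a e\<^esub> (a1 \<cdot>\<^bsub>D a e\<^esub> (x2 \<cdot>\<^bsub>D a e\<^esub> (x1 \<cdot>\<^bsub>D a e\<^esub> x0))) = u2 \<cdot>\<^bsub>D a e\<^esub> (u1 \<cdot>\<^bsub>D a e\<^esub> (v \<cdot>\<^bsub>D a e\<^esub> (w4 \<cdot>\<^bsub>D a e\<^esub> w2)))" .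
  \<comment> \<open>The three-step side: one coherence equation for each constraint, the outer two of them whiskered;
    the pentagon of \<open>E\<close> turns the result into that of the other side.\<close>
  have "b3 \<cdot>\<^bsub>D a e\<^esub> (b2 \<cdot>\<^bsub>D a e\<^esub> (b1 \<cdot>\<^bsub>D a e\<^esub> (x2 \<cdot>\<^bsub>D a e\<^esub> (x1 \<cdot>\<^bsub>D a e\<^esub> x0))))
      = b3 \<cdot>\<^bsub>D a e\<^esub> (b2 \<cdot>\<^bsub>D a e\<^esub> ((b1 \<cdot>\<^bsub>D a e\<^esub> x2) \<cdot>\<^bsub>D a e\<^esub> (x1 \<cdot>\<^bsub>D a e\<^esub> x0)))"
    using T by (simp add: X.reassoc)
  also have "\<dots> = b3 \<cdot>\<^bsub>D a e\<^esub> (b2 \<cdot>\<^bsub>D a e\<^esub> ((x2' \<cdot>\<^bsub>D a e\<^esub> s) \<cdot>\<^bsub>D a e\<^esub> (x1 \<cdot>\<^bsub>D a e\<^esub> x0)))"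
    unfolding f1 ..
  also have "\<dots> = b3 \<cdot>\<^bsub>D a e\<^esub> (b2 \<cdot>\<^bsub>D a e\<^esub> (x2' \<cdot>\<^bsub>D a e\<^esub> (s \<cdot>\<^bsub>D a e\<^esub> (x1 \<cdot>\<^bsub>D a e\<^esub> x0))))"
    using T by (simp add: X.reassoc)
  also have "\<dots> = b3 \<cdot>\<^bsub>D a e\<^esub> (b2 \<cdot>\<^bsub>D a e\<^esub> (x2' \<cdot>\<^bsub>D a e\<^esub> (t1 \<cdot>\<^bsub>D a e\<^esub> (t0 \<cdot>\<^bsub>D a e\<^esub> w5))))"
    unfolding f2 ..
  also have "\<dots> = b3 \<cdot>\<^bsub>D a e\<^esub> ((b2 \<cdot>\<^bsub>D a e\<^esub> (x2' \<cdot>\<^bsub>D a e\<^esub> t1)) \<cdot>\<^bsub>D a e\<^esub> (t0 \<cdot>\<^bsub>D a e\<^esub> w5))"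
    using T by (simp add: X.reassoc)
  also have "\<dots> = b3 \<cdot>\<^bsub>D a e\<^esub> ((r2 \<cdot>\<^bsub>D a e\<^esub> (r1 \<cdot>\<^bsub>D a e\<^esub> w6)) \<cdot>\<^bsub>D a e\<^esub> (t0 \<cdot>\<^bsub>D a e\<^esub> w5))"
    unfolding f3 ..
  also have "\<dots> = b3 \<cdot>\<^bsub>D a e\<^esub> (r2 \<cdot>\<^bsub>D a e\<^esub> (r1 \<cdot>\<^bsub>D a e\<^esub> ((w6 \<cdot>\<^bsub>D a e\<^esub> t0) \<cdot>\<^bsub>D a e\<^esub> w5)))"
    using T by (simp add: X.reassoc)
  also have "\<dots> = b3 \<cdot>\<^bsub>D a e\<^esub> (r2 \<cdot>\<^bsub>D a e\<^esub> (r1 \<cdot>\<^bsub>D a e\<^esub> ((q \<cdot>\<^bsub>D a e\<^esub> w7) \<cdot>\<^bsub>D a e\<^esub> w5)))"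
    unfolding f4 ..
  also have "\<dots> = (b3 \<cdot>\<^bsub>D a e\<^esub> r2) \<cdot>\<^bsub>D a e\<^esub> ((r1 \<cdot>\<^bsub>D a e\<^esub> q) \<cdot>\<^bsub>D a e\<^esub> (w7 \<cdot>\<^bsub>D a e\<^esub> w5))"
    using T by (simp add: X.reassoc)
  also have "\<dots> = (u2 \<cdot>\<^bsub>D a e\<^esub> va) \<cdot>\<^bsub>D a e\<^esub> ((r1 \<cdot>\<^bsub>D a e\<^esub> q) \<cdot>\<^bsub>D a e\<^esub> (w7 \<cdot>\<^bsub>D a e\<^esub> w5))"
    unfolding f5 ..
  also have "\<dots> = u2 \<cdot>\<^bsub>D a e\<^esub> ((va \<cdot>\<^bsub>D a e\<^esub> (r1 \<cdot>\<^bsub>D a e\<^esub> q)) \<cdot>\<^bsub>D a e\<^esub> (w7 \<cdot>\<^bsub>D a e\<^esub> w5))"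
    using T by (simp add: X.reassoc)
  also have "\<dots> = u2 \<cdot>\<^bsub>D a e\<^esub> ((u1 \<cdot>\<^bsub>D a e\<^esub> (v \<cdot>\<^bsub>D a e\<^esub> w8)) \<cdot>\<^bsub>D a e\<^esub> (w7 \<cdot>\<^bsub>D a e\<^esub> w5))"
    unfolding f6 ..
  also have "\<dots> = u2 \<cdot>\<^bsub>D a e\<^esub> (u1 \<cdot>\<^bsub>D a e\<^esub> (v \<cdot>\<^bsub>D a e\<^esub> (w8 \<cdot>\<^bsub>D a e\<^esub> (w7 \<cdot>\<^bsub>D a e\<^esub> w5))))"
    using T by (simp add: X.reassoc)
  also have "\<dots> = u2 \<cdot>\<^bsub>D a e\<^esub> (u1 \<cdot>\<^bsub>D a e\<^esub> (v \<cdot>\<^bsub>D a e\<^esub> (w4 \<cdot>\<^bsub>D a e\<^esub> w2)))"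
    unfolding f7 ..
  finally have right: "b3 \<cdot>\<^bsub>D a e\<^esub> (b2 \<cdot>\<^bsub>D a e\<^esub> (b1 \<cdot>\<^bsub>D a e\<^esub> (x2 \<cdot>\<^bsub>D a e\<^esub> (x1 \<cdot>\<^bsub>D a e\<^esub> x0)))) = u2 \<cdot>\<^bsub>D a e\<^esub> (u1 \<cdot>\<^bsub>D a e\<^esub> (v \<cdot>\<^bsub>D a e\<^esub> (w4 \<cdot>\<^bsub>D a e\<^esub> w2)))" .
  have l: "FA (P a e) (?l2 \<cdot>\<^bsub>H a e\<^esub> ?l1) = a2 \<cdot>\<^bsub>D a e\<^esub> a1"
    unfolding a by (rule P.pres_cmp[OF lr(1,2)])
  have r: "FA (P a e) (?r3 \<cdot>\<^bsub>H a e\<^esub> (?r2 \<cdot>\<^bsub>H a e\<^esub> ?r1)) = b3 \<cdot>\<^bsub>D a e\<^esub> (b2 \<cdot>\<^bsub>D a e\<^esub> b1)"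
    unfolding b P.pres_cmp[OF Hae.cmp_closed[OF lr(3,4)] lr(5)] P.pres_cmp[OF lr(3,4)] ..
  show ?thesis
  proof (rule P_cancel[OF o(1,5) X.iso_arrs_cmp[OF X.iso_arrs_cmp[OF xi(1,2)] xi(3)]
      Hae.cmp_closed[OF lr(1,2)] Hae.cmp_closed[OF Hae.cmp_closed[OF lr(3,4)] lr(5)]])
    show "FA (P a e) (?l2 \<cdot>\<^bsub>H a e\<^esub> ?l1) \<cdot>\<^bsub>D a e\<^esub> (x2 \<cdot>\<^bsub>D a e\<^esub> (x1 \<cdot>\<^bsub>D a e\<^esub> x0))
      = FA (P a e) (?r3 \<cdot>\<^bsub>H a e\<^esub> (?r2 \<cdot>\<^bsub>H a e\<^esub> ?r1)) \<cdot>\<^bsub>D a e\<^esub> (x2 \<cdot>\<^bsub>D a e\<^esub> (x1 \<cdot>\<^bsub>D a e\<^esub> x0))"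
      using left right T unfolding l r by (simp add: X.reassoc)
  qed
qed

text \<open>As for the pentagon, with the comparison \<open>(g' 1) f' \<cong> P ((g 1) f)\<close>; the claim becomes the triangle of \<open>E\<close>.\<close>

lemma lifted_triangle:
  assumes o: "a \<in> Ob" "b \<in> Ob" "c \<in> Ob" and f: "f \<in> Obj (H a b)" and g: "g \<in> Obj (H b c)"
  shows "mA a b c (Idt (H b c) g) (lifted_lunit a b f) \<cdot>\<^bsub>H a c\<^esub> lifted_assoc a b b c ((g, I b), f)
    = mA a b c (lifted_runit b c g) (Idt (H a b) f)"
    (is "?l2 \<cdot>\<^bsub>_\<^esub> ?l1 = ?r")
proof -
  interpret X: category "D a c" using D_category o by blast
  interpret Xab: category "D a b" using D_category o by blast
  interpret Xbc: category "D b c" using D_category o by blast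
  interpret Hab: category "H a b" using H_category o by blast
  interpret Hbc: category "H b c" using H_category o by blast
  interpret Hac: category "H a c" using H_category o by blast
  interpret P: is_functor "H a c" "D a c" "P a c" using P_functor o by blast
  interpret Pab: is_functor "H a b" "D a b" "P a b" using P_functor o by blast
  interpret Pbc: is_functor "H b c" "D b c" "P b c" using P_functor o by blast
  define f' g' j J where cells: "f' = FO (P a b) f" "g' = FO (P b c) g"
    "j = BId E (p b)" "J = FO (P b b) (I b)"
  note Ib = I_closed[OF o(2)]
  have obj: "f' \<in> Obj (D a b)" "g' \<in> Obj (D b c)" "j \<in> Obj (D b b)" "J \<in> Obj (D b b)"
    "mO a b b (I b) f \<in> Obj (H a b)" "mO b b c g (I b) \<in> Obj (H b c)"
    unfolding cells using P_obj id_closed p_closed M_bifunctor(1) o f g Ib by simp_all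
  have i: "idD a b f' \<in> iso_arrs (D a b) f' f'" "idD b c g' \<in> iso_arrs (D b c) g' g'"
    using Xab.iso_arrs_idt Xbc.iso_arrs_idt obj by auto
  note ida = i[THEN iso_arrsD]
  have ps: "\<psi> b \<in> iso_arrs (D b b) j J" unfolding cells using \<psi>_iso[OF o(2)] .
  have ph: "\<phi> b b c (g, I b) \<in> iso_arrs (D b c) (nO b b c g' J) (FO (P b c) (mO b b c g (I b)))"
    "\<phi> a b b (I b, f) \<in> iso_arrs (D a b) (nO a b b J f') (FO (P a b) (mO a b b (I b) f))"
    "\<phi> a b c (g, f) \<in> iso_arrs (D a c) (nO a b c g' f') (FO (P a c) (mO a b c g f))"
    unfolding cells using \<phi>_arr o f g Ib by simp_all
  note pha = ph[THEN iso_arrsD]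

  \<comment> \<open>\<open>x2 x1 x0\<close> runs from \<open>(g' 1) f'\<close>, with the unit of \<open>E\<close>, to the image of \<open>(g 1) f\<close>.\<close>
  define x0 x1 x2 where x: "x0 = nA a b c (nA b b c (idD b c g') (\<psi> b)) (idD a b f')"
    "x1 = nA a b c (\<phi> b b c (g, I b)) (idD a b f')" "x2 = \<phi> a b c (mO b b c g (I b), f)"
  have xi: "x0 \<in> iso_arrs (D a c) (nO a b c (nO b b c g' j) f') (nO a b c (nO b b c g' J) f')"
    "x1 \<in> iso_arrs (D a c) (nO a b c (nO b b c g' J) f') (nO a b c (FO (P b c) (mO b b c g (I b))) f')"
    "x2 \<in> iso_arrs (D a c) (nO a b c (FO (P b c) (mO b b c g (I b))) f') (FO (P a c) (mO a b c (mO b b c g (I b)) f))"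
    unfolding x cells(1)
    using bifunctor_iso[OF D_category D_category N_functor] ph i ps \<phi>_arr obj f o unfolding cells(1) by simp_all
  note xa = xi[THEN iso_arrsD]
  note La = lifted_lunit_arr[OF o(1,2) f] and Ra = lifted_runit_arr[OF o(2,3) g]
  note PL = Pab.arr_closed[OF La] and PR = Pbc.arr_closed[OF Ra]
  have lr: "?l1 \<in> arrs (H a c) (mO a b c (mO b b c g (I b)) f) (mO a b c g (mO a b b (I b) f))"
    "?l2 \<in> arrs (H a c) (mO a b c g (mO a b b (I b) f)) (mO a b c g f)"
    "?r \<in> arrs (H a c) (mO a b c (mO b b c g (I b)) f) (mO a b c g f)"
    using lifted_assoc_arr[OF o(1,2,2,3) g Ib f] M_bifunctor(2)[OF o Hbc.idt_closed[OF g] La]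
      M_bifunctor(2)[OF o Ra Hab.idt_closed[OF f]] .
  define a1 a2 b1 where a: "a1 = FA (P a c) ?l1" "a2 = FA (P a c) ?l2" "b1 = FA (P a c) ?r"
  have aa: "a1 \<in> arrs (D a c) (FO (P a c) (mO a b c (mO b b c g (I b)) f)) (FO (P a c) (mO a b c g (mO a b b (I b) f)))"
    "a2 \<in> arrs (D a c) (FO (P a c) (mO a b c g (mO a b b (I b) f))) (FO (P a c) (mO a b c g f))"
    "b1 \<in> arrs (D a c) (FO (P a c) (mO a b c (mO b b c g (I b)) f)) (FO (P a c) (mO a b c g f))"
    unfolding a using lr[THEN P.arr_closed] .

  define y2 y1 y0 w1 w0 l r u where y: "y2 = \<phi> a b c (g, mO a b b (I b) f)"
    "y1 = nA a b c (idD b c g') (\<phi> a b b (I b, f))" "y0 = nA a b c (idD b c g') (nA a b b (\<psi> b) (idD a b f'))"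
    "w1 = \<omega> a b b c g' J f'" "w0 = \<omega> a b b c g' j f'"
    "l = nA a b c (idD b c g') (FA (P a b) (lifted_lunit a b f))" "r = nA a b c (FA (P b c) (lifted_runit b c g)) (idD a b f')"
    "u = \<phi> a b c (g, f)"
  have nn: "nA b b c (idD b c g') (\<psi> b) \<in> arrs (D b c) (nO b b c g' j) (nO b b c g' J)"
    "nA a b b (\<psi> b) (idD a b f') \<in> arrs (D a b) (nO a b b j f') (nO a b b J f')"
    using N_bifunctor(2) o ida ps[THEN iso_arrsD] by simp_all
  have e1: "a1 \<cdot>\<^bsub>D a c\<^esub> (x2 \<cdot>\<^bsub>D a c\<^esub> x1) = y2 \<cdot>\<^bsub>D a c\<^esub> (y1 \<cdot>\<^bsub>D a c\<^esub> w1)"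
    using lifted_assoc_coherence[OF o(1,2,2,3) g Ib f] unfolding a x y cells .
  have e2: "w1 \<cdot>\<^bsub>D a c\<^esub> x0 = y0 \<cdot>\<^bsub>D a c\<^esub> w0"
    using \<omega>_nat[OF o(1,2,2,3) ida(2) iso_arrsD[OF ps] ida(1)] unfolding x y .
  have e3: "a2 \<cdot>\<^bsub>D a c\<^esub> y2 = u \<cdot>\<^bsub>D a c\<^esub> l"
    using \<phi>_nat[OF o Hbc.idt_closed[OF g] La] Pbc.pres_idt[OF g] unfolding a y cells by simp
  have e4: "l \<cdot>\<^bsub>D a c\<^esub> (y1 \<cdot>\<^bsub>D a c\<^esub> y0) = nA a b c (idD b c g') (BLunit E (p a) (p b) f')"
    unfolding y N_left3[OF o obj(2) nn(2) pha(2) PL, symmetric]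
    using lifted_lunit_coherence[OF o(1,2) f] unfolding cells by simp
  have f1: "b1 \<cdot>\<^bsub>D a c\<^esub> x2 = u \<cdot>\<^bsub>D a c\<^esub> r"
    using \<phi>_nat[OF o Ra Hab.idt_closed[OF f]] Pab.pres_idt[OF f] unfolding a x y cells by simp
  have f2: "r \<cdot>\<^bsub>D a c\<^esub> (x1 \<cdot>\<^bsub>D a c\<^esub> x0) = nA a b c (BRunit E (p b) (p c) g') (idD a b f')"
    unfolding x y N_right3[OF o obj(1) nn(1) pha(1) PR, symmetric]
    using lifted_runit_coherence[OF o(2,3) g] unfolding cells by simp
  have tr: "nA a b c (idD b c g') (BLunit E (p a) (p b) f') \<cdot>\<^bsub>D a c\<^esub> w0 = nA a b c (BRunit E (p b) (p c) g') (idD a b f')"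
    using triangle[OF o[THEN p_closed] obj(1,2)] unfolding y cells .
  have ty: "y2 \<in> arrs (D a c) (nO a b c g' (FO (P a b) (mO a b b (I b) f))) (FO (P a c) (mO a b c g (mO a b b (I b) f)))"
    "y1 \<in> arrs (D a c) (nO a b c g' (nO a b b J f')) (nO a b c g' (FO (P a b) (mO a b b (I b) f)))"
    "y0 \<in> arrs (D a c) (nO a b c g' (nO a b b j f')) (nO a b c g' (nO a b b J f'))"
    "w1 \<in> arrs (D a c) (nO a b c (nO b b c g' J) f') (nO a b c g' (nO a b b J f'))"
    "w0 \<in> arrs (D a c) (nO a b c (nO b b c g' j) f') (nO a b c g' (nO a b b j f'))"
    "l \<in> arrs (D a c) (nO a b c g' (FO (P a b) (mO a b b (I b) f))) (nO a b c g' f')"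
    "r \<in> arrs (D a c) (nO a b c (FO (P b c) (mO b b c g (I b))) f') (nO a b c g' f')"
    "u \<in> arrs (D a c) (nO a b c g' f') (FO (P a c) (mO a b c g f))"
    using \<phi>_arr[OF o g obj(5), THEN iso_arrsD, folded cells]
      \<omega>_arr[THEN iso_arrsD] N_bifunctor(2) o obj pha ida nn
      PL[folded cells] PR[folded cells]
    unfolding y by simp_all
  note T = xa aa ty
  have "a2 \<cdot>\<^bsub>D a c\<^esub> (a1 \<cdot>\<^bsub>D a c\<^esub> (x2 \<cdot>\<^bsub>D a c\<^esub> (x1 \<cdot>\<^bsub>D a c\<^esub> x0)))
      = a2 \<cdot>\<^bsub>D a c\<^esub> ((a1 \<cdot>\<^bsub>D a c\<^esub> (x2 \<cdot>\<^bsub>D a c\<^esub> x1)) \<cdot>\<^bsub>D a c\<^esub> x0)"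
    using T by (simp add: X.reassoc)
  also have "\<dots> = a2 \<cdot>\<^bsub>D a c\<^esub> ((y2 \<cdot>\<^bsub>D a c\<^esub> (y1 \<cdot>\<^bsub>D a c\<^esub> w1)) \<cdot>\<^bsub>D a c\<^esub> x0)"
    unfolding e1 ..
  also have "\<dots> = (a2 \<cdot>\<^bsub>D a c\<^esub> y2) \<cdot>\<^bsub>D a c\<^esub> (y1 \<cdot>\<^bsub>D a c\<^esub> (w1 \<cdot>\<^bsub>D a c\<^esub> x0))"
    using T by (simp add: X.reassoc)
  also have "\<dots> = (u \<cdot>\<^bsub>D a c\<^esub> l) \<cdot>\<^bsub>D a c\<^esub> (y1 \<cdot>\<^bsub>D a c\<^esub> (y0 \<cdot>\<^bsub>D a c\<^esub> w0))"
    unfolding e2 e3 ..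
  also have "\<dots> = u \<cdot>\<^bsub>D a c\<^esub> ((l \<cdot>\<^bsub>D a c\<^esub> (y1 \<cdot>\<^bsub>D a c\<^esub> y0)) \<cdot>\<^bsub>D a c\<^esub> w0)"
    using T by (simp add: X.reassoc)
  also have "\<dots> = u \<cdot>\<^bsub>D a c\<^esub> (r \<cdot>\<^bsub>D a c\<^esub> (x1 \<cdot>\<^bsub>D a c\<^esub> x0))"
    unfolding e4 tr f2 ..
  also have "\<dots> = (u \<cdot>\<^bsub>D a c\<^esub> r) \<cdot>\<^bsub>D a c\<^esub> (x1 \<cdot>\<^bsub>D a c\<^esub> x0)"
    using T by (simp add: X.reassoc)
  also have "\<dots> = (b1 \<cdot>\<^bsub>D a c\<^esub> x2) \<cdot>\<^bsub>D a c\<^esub> (x1 \<cdot>\<^bsub>D a c\<^esub> x0)"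
    unfolding f1 ..
  finally have eq: "a2 \<cdot>\<^bsub>D a c\<^esub> (a1 \<cdot>\<^bsub>D a c\<^esub> (x2 \<cdot>\<^bsub>D a c\<^esub> (x1 \<cdot>\<^bsub>D a c\<^esub> x0))) = (b1 \<cdot>\<^bsub>D a c\<^esub> x2) \<cdot>\<^bsub>D a c\<^esub> (x1 \<cdot>\<^bsub>D a c\<^esub> x0)" .
  have l2: "FA (P a c) (?l2 \<cdot>\<^bsub>H a c\<^esub> ?l1) = a2 \<cdot>\<^bsub>D a c\<^esub> a1"
    unfolding a by (rule P.pres_cmp[OF lr(1,2)])
  show ?thesis
  proof (rule P_cancel[OF o(1,3) X.iso_arrs_cmp[OF X.iso_arrs_cmp[OF xi(1,2)] xi(3)]
      Hac.cmp_closed[OF lr(1,2)] lr(3)])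
    show "FA (P a c) (?l2 \<cdot>\<^bsub>H a c\<^esub> ?l1) \<cdot>\<^bsub>D a c\<^esub> (x2 \<cdot>\<^bsub>D a c\<^esub> (x1 \<cdot>\<^bsub>D a c\<^esub> x0))
      = FA (P a c) ?r \<cdot>\<^bsub>D a c\<^esub> (x2 \<cdot>\<^bsub>D a c\<^esub> (x1 \<cdot>\<^bsub>D a c\<^esub> x0))"
      using eq T unfolding l2 a(3)[symmetric] by (simp add: X.reassoc)
  qed
qed

definition lifted_bicat :: "('o, 'h, 'm) bicat" where
  "lifted_bicat = \<lparr>BOb = Ob, BHom = H, BComp = M, BId = I, BAssoc = lifted_assoc, BLunit = lifted_lunit, BRunit = lifted_runit\<rparr>"

definition lifted_psfun :: "('o, 'h, 'm, 'p, 'k, 'n) psfun" where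
  "lifted_psfun = \<lparr>PO = p, PF = P, PComp = \<phi>, PUnit = \<psi>\<rparr>"

lemma lifted_bicat_sel:
  "BOb lifted_bicat = Ob" "BHom lifted_bicat = H" "BComp lifted_bicat = M" "BId lifted_bicat = I"
  "BAssoc lifted_bicat = lifted_assoc" "BLunit lifted_bicat = lifted_lunit" "BRunit lifted_bicat = lifted_runit"
  by (simp_all add: lifted_bicat_def)

lemma lifted_psfun_sel:
  "PO lifted_psfun = p" "PF lifted_psfun = P" "PComp lifted_psfun = \<phi>" "PUnit lifted_psfun = \<psi>"
  by (simp_all add: lifted_psfun_def)

lemma bicategory_lifted: "bicategory lifted_bicat"
  by (rule bicategory.intro; unfold lifted_bicat_sel;
    rule H_category M_functor I_closed lifted_assoc_iso lifted_lunit_iso lifted_runit_iso lifted_pentagon lifted_triangle; assumption)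

lemma pseudofunctor_lifted: "pseudofunctor lifted_bicat E lifted_psfun"
  by (rule pseudofunctor.intro; unfold lifted_bicat_sel lifted_psfun_sel Let_def;
    rule p_closed P_functor \<phi>_iso \<psi>_iso lifted_assoc_coherence lifted_lunit_coherence lifted_runit_coherence; assumption)

end

section \<open>Enriched equivalences and bicategories\<close>

text \<open>Representatives of the classes that make up \<open>C\<close> and \<open>F\<close> form an instance of
  \<^locale>\<open>lifted_composition\<close>: \<open>P\<close> is fully faithful as \<open>F\<close> is a local equivalence, and \<open>\<phi>\<close> and \<open>\<psi>\<close>
  witness the equations of classes which say that \<open>F\<close> preserves composition and identities.\<close>

proposition ho_equivalence_lifts_bicategory:
  fixes C :: "('o, 'h, 'm) hocat" and D :: "('p, 'k, 'n) hocat"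
    and F :: "('o, 'h, 'm, 'p, 'k, 'n) hofun"
  assumes C: "ho_category C" and D: "ho_category D" and F: "ho_equivalence C D F"
    and E: "bicategory E" and u: "underlies_bicategory D E"
  obtains B :: "('o, 'h, 'm) bicat" and Q :: "('o, 'h, 'm, 'p, 'k, 'n) psfun"
  where "bicategory B" "underlies_bicategory C B"
    "pseudofunctor B E Q" "underlies_pseudofunctor F B E Q"
proof -
  interpret C: ho_category C by fact
  interpret D: ho_category D by fact
  interpret F: ho_functor C D F using F by (simp add: ho_equivalence_def)
  interpret E: bicategory E by fact
  have obD: "EOb D = BOb E" using u by (simp add: underlies_bicategory_def)
  note fo = F.obj_closed[unfolded obD]
  have homD: "EHom D (EFO F a) (EFO F b) = BHom E (EFO F a) (EFO F b)"
    and compD: "EComp D (EFO F a) (EFO F b) (EFO F c) = iso_class (BHom E (EFO F b) (EFO F c) \<times>\<^sub>C BHom E (EFO F a) (EFO F b))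
      (BHom E (EFO F a) (EFO F c)) (BComp E (EFO F a) (EFO F b) (EFO F c))"
    and idD: "EId D (EFO F a) = iso_class one_cat (BHom E (EFO F a) (EFO F a))
      (pick (BHom E (EFO F a) (EFO F a)) (BId E (EFO F a)))"
    if "a \<in> EOb C" "b \<in> EOb C" "c \<in> EOb C" for a b c
    using u fo that by (simp_all add: underlies_bicategory_def)
  define P where "P a b = rep (EFA F a b)" for a b
  define I where "I a = FO (C.unit_rep a) ()" for a
  note Dc = E.hom_category[OF fo fo]
  have P: "is_functor (EHom C a b) (BHom E (EFO F a) (EFO F b)) (P a b)"
    "EFA F a b = iso_class (EHom C a b) (BHom E (EFO F a) (EFO F b)) (P a b)"
    if o: "a \<in> EOb C" "b \<in> EOb C" for a b
    unfolding P_def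
    using rep_ho_hom[OF C.hom_category[OF o] Dc[OF o] F.hom_mor[OF o, unfolded homD[OF o o(1)]]] by simp_all
  have ff: "bij_betw (FA (P a b)) (arrs (EHom C a b) x y)
      (arrs (BHom E (EFO F a) (EFO F b)) (FO (P a b) x) (FO (P a b) y))"
    if o: "a \<in> EOb C" "b \<in> EOb C" and xy: "x \<in> Obj (EHom C a b)" "y \<in> Obj (EHom C a b)" for a b x y
  proof -
    have "cat_equivalence (EHom C a b) (BHom E (EFO F a) (EFO F b)) (P a b)"
      using ho_iso_imp_cat_equivalence[OF C.hom_category[OF o] Dc[OF o]]
        ho_equivalence_ho_iso[OF C D F o, of "P a b"] P[OF o] homD[OF o o(1)] by simp
    then show ?thesis using xy by (simp add: cat_equivalence_def)
  qed
  have I: "I a \<in> Obj (EHom C a a)" and unit: "EId C a = iso_class one_cat (EHom C a a) (pick (EHom C a a) (I a))"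
    if a: "a \<in> EOb C" for a
  proof -
    interpret u: is_functor one_cat "EHom C a a" "C.unit_rep a" using C.unit_rep(1)[OF a] .
    show "I a \<in> Obj (EHom C a a)" unfolding I_def by (rule u.obj_closed) (simp add: one_cat_def)
    have "FA (C.unit_rep a) i = Idt (EHom C a a) (FO (C.unit_rep a) ())" for i
      using u.pres_idt[of "()"] by (simp add: one_cat_def)
    then have "C.unit_rep a = pick (EHom C a a) (I a)"
      by (intro funct_eqI) (simp_all add: I_def)
    then show "EId C a = iso_class one_cat (EHom C a a) (pick (EHom C a a) (I a))"
      using C.unit_rep(2)[OF a] by simp
  qed
  have "\<exists>\<tau>. nat_iso (EHom C b c \<times>\<^sub>C EHom C a b) (BHom E (EFO F a) (EFO F c))
      (BComp E (EFO F a) (EFO F b) (EFO F c) \<circ>\<^sub>F (P b c \<times>\<^sub>F P a b)) (P a c \<circ>\<^sub>F C.comp_rep a b c) \<tau>"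
    if o: "a \<in> EOb C" "b \<in> EOb C" "c \<in> EOb C" for a b c
  proof -
    note X = category_prod[OF C.hom_category[OF o(2,3)] C.hom_category[OF o(1,2)]]
    note Y = category_prod[OF Dc[OF o(2,3)] Dc[OF o(1,2)]]
    note PP = is_functor_fprod[OF P(1)[OF o(2,3)] P(1)[OF o(1,2)]]
    note K = E.comp_functor[OF fo[OF o(1)] fo[OF o(2)] fo[OF o(3)]]
    have "iso_class (EHom C b c \<times>\<^sub>C EHom C a b) (BHom E (EFO F a) (EFO F c)) (P a c \<circ>\<^sub>F C.comp_rep a b c)
      = iso_class (EHom C b c \<times>\<^sub>C EHom C a b) (BHom E (EFO F a) (EFO F c))
        (BComp E (EFO F a) (EFO F b) (EFO F c) \<circ>\<^sub>F (P b c \<times>\<^sub>F P a b))"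
      using F.pres_comp[OF o]
      unfolding Let_def homD[OF o(1,3,2)] homD[OF o(2,3,1)] homD[OF o] compD[OF o] P(2)[OF o(1,2)]
        P(2)[OF o(2,3)] P(2)[OF o(1,3)] C.comp_rep(2)[OF o]
        ho_prod_iso_class[OF C.hom_category[OF o(2,3)] Dc[OF o(2,3)] C.hom_category[OF o(1,2)] Dc[OF o(1,2)]
          P(1)[OF o(2,3)] P(1)[OF o(1,2)]]
        ho_comp_iso_class[OF X C.hom_category[OF o(1,3)] Dc[OF o(1,3)] C.comp_rep(1)[OF o] P(1)[OF o(1,3)]]
        ho_comp_iso_class[OF X Y Dc[OF o(1,3)] PP K] .
    from iso_class_eqD[OF X Dc[OF o(1,3)] is_functor_fcomp[OF PP K] this]
    show ?thesis
      using iso_rel_sym[OF X Dc[OF o(1,3)]] by (auto simp: iso_rel_def)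
  qed
  then obtain \<phi> where \<phi>: "\<And>a b c. \<lbrakk>a \<in> EOb C; b \<in> EOb C; c \<in> EOb C\<rbrakk> \<Longrightarrow>
      nat_iso (EHom C b c \<times>\<^sub>C EHom C a b) (BHom E (EFO F a) (EFO F c))
      (BComp E (EFO F a) (EFO F b) (EFO F c) \<circ>\<^sub>F (P b c \<times>\<^sub>F P a b)) (P a c \<circ>\<^sub>F C.comp_rep a b c) (\<phi> a b c)"
    by metis
  have "\<exists>t. t \<in> iso_arrs (BHom E (EFO F a) (EFO F a)) (BId E (EFO F a)) (FO (P a a) (I a))"
    if a: "a \<in> EOb C" for a
  proof -
    note aa = C.hom_category[OF a a] and Daa = Dc[OF a a]
    note J = is_functor_pick[OF Daa E.id_closed[OF fo[OF a]]]
    have "iso_class one_cat (BHom E (EFO F a) (EFO F a)) (P a a \<circ>\<^sub>F pick (EHom C a a) (I a))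
      = iso_class one_cat (BHom E (EFO F a) (EFO F a)) (pick (BHom E (EFO F a) (EFO F a)) (BId E (EFO F a)))"
      using F.pres_id[OF a]
      unfolding homD[OF a a a] idD[OF a a a] P(2)[OF a a] unit[OF a]
        ho_comp_iso_class[OF category_one aa Daa is_functor_pick[OF aa I[OF a]] P(1)[OF a a]] .
    from iso_rel_sym[OF category_one Daa iso_class_eqD[OF category_one Daa J this]]
    show ?thesis by (auto simp: iso_rel_def nat_iso_def one_cat_def)
  qed
  then obtain \<psi> where \<psi>: "\<And>a. a \<in> EOb C \<Longrightarrow>
      \<psi> a \<in> iso_arrs (BHom E (EFO F a) (EFO F a)) (BId E (EFO F a)) (FO (P a a) (I a))"
    by metis
  interpret lifted_composition E "EOb C" "EHom C" C.comp_rep I "EFO F" P \<phi> \<psi>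
    by (rule lifted_composition.intro[OF E lifted_composition_axioms.intro];
      rule C.hom_category fo P(1) ff C.comp_rep(1) I \<phi> \<psi>; assumption)
  define B where "B = lifted_bicat"
  define Q where "Q = lifted_psfun"
  have Q: "bicategory B" "pseudofunctor B E Q"
    and sel: "BOb B = EOb C" "BHom B = EHom C" "BComp B = C.comp_rep" "BId B = I" "PO Q = EFO F" "PF Q = P"
    unfolding B_def Q_def
    by (fact bicategory_lifted pseudofunctor_lifted lifted_bicat_sel lifted_psfun_sel)+
  have uC: "underlies_bicategory C B"
    using C.comp_rep(2) unit by (simp add: underlies_bicategory_def sel)
  have uQ: "underlies_pseudofunctor F B E Q"
    using P(2) by (simp add: underlies_pseudofunctor_def sel)
  show ?thesis
    using that[OF Q(1) uC Q(2) uQ] .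
qed

theorem theorem2p13:
  fixes C :: "('o, 'h, 'm) hocat" and D :: "('p, 'k, 'n) hocat"
    and F :: "('o, 'h, 'm, 'p, 'k, 'n) hofun"
  assumes "ho_category C" and "ho_category D" and "ho_equivalence C D F"
  shows
    "(\<forall>(\<CC> :: ('o, 'h, 'm) bicat) (\<DD> :: ('p, 'k, 'n) bicat)
        (P :: ('o, 'h, 'm, 'p, 'k, 'n) psfun).
        bicategory \<CC> \<and> bicategory \<DD> \<and> pseudofunctor \<CC> \<DD> P \<and>
        underlies_bicategory C \<CC> \<and> underlies_bicategory D \<DD> \<and>
        underlies_pseudofunctor F \<CC> \<DD> P
        \<longrightarrow> bicategorical_equivalence \<CC> \<DD> P)
    \<and> (\<forall>\<DD> :: ('p, 'k, 'n) bicat.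
        bicategory \<DD> \<and> underlies_bicategory D \<DD>
        \<longrightarrow> (\<exists>(\<CC> :: ('o, 'h, 'm) bicat) (P :: ('o, 'h, 'm, 'p, 'k, 'n) psfun).
              bicategory \<CC> \<and> underlies_bicategory C \<CC> \<and>
              bicategorical_equivalence \<CC> \<DD> P \<and> underlies_pseudofunctor F \<CC> \<DD> P))"
proof (intro conjI allI impI; elim conjE)
  fix \<CC> :: "('o, 'h, 'm) bicat" and \<DD> :: "('p, 'k, 'n) bicat" and P :: "('o, 'h, 'm, 'p, 'k, 'n) psfun"
  assume "bicategory \<DD>" "pseudofunctor \<CC> \<DD> P" "underlies_bicategory C \<CC>"
    "underlies_bicategory D \<DD>" "underlies_pseudofunctor F \<CC> \<DD> P"
  then show "bicategorical_equivalence \<CC> \<DD> P"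
    by (rule bicategorical_equivalence_of_ho_equivalence[OF assms])
next
  fix \<DD> :: "('p, 'k, 'n) bicat"
  assume \<DD>: "bicategory \<DD>" "underlies_bicategory D \<DD>"
  obtain \<CC> :: "('o, 'h, 'm) bicat" and P :: "('o, 'h, 'm, 'p, 'k, 'n) psfun"
    where P: "bicategory \<CC>" "underlies_bicategory C \<CC>" "pseudofunctor \<CC> \<DD> P"
      "underlies_pseudofunctor F \<CC> \<DD> P"
    using ho_equivalence_lifts_bicategory[OF assms \<DD>] .
  moreover have "bicategorical_equivalence \<CC> \<DD> P"
    using bicategorical_equivalence_of_ho_equivalence[OF assms \<DD>(1) P(3,2) \<DD>(2) P(4)] .
  ultimately show "\<exists>(\<CC> :: ('o, 'h, 'm) bicat) (P :: ('o, 'h, 'm, 'p, 'k, 'n) psfun).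
      bicategory \<CC> \<and> underlies_bicategory C \<CC> \<and>
      bicategorical_equivalence \<CC> \<DD> P \<and> underlies_pseudofunctor F \<CC> \<DD> P"
    by blast
qed

end
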